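(* Let $K$ be a field and let $A$ be a (unital) strongly $\mathbb Z$-graded $K$-algebra. Then $I_A=A$ and $\mathrm{Tors}_I(A)=0$. Consequently, the functor $M\mapsto M_0$ induces an equivalence of triples $$\operatorname{proj} A\;\simeq\;\big(\mathsf{Mod}\text{-}A_0,\ A_0,\ -\otimes_{A_0}A_1\big).$$
   Context: All modules are right modules and all algebras are unital. $A=\bigoplus_{n\in\mathbb Z}A_n$ is strongly graded if $A_nA_m=A_{n+m}$ for all $n,m\in\mathbb Z$. $\mathsf{Mod}\text{-}A_0$ is the category of right $A_0$-modules; $\mathsf{Gr}\text{-}A$ is the category of $\mathbb Z$-graded right $A$-modules with degree-preserving homomorphisms; $M(1)$ is the shift, $M(1)_n=M_{n+1}$. For a unital $\mathbb Z$-graded $K$-algebra $A$ put $I_A=A\big(\bigoplus_{n\ne 0}A_n\big)A$, a graded two-sided ideal. A full subcategory of a Grothendieck category is localizing if it is closed under subobjects, quotients, extensions and arbitrary direct sums. $\mathrm{Tors}_I(A)$ is the smallest localizing subcategory of $\mathsf{Gr}\text{-}A$ containing every graded module $M$ with $MI_A=0$. Put $\mathsf{QGr}_I\text{-}A=\mathsf{Gr}\text{-}A/\mathrm{Tors}_I(A)$ (Gabriel quotient), with quotient functor $\pi$. The noncommutative projective scheme of $A$ is the triple $\operatorname{proj}A=(\mathsf{QGr}_I\text{-}A,\ \pi(A_A),\ s)$, where $s$ is the autoequivalence induced by $M\mapsto M(1)$. Two triples $(\mathcal C,\mathcal O,s)$ and $(\mathcal C',\mathcal O',s')$ (category, object,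 autoequivalence) are equivalent, written $\simeq$, if there is an equivalence $G\colon\mathcal C\to\mathcal C'$ with $G(\mathcal O)\cong\mathcal O'$ and a natural isomorphism $G\circ s\cong s'\circ G$. *)

theory Defs
  imports "HOL-Algebra.Module" "HOL-Algebra.Ideal_Product" "HOL-Algebra.QuotRing"
    "HOL-Algebra.Free_Abelian_Groups"
begin

section \<open>Categories, equivalences, triples\<close>

text \<open>
  Hom-sets are indexed by source and target and need not be disjoint; \<open>Comp C X Y Z g f\<close> is the
  composite of \<open>f : X \<rightarrow> Y\<close> followed by \<open>g : Y \<rightarrow> Z\<close>.
\<close>

record ('o, 'f) cat =
  Obj :: "'o set"
  Hom :: "'o \<Rightarrow> 'o \<Rightarrow> 'f set"
  Id :: "'o \<Rightarrow> 'f"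
  Comp :: "'o \<Rightarrow> 'o \<Rightarrow> 'o \<Rightarrow> 'f \<Rightarrow> 'f \<Rightarrow> 'f"

definition is_category :: "('o, 'f) cat \<Rightarrow> bool" where
  "is_category C \<longleftrightarrow>
    (\<forall>X\<in>Obj C. Id C X \<in> Hom C X X) \<and>
    (\<forall>X\<in>Obj C. \<forall>Y\<in>Obj C. \<forall>Z\<in>Obj C. \<forall>f\<in>Hom C X Y. \<forall>g\<in>Hom C Y Z.
       Comp C X Y Z g f \<in> Hom C X Z) \<and>
    (\<forall>X\<in>Obj C. \<forall>Y\<in>Obj C. \<forall>f\<in>Hom C X Y.
       Comp C X X Y f (Id C X) = f \<and> Comp C X Y Y (Id C Y) f = f) \<and>
    (\<forall>W\<in>Obj C. \<forall>X\<in>Obj C. \<forall>Y\<in>Obj C. \<forall>Z\<in>Obj C.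
       \<forall>f\<in>Hom C W X. \<forall>g\<in>Hom C X Y. \<forall>h\<in>Hom C Y Z.
       Comp C W X Z (Comp C X Y Z h g) f = Comp C W Y Z h (Comp C W X Y g f))"

definition is_iso :: "('o, 'f) cat \<Rightarrow> 'o \<Rightarrow> 'o \<Rightarrow> 'f \<Rightarrow> bool" where
  "is_iso C X Y f \<longleftrightarrow> f \<in> Hom C X Y \<and>
    (\<exists>g\<in>Hom C Y X. Comp C X Y X g f = Id C X \<and> Comp C Y X Y f g = Id C Y)"

definition isomorphic :: "('o, 'f) cat \<Rightarrow> 'o \<Rightarrow> 'o \<Rightarrow> bool" where
  "isomorphic C X Y \<longleftrightarrow> (\<exists>f. is_iso C X Y f)"

record ('o, 'f, 'p, 'g) ftor =
  fobj :: "'o \<Rightarrow> 'p"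
  farr :: "'o \<Rightarrow> 'o \<Rightarrow> 'f \<Rightarrow> 'g"

definition is_functor :: "('o, 'f) cat \<Rightarrow> ('p, 'g) cat \<Rightarrow> ('o, 'f, 'p, 'g) ftor \<Rightarrow> bool" where
  "is_functor C D F \<longleftrightarrow>
    (\<forall>X\<in>Obj C. fobj F X \<in> Obj D) \<and>
    (\<forall>X\<in>Obj C. \<forall>Y\<in>Obj C. \<forall>f\<in>Hom C X Y. farr F X Y f \<in> Hom D (fobj F X) (fobj F Y)) \<and>
    (\<forall>X\<in>Obj C. farr F X X (Id C X) = Id D (fobj F X)) \<and>
    (\<forall>X\<in>Obj C. \<forall>Y\<in>Obj C. \<forall>Z\<in>Obj C. \<forall>f\<in>Hom C X Y. \<forall>g\<in>Hom C Y Z.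
       farr F X Z (Comp C X Y Z g f) =
       Comp D (fobj F X) (fobj F Y) (fobj F Z) (farr F Y Z g) (farr F X Y f))"

definition id_ftor :: "('o, 'f, 'o, 'f) ftor" where
  "id_ftor = \<lparr>fobj = (\<lambda>X. X), farr = (\<lambda>X Y f. f)\<rparr>"

definition comp_ftor ::
  "('p, 'g, 'q, 'h) ftor \<Rightarrow> ('o, 'f, 'p, 'g) ftor \<Rightarrow> ('o, 'f, 'q, 'h) ftor"  (infixl \<open>\<circ>\<^sub>F\<close> 55) where
  "G \<circ>\<^sub>F F = \<lparr>fobj = (\<lambda>X. fobj G (fobj F X)),
             farr = (\<lambda>X Y f. farr G (fobj F X) (fobj F Y) (farr F X Y f))\<rparr>"

text \<open>Equality of functors, which only concerns their values on the source category.\<close>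

definition ftor_eq_on ::
  "('o, 'f) cat \<Rightarrow> ('o, 'f, 'p, 'g) ftor \<Rightarrow> ('o, 'f, 'p, 'g) ftor \<Rightarrow> bool" where
  "ftor_eq_on C F G \<longleftrightarrow> (\<forall>X\<in>Obj C. fobj F X = fobj G X) \<and>
    (\<forall>X\<in>Obj C. \<forall>Y\<in>Obj C. \<forall>f\<in>Hom C X Y. farr F X Y f = farr G X Y f)"

definition nat_isomorphic ::
  "('o, 'f) cat \<Rightarrow> ('p, 'g) cat \<Rightarrow> ('o, 'f, 'p, 'g) ftor \<Rightarrow> ('o, 'f, 'p, 'g) ftor \<Rightarrow> bool" where
  "nat_isomorphic C D F G \<longleftrightarrow> (\<exists>\<eta>.
    (\<forall>X\<in>Obj C. is_iso D (fobj F X) (fobj G X) (\<eta> X)) \<and>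
    (\<forall>X\<in>Obj C. \<forall>Y\<in>Obj C. \<forall>f\<in>Hom C X Y.
       Comp D (fobj F X) (fobj F Y) (fobj G Y) (\<eta> Y) (farr F X Y f) =
       Comp D (fobj F X) (fobj G X) (fobj G Y) (farr G X Y f) (\<eta> X)))"

definition is_equivalence ::
  "('o, 'f) cat \<Rightarrow> ('p, 'g) cat \<Rightarrow> ('o, 'f, 'p, 'g) ftor \<Rightarrow> bool" where
  "is_equivalence C D F \<longleftrightarrow> is_functor C D F \<and>
    (\<exists>H. is_functor D C H \<and> nat_isomorphic C C (H \<circ>\<^sub>F F) id_ftor \<and>
         nat_isomorphic D D (F \<circ>\<^sub>F H) id_ftor)"

type_synonym ('o, 'f) triple = "('o, 'f) cat \<times> 'o \<times> ('o, 'f, 'o, 'f) ftor"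

definition is_triple :: "('o, 'f) triple \<Rightarrow> bool" where
  "is_triple t \<longleftrightarrow> (case t of (C, X, s) \<Rightarrow>
    is_category C \<and> X \<in> Obj C \<and> is_equivalence C C s)"

definition is_triple_equivalence ::
  "('o, 'f) triple \<Rightarrow> ('p, 'g) triple \<Rightarrow> ('o, 'f, 'p, 'g) ftor \<Rightarrow> bool" where
  "is_triple_equivalence t t' G \<longleftrightarrow> is_triple t \<and> is_triple t' \<and>
    (case t of (C, X, s) \<Rightarrow> case t' of (C', X', s') \<Rightarrow>
       is_equivalence C C' G \<and> isomorphic C' (fobj G X) X' \<and>
       nat_isomorphic C C' (G \<circ>\<^sub>F s) (s' \<circ>\<^sub>F G))"


section \<open>Right modules and graded right modules\<close>

text \<open>
  As in the library record \<^typ>\<open>('a, 'b) module\<close>, the additive structure is that of a ring record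
  whose fields \<open>mult\<close> and \<open>one\<close> carry no meaning for modules.
\<close>

record ('a, 'm) rmodule = "'m ring" +
  ract :: "['m, 'a] \<Rightarrow> 'm"  (infixl \<open>\<star>\<index>\<close> 70)

locale right_module = R?: ring R + M?: abelian_group M
  for R (structure) and M (structure) +
  assumes ract_closed: "\<lbrakk>x \<in> carrier M; a \<in> carrier R\<rbrakk> \<Longrightarrow> x \<star>\<^bsub>M\<^esub> a \<in> carrier M"
    and ract_l_distr: "\<lbrakk>x \<in> carrier M; y \<in> carrier M; a \<in> carrier R\<rbrakk> \<Longrightarrow>
      (x \<oplus>\<^bsub>M\<^esub> y) \<star>\<^bsub>M\<^esub> a = x \<star>\<^bsub>M\<^esub> a \<oplus>\<^bsub>M\<^esub> y \<star>\<^bsub>M\<^esub> a"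
    and ract_r_distr: "\<lbrakk>x \<in> carrier M; a \<in> carrier R; b \<in> carrier R\<rbrakk> \<Longrightarrow>
      x \<star>\<^bsub>M\<^esub> (a \<oplus>\<^bsub>R\<^esub> b) = x \<star>\<^bsub>M\<^esub> a \<oplus>\<^bsub>M\<^esub> x \<star>\<^bsub>M\<^esub> b"
    and ract_assoc: "\<lbrakk>x \<in> carrier M; a \<in> carrier R; b \<in> carrier R\<rbrakk> \<Longrightarrow>
      (x \<star>\<^bsub>M\<^esub> a) \<star>\<^bsub>M\<^esub> b = x \<star>\<^bsub>M\<^esub> (a \<otimes>\<^bsub>R\<^esub> b)"
    and ract_one: "x \<in> carrier M \<Longrightarrow> x \<star>\<^bsub>M\<^esub> \<one>\<^bsub>R\<^esub> = x"

text \<open>Internal direct sum \<open>G = \<Oplus>\<^sub>i\<^sub>\<in>\<^sub>I B i\<close> of additive subgroups, with \<open>I\<close> possibly infinite.\<close>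

definition direct_sum_of :: "('m, 'z) ring_scheme \<Rightarrow> 'i set \<Rightarrow> ('i \<Rightarrow> 'm set) \<Rightarrow> bool" where
  "direct_sum_of G I B \<longleftrightarrow> (\<forall>i\<in>I. additive_subgroup (B i) G) \<and>
    (\<forall>x\<in>carrier G. \<exists>!c. (\<forall>i\<in>I. c i \<in> B i) \<and> (\<forall>i. i \<notin> I \<longrightarrow> c i = \<zero>\<^bsub>G\<^esub>) \<and>
       finite {i. c i \<noteq> \<zero>\<^bsub>G\<^esub>} \<and> x = finsum G c {i. c i \<noteq> \<zero>\<^bsub>G\<^esub>})"

record ('a, 'm) grmodule = "('a, 'm) rmodule" +
  homog :: "int \<Rightarrow> 'm set"

definition graded_right_module ::
  "('a, 'x) ring_scheme \<Rightarrow> (int \<Rightarrow> 'a set) \<Rightarrow> ('a, 'm, 'y) grmodule_scheme \<Rightarrow> bool" where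
  "graded_right_module A gr M \<longleftrightarrow> right_module A M \<and> direct_sum_of M UNIV (homog M) \<and>
    (\<forall>n m. \<forall>x\<in>homog M n. \<forall>a\<in>gr m. x \<star>\<^bsub>M\<^esub> a \<in> homog M (n + m))"

text \<open>Homomorphisms are extensional functions, so that equality of morphisms is equality in HOL.\<close>

definition rhom ::
  "('a, 'x) ring_scheme \<Rightarrow> ('a, 'm, 'y) rmodule_scheme \<Rightarrow> ('a, 'n, 'z) rmodule_scheme \<Rightarrow> ('m \<Rightarrow> 'n) set"
  where "rhom R M N = {f \<in> carrier M \<rightarrow>\<^sub>E carrier N.
    (\<forall>x\<in>carrier M. \<forall>y\<in>carrier M. f (x \<oplus>\<^bsub>M\<^esub> y) = f x \<oplus>\<^bsub>N\<^esub> f y) \<and>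
    (\<forall>x\<in>carrier M. \<forall>a\<in>carrier R. f (x \<star>\<^bsub>M\<^esub> a) = f x \<star>\<^bsub>N\<^esub> a)}"

definition grhom ::
  "('a, 'x) ring_scheme \<Rightarrow> ('a, 'm, 'y) grmodule_scheme \<Rightarrow> ('a, 'n, 'z) grmodule_scheme \<Rightarrow> ('m \<Rightarrow> 'n) set"
  where "grhom A M N = {f \<in> rhom A M N. \<forall>n. f ` homog M n \<subseteq> homog N n}"

text \<open>
  The type variable \<open>'u\<close> plays the role of the universe: \<open>ModR R\<close> and \<open>GrR A gr\<close> consist of all
  (graded) modules whose carrier is a subset of \<open>'u\<close>. Since \<open>'u\<close> is schematic, a theorem for
  every infinite \<open>'u\<close> into which \<open>A\<close> embeds speaks about modules of all sizes; these two conditions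
  make the universe closed under the tensor products below and under countable direct sums.
\<close>

definition ModR :: "('a, 'x) ring_scheme \<Rightarrow> (('a, 'u) rmodule, 'u \<Rightarrow> 'u) cat" where
  "ModR R = \<lparr>Obj = {M. right_module R M}, Hom = rhom R,
    Id = (\<lambda>M. \<lambda>x\<in>carrier M. x), Comp = (\<lambda>L M N g f. compose (carrier L) g f)\<rparr>"

definition GrR :: "('a, 'x) ring_scheme \<Rightarrow> (int \<Rightarrow> 'a set) \<Rightarrow> (('a, 'u) grmodule, 'u \<Rightarrow> 'u) cat" where
  "GrR A gr = \<lparr>Obj = {M. graded_right_module A gr M}, Hom = grhom A,
    Id = (\<lambda>M. \<lambda>x\<in>carrier M. x), Comp = (\<lambda>L M N g f. compose (carrier L) g f)\<rparr>"

definition shift_module :: "('a, 'u) grmodule \<Rightarrow> ('a, 'u) grmodule" where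
  "shift_module M = M\<lparr>homog := (\<lambda>n. homog M (n + 1))\<rparr>"

definition degree_part :: "('a, 'm) grmodule \<Rightarrow> int \<Rightarrow> ('a, 'm) rmodule" where
  "degree_part M n = (rmodule.truncate M)\<lparr>carrier := homog M n\<rparr>"

definition degree_zero_ftor ::
  "(('a, 'u) grmodule, 'u \<Rightarrow> 'u, ('a, 'u) rmodule, 'u \<Rightarrow> 'u) ftor" where
  "degree_zero_ftor = \<lparr>fobj = (\<lambda>M. degree_part M 0), farr = (\<lambda>M N f. restrict f (homog M 0))\<rparr>"

definition regular_module :: "('a, 'x) ring_scheme \<Rightarrow> (int \<Rightarrow> 'a set) \<Rightarrow> ('a, 'a) grmodule" where
  "regular_module A gr = \<lparr>carrier = carrier A, monoid.mult = monoid.mult A, one = one A, ring.zero = ring.zero A,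
    ring.add = ring.add A, ract = monoid.mult A, homog = gr\<rparr>"


section \<open>Transport of modules into the universe\<close>

text \<open>
  A module with carrier of another type is replaced by an isomorphic copy in \<open>'u\<close>, along some
  injection of its carrier. The choice of injection depends only on the carrier, and it is
  meaningful as soon as one exists.
\<close>

definition emb :: "'v set \<Rightarrow> 'v \<Rightarrow> 'u" where
  "emb S = (SOME e. inj_on e S)"

definition copy_module :: "('a, 'v) rmodule \<Rightarrow> ('a, 'u) rmodule" where
  "copy_module M = (let e = emb (carrier M); d = inv_into (carrier M) e in
    \<lparr>carrier = e ` carrier M,
     monoid.mult = (\<lambda>x y. e (d x \<otimes>\<^bsub>M\<^esub> d y)), one = e \<one>\<^bsub>M\<^esub>, ring.zero = e \<zero>\<^bsub>M\<^esub>,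
     ring.add = (\<lambda>x y. e (d x \<oplus>\<^bsub>M\<^esub> d y)),
     ract = (\<lambda>x a. e (d x \<star>\<^bsub>M\<^esub> a))\<rparr>)"

definition copy_grmodule :: "('a, 'v) grmodule \<Rightarrow> ('a, 'u) grmodule" where
  "copy_grmodule M = rmodule.extend (copy_module (rmodule.truncate M))
     (grmodule.fields (\<lambda>n. emb (carrier M) ` homog M n))"


section \<open>Tensor products\<close>

text \<open>
  \<open>N \<otimes>\<^sub>R B\<close> for a right \<open>R\<close>-module \<open>N\<close> and a bimodule \<open>B\<close> whose left \<open>R\<close>-action is \<open>l\<close>: the free
  abelian group on pairs modulo the biadditivity and balancing relations. The elements of the free
  group are finitely supported integer-valued functions, written additively.
\<close>

definition tensor_free :: "('a, 'm) rmodule \<Rightarrow> ('a, 'b) rmodule \<Rightarrow> (('m \<times> 'b) \<Rightarrow>\<^sub>0 int) monoid" where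
  "tensor_free N B = free_Abelian_group (carrier N \<times> carrier B)"

definition tensor_rels ::
  "('a, 'x) ring_scheme \<Rightarrow> ('a, 'm) rmodule \<Rightarrow> ('a \<Rightarrow> 'b \<Rightarrow> 'b) \<Rightarrow> ('a, 'b) rmodule
    \<Rightarrow> (('m \<times> 'b) \<Rightarrow>\<^sub>0 int) set" where
  "tensor_rels R N l B = generate (tensor_free N B)
    ({frag_of (x \<oplus>\<^bsub>N\<^esub> y, b) - frag_of (x, b) - frag_of (y, b) | x y b.
        x \<in> carrier N \<and> y \<in> carrier N \<and> b \<in> carrier B} \<union>
     {frag_of (x, b \<oplus>\<^bsub>B\<^esub> c) - frag_of (x, b) - frag_of (x, c) | x b c.
        x \<in> carrier N \<and> b \<in> carrier B \<and> c \<in> carrier B} \<union>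
     {frag_of (x \<star>\<^bsub>N\<^esub> r, b) - frag_of (x, l r b) | x r b.
        x \<in> carrier N \<and> r \<in> carrier R \<and> b \<in> carrier B})"

definition tensor ::
  "('a, 'x) ring_scheme \<Rightarrow> ('a, 'm) rmodule \<Rightarrow> ('a \<Rightarrow> 'b \<Rightarrow> 'b) \<Rightarrow> ('a, 'b) rmodule
    \<Rightarrow> ('a, (('m \<times> 'b) \<Rightarrow>\<^sub>0 int) set) rmodule" where
  "tensor R N l B = (let F = tensor_free N B; H = tensor_rels R N l B in
    \<lparr>carrier = carrier (F Mod H), monoid.mult = monoid.mult (F Mod H), one = one (F Mod H),
     ring.zero = one (F Mod H), ring.add = monoid.mult (F Mod H),
     ract = (\<lambda>C a. \<Union>c\<in>C. H #>\<^bsub>F\<^esub> frag_extend (\<lambda>(x, b). frag_of (x, b \<star>\<^bsub>B\<^esub> a)) c)\<rparr>)"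

definition tensor_map ::
  "('a, 'x) ring_scheme \<Rightarrow> ('a \<Rightarrow> 'b \<Rightarrow> 'b) \<Rightarrow> ('a, 'b) rmodule \<Rightarrow> ('a, 'n) rmodule \<Rightarrow> ('m \<Rightarrow> 'n)
    \<Rightarrow> (('m \<times> 'b) \<Rightarrow>\<^sub>0 int) set \<Rightarrow> (('n \<times> 'b) \<Rightarrow>\<^sub>0 int) set" where
  "tensor_map R l B N' f C = (\<Union>c\<in>C. tensor_rels R N' l B #>\<^bsub>tensor_free N' B\<^esub>
     frag_extend (\<lambda>(x, b). frag_of (f x, b)) c)"

definition tensor_ftor ::
  "('a, 'x) ring_scheme \<Rightarrow> ('a \<Rightarrow> 'b \<Rightarrow> 'b) \<Rightarrow> ('a, 'b) rmodule
    \<Rightarrow> (('a, 'u) rmodule, 'u \<Rightarrow> 'u, ('a, 'u) rmodule, 'u \<Rightarrow> 'u) ftor" where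
  "tensor_ftor R l B = \<lparr>
     fobj = (\<lambda>N. copy_module (tensor R N l B)),
     farr = (\<lambda>N N' f.
       let T = carrier (tensor R N l B); T' = carrier (tensor R N' l B) in
       (\<lambda>y\<in>emb T ` T. emb T' (tensor_map R l B N' f (inv_into T (emb T) y))))\<rparr>"


section \<open>Graded algebras\<close>

text \<open>
  \<open>A\<close> is a unital, not necessarily commutative algebra over the field \<open>K\<close>; the library locale
  \<open>algebra\<close> covers only commutative algebras.
\<close>

locale graded_algebra = K: field K + A: ring A + KA: module K A
  for K :: "('k, 'q) ring_scheme" and A :: "('k, 'a, 'x) module_scheme" +
  fixes gr :: "int \<Rightarrow> 'a set"
  assumes smult_mult_l: "\<lbrakk>k \<in> carrier K; a \<in> carrier A; b \<in> carrier A\<rbrakk> \<Longrightarrow>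
      (k \<odot>\<^bsub>A\<^esub> a) \<otimes>\<^bsub>A\<^esub> b = k \<odot>\<^bsub>A\<^esub> (a \<otimes>\<^bsub>A\<^esub> b)"
    and smult_mult_r: "\<lbrakk>k \<in> carrier K; a \<in> carrier A; b \<in> carrier A\<rbrakk> \<Longrightarrow>
      a \<otimes>\<^bsub>A\<^esub> (k \<odot>\<^bsub>A\<^esub> b) = k \<odot>\<^bsub>A\<^esub> (a \<otimes>\<^bsub>A\<^esub> b)"
    and direct_sum: "direct_sum_of A UNIV gr"
    and gr_smult: "\<lbrakk>k \<in> carrier K; a \<in> gr n\<rbrakk> \<Longrightarrow> k \<odot>\<^bsub>A\<^esub> a \<in> gr n"
    and gr_mult: "\<lbrakk>a \<in> gr n; b \<in> gr m\<rbrakk> \<Longrightarrow> a \<otimes>\<^bsub>A\<^esub> b \<in> gr (n + m)"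

text \<open>
  For additive subgroups \<open>I, J\<close>, the library's \<^const>\<open>ideal_prod\<close> is the additive subgroup
  of finite sums of products.
\<close>

locale strongly_graded_algebra = graded_algebra +
  assumes strong: "ideal_prod A (gr n) (gr m) = gr (n + m)"

definition degree_zero_ring :: "('k, 'a, 'x) module_scheme \<Rightarrow> (int \<Rightarrow> 'a set) \<Rightarrow> ('k, 'a, 'x) module_scheme"
  where "degree_zero_ring A gr = A\<lparr>carrier := gr 0\<rparr>"

definition nonzero_degrees :: "('a, 'x) ring_scheme \<Rightarrow> (int \<Rightarrow> 'a set) \<Rightarrow> 'a set" where
  "nonzero_degrees A gr = {finsum A c F | c F. finite F \<and> 0 \<notin> F \<and> (\<forall>n\<in>F. c n \<in> gr n)}"

definition I_ideal :: "('a, 'x) ring_scheme \<Rightarrow> (int \<Rightarrow> 'a set) \<Rightarrow> 'a set" where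
  "I_ideal A gr = ideal_prod A (ideal_prod A (carrier A) (nonzero_degrees A gr)) (carrier A)"


section \<open>Localizing subcategories\<close>

text \<open>
  A full subcategory is given by its class of objects. In the clause on direct sums the object \<open>M\<close>
  is the direct sum of the images of the injections \<open>\<iota> i\<close>. Indices from \<open>'u\<close> suffice: in
  a direct sum lying in the universe, the nonzero summands are indexed by a set embedding into the
  carrier.
\<close>

definition localizing ::
  "('a, 'x) ring_scheme \<Rightarrow> (int \<Rightarrow> 'a set) \<Rightarrow> ('a, 'u) grmodule set \<Rightarrow> bool" where
  "localizing A gr T \<longleftrightarrow> T \<subseteq> Obj (GrR A gr) \<and>
    (\<forall>M\<in>T. \<forall>N\<in>Obj (GrR A gr). \<forall>f\<in>grhom A N M. inj_on f (carrier N) \<longrightarrow> N \<in> T) \<and>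
    (\<forall>M\<in>T. \<forall>N\<in>Obj (GrR A gr). \<forall>f\<in>grhom A M N. f ` carrier M = carrier N \<longrightarrow> N \<in> T) \<and>
    (\<forall>L\<in>T. \<forall>N\<in>T. \<forall>M\<in>Obj (GrR A gr). \<forall>f\<in>grhom A L M. \<forall>g\<in>grhom A M N.
       inj_on f (carrier L) \<and> g ` carrier M = carrier N \<and> f ` carrier L = a_kernel M N g
       \<longrightarrow> M \<in> T) \<and>
    (\<forall>(I :: 'u set) X \<iota>. \<forall>M\<in>Obj (GrR A gr).
       (\<forall>i\<in>I. X i \<in> T \<and> \<iota> i \<in> grhom A (X i) M \<and> inj_on (\<iota> i) (carrier (X i))) \<and>
       direct_sum_of M I (\<lambda>i. \<iota> i ` carrier (X i)) \<longrightarrow> M \<in> T)"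

definition Tors :: "('a, 'x) ring_scheme \<Rightarrow> (int \<Rightarrow> 'a set) \<Rightarrow> ('a, 'u) grmodule set" where
  "Tors A gr = \<Inter>{T. localizing A gr T \<and>
     {M \<in> Obj (GrR A gr). \<forall>x\<in>carrier M. \<forall>a\<in>I_ideal A gr. x \<star>\<^bsub>M\<^esub> a = \<zero>\<^bsub>M\<^esub>} \<subseteq> T}"


section \<open>The Gabriel quotient\<close>

definition sub_grmodule :: "('a, 'm) grmodule \<Rightarrow> 'm set \<Rightarrow> ('a, 'm) grmodule" where
  "sub_grmodule M S = M\<lparr>carrier := S, homog := (\<lambda>n. S \<inter> homog M n)\<rparr>"

definition graded_submodule ::
  "('a, 'x) ring_scheme \<Rightarrow> (int \<Rightarrow> 'a set) \<Rightarrow> ('a, 'm) grmodule \<Rightarrow> 'm set \<Rightarrow> bool" where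
  "graded_submodule A gr M S \<longleftrightarrow> S \<subseteq> carrier M \<and> graded_right_module A gr (sub_grmodule M S)"

definition quot_grmodule :: "('a, 'm) grmodule \<Rightarrow> 'm set \<Rightarrow> ('a, 'm set) grmodule" where
  "quot_grmodule M S = \<lparr>carrier = a_rcosets\<^bsub>M\<^esub> S, monoid.mult = set_add M, one = S, ring.zero = S,
     ring.add = set_add M, ract = (\<lambda>C a. \<Union>x\<in>C. S +>\<^bsub>M\<^esub> (x \<star>\<^bsub>M\<^esub> a)),
     homog = (\<lambda>n. (\<lambda>x. S +>\<^bsub>M\<^esub> x) ` homog M n)\<rparr>"

text \<open>Membership in \<open>T\<close> up to isomorphism, for modules (here: quotients) outside the universe type.\<close>

definition in_class ::
  "('a, 'x) ring_scheme \<Rightarrow> ('a, 'u) grmodule set \<Rightarrow> ('a, 'v) grmodule \<Rightarrow> bool" where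
  "in_class A T Q \<longleftrightarrow> (\<exists>M\<in>T. \<exists>f\<in>grhom A M Q. bij_betw f (carrier M) (carrier Q))"

text \<open>
  Gabriel's description: \<open>Hom(X, Y)\<close> in the quotient by \<open>T\<close> is the filtered colimit of the groups
  \<open>Hom(X', Y/Y')\<close> over \<open>X' \<subseteq> X\<close> with \<open>X/X' \<in> T\<close> and \<open>Y' \<subseteq> Y\<close> with \<open>Y' \<in> T\<close>. A representative is
  a triple \<open>(X', Y', f)\<close>; two of them are identified when they agree after passing to a smaller
  \<open>X'\<close> and a larger \<open>Y'\<close>.
\<close>

type_synonym 'u frac = "'u set \<times> 'u set \<times> ('u \<Rightarrow> 'u set)"

definition cotors_sub ::
  "('a, 'x) ring_scheme \<Rightarrow> (int \<Rightarrow> 'a set) \<Rightarrow> ('a, 'u) grmodule set \<Rightarrow> ('a, 'u) grmodule \<Rightarrow> 'u set \<Rightarrow> bool"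
  where "cotors_sub A gr T X X' \<longleftrightarrow> graded_submodule A gr X X' \<and> in_class A T (quot_grmodule X X')"

definition tors_sub ::
  "('a, 'x) ring_scheme \<Rightarrow> (int \<Rightarrow> 'a set) \<Rightarrow> ('a, 'u) grmodule set \<Rightarrow> ('a, 'u) grmodule \<Rightarrow> 'u set \<Rightarrow> bool"
  where "tors_sub A gr T Y Y' \<longleftrightarrow> graded_submodule A gr Y Y' \<and> sub_grmodule Y Y' \<in> T"

definition fracs ::
  "('a, 'x) ring_scheme \<Rightarrow> (int \<Rightarrow> 'a set) \<Rightarrow> ('a, 'u) grmodule set
    \<Rightarrow> ('a, 'u) grmodule \<Rightarrow> ('a, 'u) grmodule \<Rightarrow> 'u frac set" where
  "fracs A gr T X Y = {(X', Y', f). cotors_sub A gr T X X' \<and> tors_sub A gr T Y Y' \<and>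
     f \<in> grhom A (sub_grmodule X X') (quot_grmodule Y Y')}"

definition frac_rel ::
  "('a, 'x) ring_scheme \<Rightarrow> (int \<Rightarrow> 'a set) \<Rightarrow> ('a, 'u) grmodule set
    \<Rightarrow> ('a, 'u) grmodule \<Rightarrow> ('a, 'u) grmodule \<Rightarrow> ('u frac \<times> 'u frac) set" where
  "frac_rel A gr T X Y = {((X1, Y1, f1), (X2, Y2, f2)).
     (X1, Y1, f1) \<in> fracs A gr T X Y \<and> (X2, Y2, f2) \<in> fracs A gr T X Y \<and>
     (\<exists>X3 Y3. cotors_sub A gr T X X3 \<and> tors_sub A gr T Y Y3 \<and> X3 \<subseteq> X1 \<inter> X2 \<and> Y1 \<union> Y2 \<subseteq> Y3 \<and>
       (\<forall>x\<in>X3. Y3 <+>\<^bsub>Y\<^esub> f1 x = Y3 <+>\<^bsub>Y\<^esub> f2 x))}"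

text \<open>
  The composite of \<open>f : X' \<rightarrow> Y/Y'\<close> and \<open>g : Y'' \<rightarrow> Z/Z'\<close>: restrict \<open>f\<close> to the preimage \<open>X''\<close> of
  \<open>(Y'' + Y')/Y' \<cong> Y''/(Y'' \<inter> Y')\<close>, and let \<open>Z''\<close> be the preimage in \<open>Z\<close> of \<open>g(Y'' \<inter> Y')\<close>; then \<open>g\<close>
  induces \<open>Y''/(Y'' \<inter> Y') \<rightarrow> Z/Z''\<close>. Here \<open>f x\<close> is a coset of \<open>Y'\<close>, and it lies in
  \<open>(Y'' + Y')/Y'\<close> iff it meets \<open>Y''\<close>.
\<close>

fun frac_comp :: "'u frac \<Rightarrow> 'u frac \<Rightarrow> 'u frac" where
  "frac_comp (Y'', Z', g) (X', Y', f) =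
    (let X'' = {x \<in> X'. f x \<inter> Y'' \<noteq> {}}; Z'' = (\<Union>y\<in>Y'' \<inter> Y'. g y) in
     (X'', Z'', \<lambda>x\<in>X''. \<Union>y\<in>f x \<inter> Y''. g y))"

definition frac_of_hom :: "('a, 'u) grmodule \<Rightarrow> ('a, 'u) grmodule \<Rightarrow> ('u \<Rightarrow> 'u) \<Rightarrow> 'u frac" where
  "frac_of_hom X Y f = (carrier X, {\<zero>\<^bsub>Y\<^esub>}, \<lambda>x\<in>carrier X. {\<zero>\<^bsub>Y\<^esub>} +>\<^bsub>Y\<^esub> f x)"

definition gabriel_ftor ::
  "('a, 'x) ring_scheme \<Rightarrow> (int \<Rightarrow> 'a set) \<Rightarrow> ('a, 'u) grmodule set
    \<Rightarrow> (('a, 'u) grmodule, 'u \<Rightarrow> 'u, ('a, 'u) grmodule, 'u frac set) ftor" where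
  "gabriel_ftor A gr T = \<lparr>fobj = (\<lambda>X. X),
     farr = (\<lambda>X Y f. frac_rel A gr T X Y `` {frac_of_hom X Y f})\<rparr>"

definition gabriel_quotient ::
  "('a, 'x) ring_scheme \<Rightarrow> (int \<Rightarrow> 'a set) \<Rightarrow> ('a, 'u) grmodule set
    \<Rightarrow> (('a, 'u) grmodule, 'u frac set) cat" where
  "gabriel_quotient A gr T = \<lparr>Obj = Obj (GrR A gr),
     Hom = (\<lambda>X Y. fracs A gr T X Y // frac_rel A gr T X Y),
     Id = (\<lambda>X. frac_rel A gr T X X `` {frac_of_hom X X (Id (GrR A gr) X)}),
     Comp = (\<lambda>X Y Z \<psi> \<phi>. frac_rel A gr T X Z `` {frac_comp q p | q p. q \<in> \<psi> \<and> p \<in> \<phi>})\<rparr>"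

text \<open>
  The functor induced on the quotient by \<open>M \<mapsto> M(1)\<close>, which on representatives leaves all sets and
  maps unchanged.
\<close>

definition quotient_shift ::
  "('a, 'x) ring_scheme \<Rightarrow> (int \<Rightarrow> 'a set) \<Rightarrow> ('a, 'u) grmodule set
    \<Rightarrow> (('a, 'u) grmodule, 'u frac set, ('a, 'u) grmodule, 'u frac set) ftor" where
  "quotient_shift A gr T = \<lparr>fobj = shift_module,
     farr = (\<lambda>X Y \<phi>. frac_rel A gr T (shift_module X) (shift_module Y) `` \<phi>)\<rparr>"


section \<open>The noncommutative projective scheme and its affine counterpart\<close>

definition proj_triple ::
  "('a, 'x) ring_scheme \<Rightarrow> (int \<Rightarrow> 'a set) \<Rightarrow> (('a, 'u) grmodule, 'u frac set) triple" where
  "proj_triple A gr = (let T = Tors A gr in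
    (gabriel_quotient A gr T,
     fobj (gabriel_ftor A gr T) (copy_grmodule (regular_module A gr)),
     quotient_shift A gr T))"

definition mod_triple ::
  "('k, 'a, 'x) module_scheme \<Rightarrow> (int \<Rightarrow> 'a set) \<Rightarrow> (('a, 'u) rmodule, 'u \<Rightarrow> 'u) triple" where
  "mod_triple A gr = (let R = degree_zero_ring A gr in
    (ModR R,
     copy_module (degree_part (regular_module A gr) 0),
     tensor_ftor R (monoid.mult A) (degree_part (regular_module A gr) 1)))"

end

theory Submission
  imports Defs "HOL-Algebra.Subrings"
begin

text \<open>
  For a strongly graded algebra \<open>1 \<in> A\<^sub>0 = A\<^sub>1 A\<^sub>-\<^sub>1\<close>, so the ideal \<open>I\<^sub>A\<close>, which contains \<open>A\<^sub>1\<close>, is all of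
  \<open>A\<close>. A module annihilated by \<open>A\<close> is zero, and the zero modules form a localizing subcategory; thus
  they are the only torsion modules (\<open>I_ideal_eq\<close>, \<open>Tors_eq\<close>). The Gabriel quotient by the zero modules
  admits no denominators except the trivial ones, so it is the category of graded modules with each
  homomorphism renamed as a fraction (\<open>gabriel_relabelling\<close>).

  It remains to show that \<open>M \<mapsto> M\<^sub>0\<close> is an equivalence from graded \<open>A\<close>-modules to \<open>A\<^sub>0\<close>-modules which
  takes the shift to \<open>- \<otimes> A\<^sub>1\<close>. Both parts rest on one device: for each \<open>n\<close> there is a finite relation
  \<open>1 = \<Sum>\<^sub>i u\<^sub>i v\<^sub>i\<close> with \<open>u\<^sub>i \<in> A\<^sub>-\<^sub>n\<close> and \<open>v\<^sub>i \<in> A\<^sub>n\<close>. It recovers an element \<open>y\<close> of degree \<open>n\<close> as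
  \<open>\<Sum>\<^sub>i (y u\<^sub>i) v\<^sub>i\<close> from elements of degree \<open>0\<close>.

  The quasi-inverse of \<open>M \<mapsto> M\<^sub>0\<close> is taken to be coinduction: \<open>N\<close> goes to the graded module of the
  \<open>A\<^sub>0\<close>-linear maps \<open>A \<rightarrow> N\<close> that vanish on almost all \<open>A\<^sub>m\<close>. Evaluation at \<open>1\<close> identifies its part of
  degree \<open>0\<close> with \<open>N\<close>, and \<open>y \<mapsto> (b \<mapsto> (y b)\<^sub>0)\<close> identifies \<open>M\<close> with the module coinduced from \<open>M\<^sub>0\<close>
  (\<open>coind_counit_bij\<close>, \<open>coind_unit_bij\<close>, \<open>is_equivalence_degree_zero\<close>). The same relation for \<open>n = 1\<close>
  provides the inverse \<open>y \<mapsto> \<Sum>\<^sub>i y u\<^sub>i \<otimes> v\<^sub>i\<close> of the multiplication \<open>M\<^sub>0 \<otimes> A\<^sub>1 \<rightarrow> M\<^sub>1 = M(1)\<^sub>0\<close>, and it is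
  natural in \<open>M\<close> (\<open>section_properties\<close>, \<open>shift_tensor_nat_isomorphic\<close>). That \<open>- \<otimes> A\<^sub>1\<close> is an
  autoequivalence then follows by conjugating the shift (\<open>is_equivalence_conjugate\<close>).

  Modules live in a fixed infinite universe into which \<open>A\<close> embeds. Tensor products and coinduced
  modules fit into it because each of their elements is described by a finite set of tuples
  with entries in the universe, in \<open>A\<close> and in the integers (\<open>tensor_lepoll\<close>, \<open>coind_lepoll\<close>).
\<close>

section \<open>Calculus of functors and natural isomorphisms\<close>

lemma cat_id: "is_category C \<Longrightarrow> X \<in> Obj C \<Longrightarrow> Id C X \<in> Hom C X X"
  unfolding is_category_def by blast

lemma cat_comp:
  "\<lbrakk>is_category C; X \<in> Obj C; Y \<in> Obj C; Z \<in> Obj C; f \<in> Hom C X Y; g \<in> Hom C Y Z\<rbrakk>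
    \<Longrightarrow> Comp C X Y Z g f \<in> Hom C X Z"
  unfolding is_category_def by blast

lemma cat_idr:
  "\<lbrakk>is_category C; X \<in> Obj C; Y \<in> Obj C; f \<in> Hom C X Y\<rbrakk> \<Longrightarrow> Comp C X X Y f (Id C X) = f"
  unfolding is_category_def by blast

lemma cat_idl:
  "\<lbrakk>is_category C; X \<in> Obj C; Y \<in> Obj C; f \<in> Hom C X Y\<rbrakk> \<Longrightarrow> Comp C X Y Y (Id C Y) f = f"
  unfolding is_category_def by blast

lemma cat_assoc:
  "\<lbrakk>is_category C; W \<in> Obj C; X \<in> Obj C; Y \<in> Obj C; Z \<in> Obj C;
    f \<in> Hom C W X; g \<in> Hom C X Y; h \<in> Hom C Y Z\<rbrakk>
    \<Longrightarrow> Comp C W X Z (Comp C X Y Z h g) f = Comp C W Y Z h (Comp C W X Y g f)"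
  unfolding is_category_def by blast

lemma ftor_obj: "is_functor C D F \<Longrightarrow> X \<in> Obj C \<Longrightarrow> fobj F X \<in> Obj D"
  unfolding is_functor_def by blast

lemma ftor_arr:
  "\<lbrakk>is_functor C D F; X \<in> Obj C; Y \<in> Obj C; f \<in> Hom C X Y\<rbrakk>
    \<Longrightarrow> farr F X Y f \<in> Hom D (fobj F X) (fobj F Y)"
  unfolding is_functor_def by blast

lemma ftor_id: "\<lbrakk>is_functor C D F; X \<in> Obj C\<rbrakk> \<Longrightarrow> farr F X X (Id C X) = Id D (fobj F X)"
  unfolding is_functor_def by blast

lemma ftor_comp:
  "\<lbrakk>is_functor C D F; X \<in> Obj C; Y \<in> Obj C; Z \<in> Obj C; f \<in> Hom C X Y; g \<in> Hom C Y Z\<rbrakk>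
    \<Longrightarrow> farr F X Z (Comp C X Y Z g f) =
        Comp D (fobj F X) (fobj F Y) (fobj F Z) (farr F Y Z g) (farr F X Y f)"
  unfolding is_functor_def by blast

lemma fobj_comp_ftor [simp]: "fobj (G \<circ>\<^sub>F F) X = fobj G (fobj F X)"
  by (simp add: comp_ftor_def)

lemma farr_comp_ftor [simp]:
  "farr (G \<circ>\<^sub>F F) X Y f = farr G (fobj F X) (fobj F Y) (farr F X Y f)"
  by (simp add: comp_ftor_def)

lemma fobj_id_ftor [simp]: "fobj id_ftor X = X" and farr_id_ftor [simp]: "farr id_ftor X Y f = f"
  by (simp_all add: id_ftor_def)

lemma comp_ftor_assoc: "(H \<circ>\<^sub>F G) \<circ>\<^sub>F F = H \<circ>\<^sub>F (G \<circ>\<^sub>F F)"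
  by (simp add: comp_ftor_def)

lemma comp_id_ftor [simp]: "id_ftor \<circ>\<^sub>F F = F" "F \<circ>\<^sub>F id_ftor = F"
  by (simp_all add: comp_ftor_def id_ftor_def)

lemma is_functor_comp:
  assumes F: "is_functor B C F" and G: "is_functor C D G"
  shows "is_functor B D (G \<circ>\<^sub>F F)"
  unfolding is_functor_def
  by (simp add: ftor_obj[OF F] ftor_obj[OF G] ftor_arr[OF F] ftor_arr[OF G]
      ftor_id[OF F] ftor_id[OF G] ftor_comp[OF F] ftor_comp[OF G])

lemma is_functor_id: "is_functor C C id_ftor"
  by (simp add: is_functor_def)

lemma is_functor_ftor_eq_on:
  assumes C: "is_category C" and F: "is_functor C D F" and eq: "ftor_eq_on C F G"
  shows "is_functor C D G"
proof -
  have o: "fobj G X = fobj F X" if "X \<in> Obj C" for X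
    using eq that by (simp add: ftor_eq_on_def)
  have a: "farr G X Y f = farr F X Y f" if "X \<in> Obj C" "Y \<in> Obj C" "f \<in> Hom C X Y" for X Y f
    using eq that by (simp add: ftor_eq_on_def)
  show ?thesis
    unfolding is_functor_def
    by (simp add: o a cat_id[OF C] cat_comp[OF C] ftor_obj[OF F] ftor_arr[OF F] ftor_id[OF F]
        ftor_comp[OF F])
qed

subsection \<open>Isomorphisms\<close>

lemma is_iso_obtain:
  assumes "is_iso C X Y f"
  obtains g where "g \<in> Hom C Y X" "Comp C X Y X g f = Id C X" "Comp C Y X Y f g = Id C Y"
  using assms unfolding is_iso_def by blast

lemma is_iso_hom: "is_iso C X Y f \<Longrightarrow> f \<in> Hom C X Y"
  unfolding is_iso_def by blast

lemma is_iso_Id: "is_category C \<Longrightarrow> X \<in> Obj C \<Longrightarrow> is_iso C X X (Id C X)"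
  unfolding is_iso_def by (metis cat_id cat_idl)

lemma is_iso_comp:
  assumes C: "is_category C" and X: "X \<in> Obj C" and Y: "Y \<in> Obj C" and Z: "Z \<in> Obj C"
    and f: "is_iso C X Y f" and g: "is_iso C Y Z g"
  shows "is_iso C X Z (Comp C X Y Z g f)"
proof -
  obtain f' where f': "f' \<in> Hom C Y X" "Comp C X Y X f' f = Id C X" "Comp C Y X Y f f' = Id C Y"
    using is_iso_obtain[OF f] .
  obtain g' where g': "g' \<in> Hom C Z Y" "Comp C Y Z Y g' g = Id C Y" "Comp C Z Y Z g g' = Id C Z"
    using is_iso_obtain[OF g] .
  note fh = is_iso_hom[OF f] and gh = is_iso_hom[OF g]
  note gf = cat_comp[OF C X Y Z fh gh] and fg' = cat_comp[OF C Z Y X g'(1) f'(1)]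
  have "Comp C X Z X (Comp C Z Y X f' g') (Comp C X Y Z g f) =
      Comp C X Y X f' (Comp C X Z Y g' (Comp C X Y Z g f))"
    by (rule cat_assoc[OF C X Z Y X gf g'(1) f'(1)])
  also have "Comp C X Z Y g' (Comp C X Y Z g f) = f"
    using cat_assoc[OF C X Y Z Y fh gh g'(1)] cat_idl[OF C X Y fh] g'(2) by simp
  finally have 1: "Comp C X Z X (Comp C Z Y X f' g') (Comp C X Y Z g f) = Id C X"
    using f'(2) by simp
  have "Comp C Z X Z (Comp C X Y Z g f) (Comp C Z Y X f' g') =
      Comp C Z Y Z g (Comp C Z X Y f (Comp C Z Y X f' g'))"
    by (rule cat_assoc[OF C Z X Y Z fg' fh gh])
  also have "Comp C Z X Y f (Comp C Z Y X f' g') = g'"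
    using cat_assoc[OF C Z Y X Y g'(1) f'(1) fh] cat_idl[OF C Z Y g'(1)] f'(3) by simp
  finally have 2: "Comp C Z X Z (Comp C X Y Z g f) (Comp C Z Y X f' g') = Id C Z"
    using g'(3) by simp
  show ?thesis
    unfolding is_iso_def using 1 2 gf fg' by blast
qed

lemma is_iso_ftor:
  assumes F: "is_functor C D F" and X: "X \<in> Obj C" and Y: "Y \<in> Obj C" and f: "is_iso C X Y f"
  shows "is_iso D (fobj F X) (fobj F Y) (farr F X Y f)"
proof -
  obtain g where g: "g \<in> Hom C Y X" "Comp C X Y X g f = Id C X" "Comp C Y X Y f g = Id C Y"
    using is_iso_obtain[OF f] .
  have fh: "f \<in> Hom C X Y" using f by (rule is_iso_hom)
  have "Comp D (fobj F X) (fobj F Y) (fobj F X) (farr F Y X g) (farr F X Y f) = Id D (fobj F X)"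
    using ftor_comp[OF F X Y X fh g(1)] ftor_id[OF F X] g(2) by simp
  moreover have "Comp D (fobj F Y) (fobj F X) (fobj F Y) (farr F X Y f) (farr F Y X g) = Id D (fobj F Y)"
    using ftor_comp[OF F Y X Y g(1) fh] ftor_id[OF F Y] g(3) by simp
  ultimately show ?thesis
    unfolding is_iso_def using ftor_arr[OF F X Y fh] ftor_arr[OF F Y X g(1)] by blast
qed

text \<open>This is what makes the inverses of the components of a natural isomorphism natural again.\<close>

lemma inverse_square:
  assumes C: "is_category C" and ob: "X \<in> Obj C" "Y \<in> Obj C" "X' \<in> Obj C" "Y' \<in> Obj C"
    and a: "a \<in> Hom C X Y" and a': "a' \<in> Hom C Y X" and aa': "Comp C Y X Y a a' = Id C Y"
    and b: "b \<in> Hom C X' Y'" and b': "b' \<in> Hom C Y' X'" and b'b: "Comp C X' Y' X' b' b = Id C X'"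
    and f: "f \<in> Hom C X X'" and g: "g \<in> Hom C Y Y'"
    and sq: "Comp C X X' Y' b f = Comp C X Y Y' g a"
  shows "Comp C Y Y' X' b' g = Comp C Y X X' f a'"
proof -
  have gaa': "g = Comp C Y X Y' (Comp C X Y Y' g a) a'"
    using cat_assoc[OF C ob(2,1,2,4) a' a g] cat_idr[OF C ob(2,4) g] aa' by simp
  have "Comp C Y Y' X' b' g = Comp C Y Y' X' b' (Comp C Y X Y' (Comp C X X' Y' b f) a')"
    using gaa' sq by simp
  also have "\<dots> = Comp C Y Y' X' b' (Comp C Y X' Y' b (Comp C Y X X' f a'))"
    using cat_assoc[OF C ob(2,1,3,4) a' f b] by simp
  also have "\<dots> = Comp C Y X' X' (Comp C X' Y' X' b' b) (Comp C Y X X' f a')"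
    using cat_assoc[OF C ob(2,3,4,3) cat_comp[OF C ob(2,1,3) a' f] b b'] by simp
  also have "\<dots> = Comp C Y X X' f a'"
    using b'b cat_idl[OF C ob(2,3) cat_comp[OF C ob(2,1,3) a' f]] by simp
  finally show ?thesis .
qed

subsection \<open>Natural isomorphisms\<close>

lemma nat_isomorphicI:
  assumes "\<And>X. X \<in> Obj C \<Longrightarrow> is_iso D (fobj F X) (fobj G X) (\<eta> X)"
    and "\<And>X Y f. \<lbrakk>X \<in> Obj C; Y \<in> Obj C; f \<in> Hom C X Y\<rbrakk> \<Longrightarrow>
      Comp D (fobj F X) (fobj F Y) (fobj G Y) (\<eta> Y) (farr F X Y f) =
      Comp D (fobj F X) (fobj G X) (fobj G Y) (farr G X Y f) (\<eta> X)"
  shows "nat_isomorphic C D F G"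
  unfolding nat_isomorphic_def using assms by blast

lemma nat_isomorphic_ftor_eq_on:
  assumes D: "is_category D" and F: "is_functor C D F" and eq: "ftor_eq_on C F G"
  shows "nat_isomorphic C D F G"
proof (rule nat_isomorphicI[where \<eta> = "\<lambda>X. Id D (fobj F X)"])
  have o: "fobj G X = fobj F X" if "X \<in> Obj C" for X
    using eq that by (simp add: ftor_eq_on_def)
  have a: "farr G X Y f = farr F X Y f" if "X \<in> Obj C" "Y \<in> Obj C" "f \<in> Hom C X Y" for X Y f
    using eq that by (simp add: ftor_eq_on_def)
  show "is_iso D (fobj F X) (fobj G X) (Id D (fobj F X))" if "X \<in> Obj C" for X
    using that o is_iso_Id[OF D] ftor_obj[OF F] by simp
  show "Comp D (fobj F X) (fobj F Y) (fobj G Y) (Id D (fobj F Y)) (farr F X Y f) =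
        Comp D (fobj F X) (fobj G X) (fobj G Y) (farr G X Y f) (Id D (fobj F X))"
    if "X \<in> Obj C" "Y \<in> Obj C" "f \<in> Hom C X Y" for X Y f
    using that by (simp add: o a cat_idl[OF D] cat_idr[OF D] ftor_obj[OF F] ftor_arr[OF F])
qed

lemma nat_isomorphic_sym:
  assumes D: "is_category D" and F: "is_functor C D F" and G: "is_functor C D G"
    and FG: "nat_isomorphic C D F G"
  shows "nat_isomorphic C D G F"
proof -
  obtain \<eta> where iso: "\<And>X. X \<in> Obj C \<Longrightarrow> is_iso D (fobj F X) (fobj G X) (\<eta> X)"
    and nat: "\<And>X Y f. \<lbrakk>X \<in> Obj C; Y \<in> Obj C; f \<in> Hom C X Y\<rbrakk> \<Longrightarrow>
      Comp D (fobj F X) (fobj F Y) (fobj G Y) (\<eta> Y) (farr F X Y f) =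
      Comp D (fobj F X) (fobj G X) (fobj G Y) (farr G X Y f) (\<eta> X)"
    using FG unfolding nat_isomorphic_def by blast
  have "\<forall>X. \<exists>g. X \<in> Obj C \<longrightarrow> g \<in> Hom D (fobj G X) (fobj F X) \<and>
      Comp D (fobj F X) (fobj G X) (fobj F X) g (\<eta> X) = Id D (fobj F X) \<and>
      Comp D (fobj G X) (fobj F X) (fobj G X) (\<eta> X) g = Id D (fobj G X)"
    using iso unfolding is_iso_def by blast
  then obtain \<theta> where \<theta>: "\<And>X. X \<in> Obj C \<Longrightarrow> \<theta> X \<in> Hom D (fobj G X) (fobj F X) \<and>
      Comp D (fobj F X) (fobj G X) (fobj F X) (\<theta> X) (\<eta> X) = Id D (fobj F X) \<and>
      Comp D (fobj G X) (fobj F X) (fobj G X) (\<eta> X) (\<theta> X) = Id D (fobj G X)"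
    by metis
  show ?thesis
  proof (rule nat_isomorphicI[where \<eta> = \<theta>])
    show "is_iso D (fobj G X) (fobj F X) (\<theta> X)" if "X \<in> Obj C" for X
      using \<theta>[OF that] is_iso_hom[OF iso[OF that]] unfolding is_iso_def by blast
    show "Comp D (fobj G X) (fobj G Y) (fobj F Y) (\<theta> Y) (farr G X Y f) =
          Comp D (fobj G X) (fobj F X) (fobj F Y) (farr F X Y f) (\<theta> X)"
      if X: "X \<in> Obj C" and Y: "Y \<in> Obj C" and f: "f \<in> Hom C X Y" for X Y f
      by (rule inverse_square[OF D, where a = "\<eta> X" and b = "\<eta> Y"])
        (use \<theta> X Y f iso nat in \<open>auto intro: ftor_obj[OF F] ftor_obj[OF G] ftor_arr[OF F]
          ftor_arr[OF G] is_iso_hom\<close>)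
  qed
qed

lemma nat_isomorphic_trans:
  assumes D: "is_category D" and F: "is_functor C D F" and G: "is_functor C D G"
    and H: "is_functor C D H"
    and FG: "nat_isomorphic C D F G" and GH: "nat_isomorphic C D G H"
  shows "nat_isomorphic C D F H"
proof -
  obtain \<eta> where iso: "\<And>X. X \<in> Obj C \<Longrightarrow> is_iso D (fobj F X) (fobj G X) (\<eta> X)"
    and nat: "\<And>X Y f. \<lbrakk>X \<in> Obj C; Y \<in> Obj C; f \<in> Hom C X Y\<rbrakk> \<Longrightarrow>
      Comp D (fobj F X) (fobj F Y) (fobj G Y) (\<eta> Y) (farr F X Y f) =
      Comp D (fobj F X) (fobj G X) (fobj G Y) (farr G X Y f) (\<eta> X)"
    using FG unfolding nat_isomorphic_def by blast
  obtain \<theta> where iso': "\<And>X. X \<in> Obj C \<Longrightarrow> is_iso D (fobj G X) (fobj H X) (\<theta> X)"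
    and nat': "\<And>X Y f. \<lbrakk>X \<in> Obj C; Y \<in> Obj C; f \<in> Hom C X Y\<rbrakk> \<Longrightarrow>
      Comp D (fobj G X) (fobj G Y) (fobj H Y) (\<theta> Y) (farr G X Y f) =
      Comp D (fobj G X) (fobj H X) (fobj H Y) (farr H X Y f) (\<theta> X)"
    using GH unfolding nat_isomorphic_def by blast
  show ?thesis
  proof (rule nat_isomorphicI)
    show "is_iso D (fobj F X) (fobj H X) (Comp D (fobj F X) (fobj G X) (fobj H X) (\<theta> X) (\<eta> X))"
      if "X \<in> Obj C" for X
      by (intro is_iso_comp[OF D] iso iso' that ftor_obj[OF F] ftor_obj[OF G] ftor_obj[OF H])
    show "Comp D (fobj F X) (fobj F Y) (fobj H Y)
            (Comp D (fobj F Y) (fobj G Y) (fobj H Y) (\<theta> Y) (\<eta> Y)) (farr F X Y f) =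
          Comp D (fobj F X) (fobj H X) (fobj H Y) (farr H X Y f)
            (Comp D (fobj F X) (fobj G X) (fobj H X) (\<theta> X) (\<eta> X))"
      if X: "X \<in> Obj C" and Y: "Y \<in> Obj C" and f: "f \<in> Hom C X Y" for X Y f
    proof -
      note obs = ftor_obj[OF F X] ftor_obj[OF F Y] ftor_obj[OF G X] ftor_obj[OF G Y]
        ftor_obj[OF H X] ftor_obj[OF H Y]
      note Ff = ftor_arr[OF F X Y f] and Gf = ftor_arr[OF G X Y f] and Hf = ftor_arr[OF H X Y f]
      note \<eta>X = is_iso_hom[OF iso[OF X]] and \<eta>Y = is_iso_hom[OF iso[OF Y]]
      note \<theta>X = is_iso_hom[OF iso'[OF X]] and \<theta>Y = is_iso_hom[OF iso'[OF Y]]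
      show ?thesis
        using cat_assoc[OF D obs(1,2,4,6) Ff \<eta>Y \<theta>Y] cat_assoc[OF D obs(1,3,4,6) \<eta>X Gf \<theta>Y]
          cat_assoc[OF D obs(1,3,5,6) \<eta>X \<theta>X Hf] nat[OF X Y f] nat'[OF X Y f] by simp
    qed
  qed
qed

lemma nat_isomorphic_whisker_right:
  assumes "is_functor B C F" and "nat_isomorphic C D G H"
  shows "nat_isomorphic B D (G \<circ>\<^sub>F F) (H \<circ>\<^sub>F F)"
proof -
  obtain \<eta> where "\<And>X. X \<in> Obj C \<Longrightarrow> is_iso D (fobj G X) (fobj H X) (\<eta> X)"
    and "\<And>X Y f. \<lbrakk>X \<in> Obj C; Y \<in> Obj C; f \<in> Hom C X Y\<rbrakk> \<Longrightarrow>
      Comp D (fobj G X) (fobj G Y) (fobj H Y) (\<eta> Y) (farr G X Y f) =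
      Comp D (fobj G X) (fobj H X) (fobj H Y) (farr H X Y f) (\<eta> X)"
    using assms(2) unfolding nat_isomorphic_def by blast
  then show ?thesis
    by (intro nat_isomorphicI[where \<eta> = "\<lambda>X. \<eta> (fobj F X)"])
      (simp_all add: ftor_obj[OF assms(1)] ftor_arr[OF assms(1)])
qed

lemma nat_isomorphic_whisker_left:
  assumes F: "is_functor B C F" and G: "is_functor B C G" and K: "is_functor C D K"
    and FG: "nat_isomorphic B C F G"
  shows "nat_isomorphic B D (K \<circ>\<^sub>F F) (K \<circ>\<^sub>F G)"
proof -
  obtain \<eta> where iso: "\<And>X. X \<in> Obj B \<Longrightarrow> is_iso C (fobj F X) (fobj G X) (\<eta> X)"
    and nat: "\<And>X Y f. \<lbrakk>X \<in> Obj B; Y \<in> Obj B; f \<in> Hom B X Y\<rbrakk> \<Longrightarrow>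
      Comp C (fobj F X) (fobj F Y) (fobj G Y) (\<eta> Y) (farr F X Y f) =
      Comp C (fobj F X) (fobj G X) (fobj G Y) (farr G X Y f) (\<eta> X)"
    using FG unfolding nat_isomorphic_def by blast
  show ?thesis
  proof (rule nat_isomorphicI[where \<eta> = "\<lambda>X. farr K (fobj F X) (fobj G X) (\<eta> X)"])
    show "is_iso D (fobj (K \<circ>\<^sub>F F) X) (fobj (K \<circ>\<^sub>F G) X) (farr K (fobj F X) (fobj G X) (\<eta> X))"
      if "X \<in> Obj B" for X
      using that by (simp add: is_iso_ftor[OF K] ftor_obj[OF F] ftor_obj[OF G] iso)
    show "Comp D (fobj (K \<circ>\<^sub>F F) X) (fobj (K \<circ>\<^sub>F F) Y) (fobj (K \<circ>\<^sub>F G) Y)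
            (farr K (fobj F Y) (fobj G Y) (\<eta> Y)) (farr (K \<circ>\<^sub>F F) X Y f) =
          Comp D (fobj (K \<circ>\<^sub>F F) X) (fobj (K \<circ>\<^sub>F G) X) (fobj (K \<circ>\<^sub>F G) Y)
            (farr (K \<circ>\<^sub>F G) X Y f) (farr K (fobj F X) (fobj G X) (\<eta> X))"
      if X: "X \<in> Obj B" and Y: "Y \<in> Obj B" and f: "f \<in> Hom B X Y" for X Y f
      using nat[OF X Y f]
        ftor_comp[OF K ftor_obj[OF F X] ftor_obj[OF F Y] ftor_obj[OF G Y]
          ftor_arr[OF F X Y f] is_iso_hom[OF iso[OF Y]]]
        ftor_comp[OF K ftor_obj[OF F X] ftor_obj[OF G X] ftor_obj[OF G Y]
          is_iso_hom[OF iso[OF X]] ftor_arr[OF G X Y f]]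
      by simp
  qed
qed

subsection \<open>Equivalences\<close>

lemma is_equivalence_functor: "is_equivalence C D F \<Longrightarrow> is_functor C D F"
  unfolding is_equivalence_def by blast

lemma is_equivalenceI:
  assumes "is_functor C D F" "is_functor D C H"
    and "nat_isomorphic C C (H \<circ>\<^sub>F F) id_ftor" "nat_isomorphic D D (F \<circ>\<^sub>F H) id_ftor"
  shows "is_equivalence C D F"
  using assms unfolding is_equivalence_def by blast

lemma is_equivalence_obtain:
  assumes "is_equivalence C D F"
  obtains H where "is_functor D C H" "nat_isomorphic C C (H \<circ>\<^sub>F F) id_ftor"
    "nat_isomorphic D D (F \<circ>\<^sub>F H) id_ftor"
  using assms unfolding is_equivalence_def by blast

text \<open>
  Whiskering \<open>G F \<cong> id\<close> on both sides gives \<open>K G F H \<cong> K H\<close>. Used once on each side, this shows that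
  the composite of two quasi-inverses is a quasi-inverse of the composite.
\<close>

lemma nat_isomorphic_cancel_middle:
  assumes cat: "is_category B" "is_category C"
    and F: "is_functor C D F" and G: "is_functor D C G" and H: "is_functor B C H"
    and K: "is_functor C B K"
    and GF: "nat_isomorphic C C (G \<circ>\<^sub>F F) id_ftor" and KH: "nat_isomorphic B B (K \<circ>\<^sub>F H) id_ftor"
  shows "nat_isomorphic B B ((K \<circ>\<^sub>F G) \<circ>\<^sub>F (F \<circ>\<^sub>F H)) id_ftor"
proof -
  have "nat_isomorphic B C ((G \<circ>\<^sub>F F) \<circ>\<^sub>F H) (id_ftor \<circ>\<^sub>F H)"
    by (rule nat_isomorphic_whisker_right[OF H GF])
  then have "nat_isomorphic B B (K \<circ>\<^sub>F ((G \<circ>\<^sub>F F) \<circ>\<^sub>F H)) (K \<circ>\<^sub>F H)"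
    using nat_isomorphic_whisker_left[OF _ H K] is_functor_comp[OF H is_functor_comp[OF F G]] by simp
  moreover have "is_functor B B (K \<circ>\<^sub>F ((G \<circ>\<^sub>F F) \<circ>\<^sub>F H))" "is_functor B B (K \<circ>\<^sub>F H)"
    using is_functor_comp[OF is_functor_comp[OF H is_functor_comp[OF F G]] K] is_functor_comp[OF H K]
    by blast+
  ultimately show ?thesis
    using nat_isomorphic_trans[OF cat(1) _ _ is_functor_id _ KH] by (simp add: comp_ftor_assoc)
qed

lemma is_equivalence_comp:
  assumes cat: "is_category B" "is_category C" "is_category D"
    and F: "is_equivalence B C F" and G: "is_equivalence C D G"
  shows "is_equivalence B D (G \<circ>\<^sub>F F)"
proof -
  obtain F' where F': "is_functor C B F'" "nat_isomorphic B B (F' \<circ>\<^sub>F F) id_ftor"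
    "nat_isomorphic C C (F \<circ>\<^sub>F F') id_ftor"
    using is_equivalence_obtain[OF F] .
  obtain G' where G': "is_functor D C G'" "nat_isomorphic C C (G' \<circ>\<^sub>F G) id_ftor"
    "nat_isomorphic D D (G \<circ>\<^sub>F G') id_ftor"
    using is_equivalence_obtain[OF G] .
  note Fn = is_equivalence_functor[OF F] is_equivalence_functor[OF G]
  show ?thesis
    by (rule is_equivalenceI[OF is_functor_comp[OF Fn] is_functor_comp[OF G'(1) F'(1)]
          nat_isomorphic_cancel_middle[OF cat(1,2) Fn(2) G'(1) Fn(1) F'(1) G'(2) F'(2)]
          nat_isomorphic_cancel_middle[OF cat(3,2) F'(1) Fn(1) G'(1) Fn(2) F'(3) G'(3)]])
qed

lemma is_equivalence_nat_isomorphic: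
  assumes cat: "is_category C" "is_category D"
    and F: "is_equivalence C D F" and G: "is_functor C D G" and FG: "nat_isomorphic C D F G"
  shows "is_equivalence C D G"
proof -
  obtain H where H: "is_functor D C H" "nat_isomorphic C C (H \<circ>\<^sub>F F) id_ftor"
    "nat_isomorphic D D (F \<circ>\<^sub>F H) id_ftor"
    using is_equivalence_obtain[OF F] .
  note Ff = is_equivalence_functor[OF F]
  note GF = nat_isomorphic_sym[OF cat(2) Ff G FG]
  show ?thesis
    by (intro is_equivalenceI[OF G H(1)]
        nat_isomorphic_trans[OF cat(1) is_functor_comp[OF G H(1)] is_functor_comp[OF Ff H(1)]
          is_functor_id nat_isomorphic_whisker_left[OF G Ff H(1) GF] H(2)]
        nat_isomorphic_trans[OF cat(2) is_functor_comp[OF H(1) G] is_functor_comp[OF H(1) Ff]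
          is_functor_id nat_isomorphic_whisker_right[OF H(1) GF] H(3)])
qed

text \<open>
  If \<open>H\<close> is a quasi-inverse of \<open>G\<close>, then \<open>t \<cong> t G H \<cong> G s H\<close> is a composite of equivalences. In this
  way \<open>- \<otimes> A\<^sub>1\<close> is recognised as an autoequivalence from the fact that the shift is one, without
  exhibiting the inverse \<open>- \<otimes> A\<^sub>-\<^sub>1\<close>.
\<close>

lemma is_equivalence_conjugate:
  assumes cat: "is_category C" "is_category D"
    and G: "is_equivalence C D G" and s: "is_equivalence C C s" and t: "is_functor D D t"
    and Gs: "nat_isomorphic C D (G \<circ>\<^sub>F s) (t \<circ>\<^sub>F G)"
  shows "is_equivalence D D t"
proof -
  obtain H where H: "is_functor D C H" "nat_isomorphic C C (H \<circ>\<^sub>F G) id_ftor"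
    "nat_isomorphic D D (G \<circ>\<^sub>F H) id_ftor"
    using is_equivalence_obtain[OF G] .
  note Gf = is_equivalence_functor[OF G] and sf = is_equivalence_functor[OF s]
  have He: "is_equivalence D C H"
    using is_equivalenceI[OF H(1) Gf H(3,2)] .
  have eqv: "is_equivalence D D ((G \<circ>\<^sub>F s) \<circ>\<^sub>F H)"
    using is_equivalence_comp[OF cat(2,1,2) He is_equivalence_comp[OF cat(1,1,2) s G]] .
  have "nat_isomorphic D D ((G \<circ>\<^sub>F s) \<circ>\<^sub>F H) ((t \<circ>\<^sub>F G) \<circ>\<^sub>F H)"
    by (rule nat_isomorphic_whisker_right[OF H(1) Gs])
  moreover have "nat_isomorphic D D ((t \<circ>\<^sub>F G) \<circ>\<^sub>F H) t"
    using nat_isomorphic_whisker_left[OF is_functor_comp[OF H(1) Gf] is_functor_id t H(3)]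
    by (simp add: comp_ftor_assoc)
  moreover have "is_functor D D ((G \<circ>\<^sub>F s) \<circ>\<^sub>F H)" "is_functor D D ((t \<circ>\<^sub>F G) \<circ>\<^sub>F H)"
    using is_functor_comp[OF H(1) is_functor_comp[OF sf Gf]] is_functor_comp[OF H(1) is_functor_comp[OF Gf t]]
    by blast+
  ultimately have "nat_isomorphic D D ((G \<circ>\<^sub>F s) \<circ>\<^sub>F H) t"
    using nat_isomorphic_trans[OF cat(2)] t by blast
  then show ?thesis
    using is_equivalence_nat_isomorphic[OF cat(2,2) eqv t] by blast
qed

subsection \<open>Relabelling the morphisms of a category\<close>

text \<open>
  The situation of a quotient by a trivial subcategory: \<open>D\<close> has the objects of \<open>C\<close>, and its
  morphisms are other names \<open>P f\<close> for those of \<open>C\<close>. The functor \<open>unlabel C P\<close> forgets the renaming.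
\<close>

definition unlabel ::
  "('o, 'f) cat \<Rightarrow> ('o, 'f, 'o, 'g) ftor \<Rightarrow> ('o, 'g, 'o, 'f) ftor" where
  "unlabel C P = \<lparr>fobj = (\<lambda>X. X), farr = (\<lambda>X Y. inv_into (Hom C X Y) (farr P X Y))\<rparr>"

locale relabelling =
  fixes C :: "('o, 'f) cat" and D :: "('o, 'g) cat" and P :: "('o, 'f, 'o, 'g) ftor"
  assumes cat: "is_category C"
    and Obj_eq: "Obj D = Obj C"
    and fobj_eq: "fobj P X = X"
    and bij: "\<lbrakk>X \<in> Obj C; Y \<in> Obj C\<rbrakk> \<Longrightarrow> bij_betw (farr P X Y) (Hom C X Y) (Hom D X Y)"
    and Id_eq: "X \<in> Obj C \<Longrightarrow> Id D X = farr P X X (Id C X)"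
    and Comp_eq: "\<lbrakk>X \<in> Obj C; Y \<in> Obj C; Z \<in> Obj C; f \<in> Hom C X Y; g \<in> Hom C Y Z\<rbrakk>
      \<Longrightarrow> Comp D X Y Z (farr P Y Z g) (farr P X Y f) = farr P X Z (Comp C X Y Z g f)"
begin

lemma Hom_cases:
  assumes "X \<in> Obj C" "Y \<in> Obj C" "\<phi> \<in> Hom D X Y"
  obtains f where "f \<in> Hom C X Y" "\<phi> = farr P X Y f"
  using bij[OF assms(1,2)] assms(3) unfolding bij_betw_def by blast

lemma farr_in_Hom: "\<lbrakk>X \<in> Obj C; Y \<in> Obj C; f \<in> Hom C X Y\<rbrakk> \<Longrightarrow> farr P X Y f \<in> Hom D X Y"
  using bij unfolding bij_betw_def by blast

lemma unlabel_farr: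
  "\<lbrakk>X \<in> Obj C; Y \<in> Obj C; f \<in> Hom C X Y\<rbrakk> \<Longrightarrow> farr (unlabel C P) X Y (farr P X Y f) = f"
  unfolding unlabel_def using bij by (simp add: bij_betw_def inv_into_f_f)

lemma fobj_unlabel: "fobj (unlabel C P) X = X"
  by (simp add: unlabel_def)

lemma is_category_target: "is_category D"
  unfolding is_category_def Obj_eq
proof (intro conjI ballI)
  fix X Y assume X: "X \<in> Obj C" and Y: "Y \<in> Obj C"
  show "Id D X \<in> Hom D X X"
    using X by (simp add: Id_eq farr_in_Hom cat_id[OF cat])
  fix \<phi> assume "\<phi> \<in> Hom D X Y"
  then obtain f where f: "f \<in> Hom C X Y" "\<phi> = farr P X Y f"
    using Hom_cases[OF X Y] by blast
  show "Comp D X X Y \<phi> (Id D X) = \<phi>" "Comp D X Y Y (Id D Y) \<phi> = \<phi>"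
    using X Y f by (simp_all add: Id_eq Comp_eq cat_id[OF cat] cat_idl[OF cat] cat_idr[OF cat])
  fix Z \<psi> assume Z: "Z \<in> Obj C" and "\<psi> \<in> Hom D Y Z"
  then obtain g where g: "g \<in> Hom C Y Z" "\<psi> = farr P Y Z g"
    using Hom_cases[OF Y Z] by blast
  show "Comp D X Y Z \<psi> \<phi> \<in> Hom D X Z"
    using X Y Z f g by (simp add: Comp_eq cat_comp[OF cat] farr_in_Hom)
next
  fix W X Y Z \<phi> \<psi> \<chi>
  assume ob: "W \<in> Obj C" "X \<in> Obj C" "Y \<in> Obj C" "Z \<in> Obj C"
    and "\<phi> \<in> Hom D W X" "\<psi> \<in> Hom D X Y" "\<chi> \<in> Hom D Y Z"
  then obtain f g h where "f \<in> Hom C W X" "\<phi> = farr P W X f" "g \<in> Hom C X Y" "\<psi> = farr P X Y g"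
    "h \<in> Hom C Y Z" "\<chi> = farr P Y Z h"
    using Hom_cases by metis
  then show "Comp D W X Z (Comp D X Y Z \<chi> \<psi>) \<phi> = Comp D W Y Z \<chi> (Comp D W X Y \<psi> \<phi>)"
    using ob by (simp add: Comp_eq cat_comp[OF cat] cat_assoc[OF cat])
qed

lemma is_functor_relabel: "is_functor C D P"
  unfolding is_functor_def by (simp add: fobj_eq Obj_eq farr_in_Hom Id_eq Comp_eq)

lemma is_functor_unlabel: "is_functor D C (unlabel C P)"
  unfolding is_functor_def fobj_unlabel Obj_eq
proof (intro conjI ballI)
  fix X Y assume X: "X \<in> Obj C" and Y: "Y \<in> Obj C"
  show "X \<in> Obj C" by fact
  show "farr (unlabel C P) X X (Id D X) = Id C X"
    using X by (simp add: Id_eq unlabel_farr cat_id[OF cat])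
  fix \<phi> assume "\<phi> \<in> Hom D X Y"
  then obtain f where f: "f \<in> Hom C X Y" "\<phi> = farr P X Y f"
    using Hom_cases[OF X Y] by blast
  show "farr (unlabel C P) X Y \<phi> \<in> Hom C X Y"
    using X Y f by (simp add: unlabel_farr)
  fix Z \<psi> assume Z: "Z \<in> Obj C" and "\<psi> \<in> Hom D Y Z"
  then obtain g where g: "g \<in> Hom C Y Z" "\<psi> = farr P Y Z g"
    using Hom_cases[OF Y Z] by blast
  show "farr (unlabel C P) X Z (Comp D X Y Z \<psi> \<phi>) =
      Comp C X Y Z (farr (unlabel C P) Y Z \<psi>) (farr (unlabel C P) X Y \<phi>)"
    using X Y Z f g by (simp add: Comp_eq unlabel_farr cat_comp[OF cat])
qed

lemma unlabel_relabel: "ftor_eq_on C (unlabel C P \<circ>\<^sub>F P) id_ftor"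
  unfolding ftor_eq_on_def by (simp add: fobj_eq fobj_unlabel unlabel_farr)

lemma relabel_unlabel: "ftor_eq_on D (P \<circ>\<^sub>F unlabel C P) id_ftor"
  unfolding ftor_eq_on_def
  by (auto simp: fobj_eq fobj_unlabel Obj_eq unlabel_farr elim!: Hom_cases[rotated 2])

lemma is_equivalence_relabel: "is_equivalence C D P"
  and is_equivalence_unlabel: "is_equivalence D C (unlabel C P)"
proof -
  have "nat_isomorphic C C (unlabel C P \<circ>\<^sub>F P) id_ftor" "nat_isomorphic D D (P \<circ>\<^sub>F unlabel C P) id_ftor"
    using nat_isomorphic_ftor_eq_on[OF cat is_functor_comp[OF is_functor_relabel is_functor_unlabel]
        unlabel_relabel]
      nat_isomorphic_ftor_eq_on[OF is_category_target
        is_functor_comp[OF is_functor_unlabel is_functor_relabel] relabel_unlabel] by blast+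
  then show "is_equivalence C D P" "is_equivalence D C (unlabel C P)"
    using is_equivalenceI is_functor_relabel is_functor_unlabel by blast+
qed

end

section \<open>Gradings and their projections\<close>

lemma additive_in: "\<lbrakk>h \<in> hom (add_monoid G) (add_monoid H); x \<in> carrier G\<rbrakk> \<Longrightarrow> h x \<in> carrier H"
  by (auto simp: hom_def)

lemma additive_add:
  "\<lbrakk>h \<in> hom (add_monoid G) (add_monoid H); x \<in> carrier G; y \<in> carrier G\<rbrakk>
    \<Longrightarrow> h (x \<oplus>\<^bsub>G\<^esub> y) = h x \<oplus>\<^bsub>H\<^esub> h y"
  by (auto simp: hom_def)

lemma additive_zero:
  assumes "abelian_group G" "abelian_group H" "h \<in> hom (add_monoid G) (add_monoid H)"
  shows "h \<zero>\<^bsub>G\<^esub> = \<zero>\<^bsub>H\<^esub>"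
proof -
  have "group (add_monoid G)" "group (add_monoid H)"
    using assms(1,2) abelian_group.a_group by blast+
  then show ?thesis
    using group_hom.hom_one[of "add_monoid G" "add_monoid H" h] assms(3)
    by (simp add: group_hom_def group_hom_axioms_def)
qed

lemma additive_a_inv:
  assumes "abelian_group G" "abelian_group H" "h \<in> hom (add_monoid G) (add_monoid H)"
    and "x \<in> carrier G"
  shows "h (\<ominus>\<^bsub>G\<^esub> x) = \<ominus>\<^bsub>H\<^esub> h x"
proof -
  have "group (add_monoid G)" "group (add_monoid H)"
    using assms(1,2) abelian_group.a_group by blast+
  then show ?thesis
    using group_hom.hom_inv[of "add_monoid G" "add_monoid H" h x] assms(3,4)
    by (simp add: group_hom_def group_hom_axioms_def a_inv_def)
qed

lemma additive_finsum:
  assumes G: "abelian_group G" and H: "abelian_group H" and h: "h \<in> hom (add_monoid G) (add_monoid H)"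
    and c: "c \<in> F \<rightarrow> carrier G"
  shows "h (finsum G c F) = finsum H (\<lambda>i. h (c i)) F"
proof -
  interpret G: abelian_group G by fact
  interpret H: abelian_group H by fact
  show ?thesis
    using c
  proof (induction F rule: infinite_finite_induct)
    case (insert i F)
    have "(\<lambda>i. h (c i)) \<in> F \<rightarrow> carrier H" "h (c i) \<in> carrier H"
      using insert.prems h by (auto simp: hom_def)
    then show ?case
      using insert by (simp add: additive_add[OF h])
  qed (simp_all add: additive_zero[OF G H h])
qed

text \<open>
  A grading amounts to a family of projections: additive idempotents onto the homogeneous parts
  which kill the other parts, of which only finitely many are nonzero at any given element, and
  which separate points. In this form a grading can be checked without summing anything.
\<close>

definition graded_projections ::
  "('m, 'z) ring_scheme \<Rightarrow> ('i \<Rightarrow> 'm set) \<Rightarrow> ('i \<Rightarrow> 'm \<Rightarrow> 'm) \<Rightarrow> bool" where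
  "graded_projections G B p \<longleftrightarrow>
    (\<forall>i. B i \<subseteq> carrier G) \<and> (\<forall>i. \<forall>x\<in>carrier G. p i x \<in> B i) \<and>
    (\<forall>i. p i \<in> hom (add_monoid G) (add_monoid G)) \<and>
    (\<forall>i. \<forall>x\<in>B i. p i x = x) \<and> (\<forall>i j. \<forall>x\<in>B j. i \<noteq> j \<longrightarrow> p i x = \<zero>\<^bsub>G\<^esub>) \<and>
    (\<forall>x\<in>carrier G. finite {i. p i x \<noteq> \<zero>\<^bsub>G\<^esub>}) \<and>
    (\<forall>x\<in>carrier G. (\<forall>i. p i x = \<zero>\<^bsub>G\<^esub>) \<longrightarrow> x = \<zero>\<^bsub>G\<^esub>)"

lemma graded_projections_finsum:
  assumes G: "abelian_group G" and p: "graded_projections G B p"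
    and c: "\<And>i. c i \<in> B i" and fin: "finite F"
  shows "p i (finsum G c F) = (if i \<in> F then c i else \<zero>\<^bsub>G\<^esub>)"
proof -
  interpret G: abelian_group G by fact
  have pi: "p i \<in> hom (add_monoid G) (add_monoid G)" for i
    using p by (auto simp: graded_projections_def)
  have cc: "c i \<in> carrier G" for i
    using p c by (auto simp: graded_projections_def)
  have pc: "p i (c j) = (if j = i then c j else \<zero>\<^bsub>G\<^esub>)" for j
    using p c unfolding graded_projections_def by metis
  have "p i (finsum G c F) = finsum G (\<lambda>j. p i (c j)) F"
    using cc by (intro additive_finsum[OF G G pi]) auto
  also have "\<dots> = finsum G (\<lambda>j. if j = i then c j else \<zero>\<^bsub>G\<^esub>) F"
    by (simp add: pc)
  also have "\<dots> = (if i \<in> F then c i else \<zero>\<^bsub>G\<^esub>)"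
  proof (cases "i \<in> F")
    case True
    then show ?thesis
      using G.finsum_singleton[OF True fin, of c] cc by (auto simp: eq_commute)
  next
    case False
    then have "finsum G (\<lambda>j. if j = i then c j else \<zero>\<^bsub>G\<^esub>) F = finsum G (\<lambda>j. \<zero>\<^bsub>G\<^esub>) F"
      by (intro G.finsum_cong') auto
    then show ?thesis using False by simp
  qed
  finally show ?thesis .
qed

text \<open>
  The difference of both sides is killed by all projections, hence vanishes.
\<close>

lemma graded_projections_sum:
  assumes G: "abelian_group G" and p: "graded_projections G B p" and x: "x \<in> carrier G"
  shows "x = finsum G (\<lambda>i. p i x) {i. p i x \<noteq> \<zero>\<^bsub>G\<^esub>}"
proof -
  interpret G: abelian_group G by fact
  let ?s = "finsum G (\<lambda>i. p i x) {i. p i x \<noteq> \<zero>\<^bsub>G\<^esub>}"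
  have pi: "p i \<in> hom (add_monoid G) (add_monoid G)" for i
    using p by (auto simp: graded_projections_def)
  have pB: "p i x \<in> B i" for i
    using p x by (auto simp: graded_projections_def)
  have s: "?s \<in> carrier G"
    using additive_in[OF pi x] by (intro G.finsum_closed) auto
  have fin: "finite {i. p i x \<noteq> \<zero>\<^bsub>G\<^esub>}"
    using p x by (auto simp: graded_projections_def)
  have ps: "p i ?s = p i x" for i
    using graded_projections_finsum[OF G p, of "\<lambda>i. p i x" "{i. p i x \<noteq> \<zero>\<^bsub>G\<^esub>}" i] pB fin by auto
  have "p i (x \<oplus>\<^bsub>G\<^esub> \<ominus>\<^bsub>G\<^esub> ?s) = \<zero>\<^bsub>G\<^esub>" for i
    using x s additive_in[OF pi x]
    by (simp add: additive_add[OF pi] additive_a_inv[OF G G pi] ps G.r_neg)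
  then have "x \<oplus>\<^bsub>G\<^esub> \<ominus>\<^bsub>G\<^esub> ?s = \<zero>\<^bsub>G\<^esub>"
    using p x s by (auto simp: graded_projections_def)
  then show ?thesis
    using G.minus_equality[OF _ s] x s G.r_neg
    by (metis G.a_inv_closed G.minus_equality G.minus_minus)
qed

lemma graded_projections_subgroup:
  assumes G: "abelian_group G" and p: "graded_projections G B p"
  shows "additive_subgroup (B i) G"
proof -
  interpret G: abelian_group G by fact
  have pi: "p i \<in> hom (add_monoid G) (add_monoid G)"
    using p by (auto simp: graded_projections_def)
  have sub: "B i \<subseteq> carrier G"
    and B: "x \<in> B i \<longleftrightarrow> x \<in> carrier G \<and> p i x = x" for x
    using p unfolding graded_projections_def by (blast, metis subsetD)
  show ?thesis
  proof (unfold_locales, simp_all)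
    show "B i \<subseteq> carrier G" by (rule sub)
    show "x \<oplus>\<^bsub>G\<^esub> y \<in> B i" if "x \<in> B i" "y \<in> B i" for x y
      using that by (simp add: B additive_add[OF pi])
    show "\<zero>\<^bsub>G\<^esub> \<in> B i"
      by (simp add: B additive_zero[OF G G pi])
    show "inv\<^bsub>add_monoid G\<^esub> x \<in> B i" if "x \<in> B i" for x
      using that additive_a_inv[OF G G pi, of x] by (simp add: B a_inv_def[symmetric])
  qed
qed

lemma graded_projections_imp_direct_sum:
  assumes G: "abelian_group G" and p: "graded_projections G B p"
  shows "direct_sum_of G UNIV B"
  unfolding direct_sum_of_def
proof (intro conjI ballI)
  interpret G: abelian_group G by fact
  show "additive_subgroup (B i) G" for i
    by (rule graded_projections_subgroup[OF G p])
  fix x assume x: "x \<in> carrier G"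
  show "\<exists>!c. (\<forall>i\<in>UNIV. c i \<in> B i) \<and> (\<forall>i. i \<notin> UNIV \<longrightarrow> c i = \<zero>\<^bsub>G\<^esub>) \<and>
       finite {i. c i \<noteq> \<zero>\<^bsub>G\<^esub>} \<and> x = finsum G c {i. c i \<noteq> \<zero>\<^bsub>G\<^esub>}" (is "\<exists>!c. ?P c")
  proof (rule ex1I[of ?P "\<lambda>i. p i x"])
    show "?P (\<lambda>i. p i x)"
      using p x graded_projections_sum[OF G p x] by (auto simp: graded_projections_def)
    fix c assume c: "?P c"
    then have "p i x = c i" for i
      using graded_projections_finsum[OF G p, of c "{i. c i \<noteq> \<zero>\<^bsub>G\<^esub>}" i] by auto
    then show "c = (\<lambda>i. p i x)" by auto
  qed
qed

lemma direct_sum_imp_graded_projections: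
  assumes G: "abelian_group G" and ds: "direct_sum_of G UNIV B"
  shows "\<exists>p. graded_projections G B p"
proof -
  interpret G: abelian_group G by fact
  let ?P = "\<lambda>x c. (\<forall>i. c i \<in> B i) \<and> finite {i. c i \<noteq> \<zero>\<^bsub>G\<^esub>} \<and> x = finsum G c {i. c i \<noteq> \<zero>\<^bsub>G\<^esub>}"
  define c where "c x = (THE c. ?P x c)" for x
  have ex1: "\<exists>!c. ?P x c" if "x \<in> carrier G" for x
    using ds that unfolding direct_sum_of_def by simp
  have c: "?P x (c x)" if "x \<in> carrier G" for x
    unfolding c_def by (rule theI'[OF ex1[OF that]])
  have sg: "additive_subgroup (B i) G" for i
    using ds by (simp add: direct_sum_of_def)
  have sub: "B i \<subseteq> carrier G" for i
    using additive_subgroup.a_subset[OF sg] .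
  have zero: "\<zero>\<^bsub>G\<^esub> \<in> B i" for i
    using additive_subgroup.zero_closed[OF sg] .
  have cB: "c x i \<in> B i" if "x \<in> carrier G" for x i using c[OF that] by blast
  have cfin: "finite {i. c x i \<noteq> \<zero>\<^bsub>G\<^esub>}" if "x \<in> carrier G" for x using c[OF that] by blast
  have csum: "x = finsum G (c x) {i. c x i \<noteq> \<zero>\<^bsub>G\<^esub>}" if "x \<in> carrier G" for x using c[OF that] by blast
  have uniq: "c (finsum G d F) = d"
    if d: "\<And>i. d i \<in> B i" and F: "finite F" "\<And>i. i \<notin> F \<Longrightarrow> d i = \<zero>\<^bsub>G\<^esub>" for d F
  proof -
    have dc: "d i \<in> carrier G" for i using d sub by blast
    have sF: "finsum G d F = finsum G d {i. d i \<noteq> \<zero>\<^bsub>G\<^esub>}"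
      using F dc by (intro G.add.finprod_mono_neutral_cong_right) auto
    have "finite {i. d i \<noteq> \<zero>\<^bsub>G\<^esub>}"
      by (rule finite_subset[OF _ F(1)]) (use F(2) in blast)
    then have "?P (finsum G d F) d"
      using d sF by simp
    moreover have "finsum G d F \<in> carrier G"
      using dc by (intro G.finsum_closed) auto
    ultimately show ?thesis
      using ex1 c by blast
  qed
  have "graded_projections G B (\<lambda>i x. c x i)"
    unfolding graded_projections_def
  proof (intro conjI allI ballI impI)
    show "B i \<subseteq> carrier G" for i by (rule sub)
    show "c x i \<in> B i" "finite {i. c x i \<noteq> \<zero>\<^bsub>G\<^esub>}" if "x \<in> carrier G" for x i
      using c[OF that] by blast+
    show "(\<lambda>x. c x i) \<in> hom (add_monoid G) (add_monoid G)" for i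
    proof (rule homI, simp_all)
      show "c x i \<in> carrier G" if "x \<in> carrier G" for x using c[OF that] sub by blast
      fix x y assume x: "x \<in> carrier G" and y: "y \<in> carrier G"
      let ?F = "{i. c x i \<noteq> \<zero>\<^bsub>G\<^esub>} \<union> {i. c y i \<noteq> \<zero>\<^bsub>G\<^esub>}"
      have F: "finite ?F" using cfin x y by blast
      have xc: "c x i \<in> carrier G" "c y i \<in> carrier G" for i
        using cB[OF x] cB[OF y] sub by blast+
      have "x = finsum G (c x) ?F" "y = finsum G (c y) ?F"
        using F xc by (subst csum[OF x] csum[OF y], intro G.add.finprod_mono_neutral_cong_left; auto)+
      then have "x \<oplus>\<^bsub>G\<^esub> y = finsum G (\<lambda>i. c x i \<oplus>\<^bsub>G\<^esub> c y i) ?F"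
        using G.finsum_addf[of "c x" ?F "c y"] xc by auto
      moreover have "c (finsum G (\<lambda>i. c x i \<oplus>\<^bsub>G\<^esub> c y i) ?F) = (\<lambda>i. c x i \<oplus>\<^bsub>G\<^esub> c y i)"
        using F cB[OF x] cB[OF y] additive_subgroup.a_closed[OF sg] by (intro uniq) auto
      ultimately show "c (x \<oplus>\<^bsub>G\<^esub> y) i = c x i \<oplus>\<^bsub>G\<^esub> c y i" by simp
    qed
    have hom: "c x = (\<lambda>i. if i = j then x else \<zero>\<^bsub>G\<^esub>)" if "x \<in> B j" for x j
    proof -
      have "c (finsum G (\<lambda>i. if i = j then x else \<zero>\<^bsub>G\<^esub>) {j}) = (\<lambda>i. if i = j then x else \<zero>\<^bsub>G\<^esub>)"
        using that zero by (intro uniq) auto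
      then show ?thesis using that sub by (simp add: subset_iff)
    qed
    show "c x i = x" if "x \<in> B i" for x i using hom[OF that] by simp
    show "c x i = \<zero>\<^bsub>G\<^esub>" if "x \<in> B j" "i \<noteq> j" for x i j using hom[OF that(1)] that(2) by simp
    show "x = \<zero>\<^bsub>G\<^esub>" if "x \<in> carrier G" "\<forall>i. c x i = \<zero>\<^bsub>G\<^esub>" for x
      using csum[OF that(1)] that(2) by simp
  qed
  then show ?thesis by blast
qed

definition component :: "('m, 'z) ring_scheme \<Rightarrow> ('i \<Rightarrow> 'm set) \<Rightarrow> 'i \<Rightarrow> 'm \<Rightarrow> 'm" where
  "component G B = (SOME p. graded_projections G B p)"

locale graded_group = abelian_group G for G (structure) +
  fixes B :: "'i \<Rightarrow> 'a set"
  assumes ds: "direct_sum_of G UNIV B"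
begin

lemma projections: "graded_projections G B (component G B)"
  unfolding component_def
  using direct_sum_imp_graded_projections[OF abelian_group_axioms ds] by (rule someI_ex)

lemma part_subgroup: "additive_subgroup (B i) G"
  using ds by (simp add: direct_sum_of_def)

lemma part_subset: "B i \<subseteq> carrier G"
  and part_in_carrier: "x \<in> B i \<Longrightarrow> x \<in> carrier G"
  and component_in: "x \<in> carrier G \<Longrightarrow> component G B i x \<in> B i"
  and component_carrier: "x \<in> carrier G \<Longrightarrow> component G B i x \<in> carrier G"
  and component_additive: "component G B i \<in> hom (add_monoid G) (add_monoid G)"
  and component_same: "x \<in> B i \<Longrightarrow> component G B i x = x"
  and component_other: "x \<in> B j \<Longrightarrow> i \<noteq> j \<Longrightarrow> component G B i x = \<zero>"
  and component_finite: "x \<in> carrier G \<Longrightarrow> finite {i. component G B i x \<noteq> \<zero>}"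
  and component_sep: "x \<in> carrier G \<Longrightarrow> (\<And>i. component G B i x = \<zero>) \<Longrightarrow> x = \<zero>"
  using projections unfolding graded_projections_def by (blast+)

lemma part_zero: "\<zero> \<in> B i"
  using additive_subgroup.zero_closed[OF part_subgroup] .

lemma part_add: "x \<in> B i \<Longrightarrow> y \<in> B i \<Longrightarrow> x \<oplus> y \<in> B i"
  using additive_subgroup.a_closed[OF part_subgroup] .

lemma part_a_inv: "x \<in> B i \<Longrightarrow> \<ominus> x \<in> B i"
  using additive_subgroup.a_inv_closed[OF part_subgroup] .

lemma component_add:
  "x \<in> carrier G \<Longrightarrow> y \<in> carrier G \<Longrightarrow> component G B i (x \<oplus> y) = component G B i x \<oplus> component G B i y"
  using additive_add[OF component_additive] .

lemma component_eqI:
  assumes "x \<in> carrier G" "y \<in> carrier G" "\<And>i. component G B i x = component G B i y"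
  shows "x = y"
  using graded_projections_sum[OF abelian_group_axioms projections assms(1)]
    graded_projections_sum[OF abelian_group_axioms projections assms(2)] assms(3) by simp

lemma homogeneous_induct [consumes 1, case_names homogeneous add]:
  assumes x: "x \<in> carrier G"
    and hom: "\<And>i x. x \<in> B i \<Longrightarrow> P x"
    and add: "\<And>x y. \<lbrakk>x \<in> carrier G; y \<in> carrier G; P x; P y\<rbrakk> \<Longrightarrow> P (x \<oplus> y)"
  shows "P x"
proof -
  have "P (finsum G (\<lambda>i. component G B i x) F)" if "finite F" for F
    using that
  proof induction
    case empty
    then show ?case using hom[OF part_zero] by simp
  next
    case (insert i F)
    have "finsum G (\<lambda>i. component G B i x) (insert i F) =
        component G B i x \<oplus> finsum G (\<lambda>i. component G B i x) F"
      using insert component_carrier[OF x] by (intro finsum_insert) auto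
    then show ?case
      using insert add[OF component_carrier[OF x] finsum_closed hom[OF component_in[OF x]] insert.IH]
        component_carrier[OF x] by auto
  qed
  then show ?thesis
    using graded_projections_sum[OF abelian_group_axioms projections x] component_finite[OF x] by metis
qed

end

text \<open>
  Both sides are additive in \<open>x\<close>, so it suffices to compare them on homogeneous elements. The
  reindexing \<open>s\<close> covers maps that shift degrees, such as multiplication by a homogeneous element.
\<close>

lemma additive_component:
  assumes G: "graded_group G B" and H: "graded_group H C" and s: "inj s"
    and h: "h \<in> hom (add_monoid G) (add_monoid H)" and hB: "\<And>i. h ` B i \<subseteq> C (s i)"
    and x: "x \<in> carrier G"
  shows "component H C (s i) (h x) = h (component G B i x)"
proof -
  interpret G: graded_group G B by fact
  interpret H: graded_group H C by fact
  have h0: "h \<zero>\<^bsub>G\<^esub> = \<zero>\<^bsub>H\<^esub>"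
    by (rule additive_zero[OF G.abelian_group_axioms H.abelian_group_axioms h])
  show ?thesis
    using x
  proof (induction x rule: G.homogeneous_induct)
    case (homogeneous j x)
    then have hx: "h x \<in> C (s j)" using hB by blast
    show ?case
    proof (cases "i = j")
      case True
      then show ?thesis using homogeneous hx by (simp add: G.component_same H.component_same)
    next
      case False
      then show ?thesis
        using G.component_other[OF homogeneous] H.component_other[OF hx] h0 injD[OF s, of i j] by auto
    qed
  next
    case (add x y)
    then show ?case
      by (simp add: additive_add[OF h] G.component_add H.component_add additive_in[OF h]
          G.component_carrier)
  qed
qed

section \<open>Modules and their homomorphisms\<close>

context right_module
begin

lemma ract_additive: "a \<in> carrier R \<Longrightarrow> (\<lambda>x. x \<star>\<^bsub>M\<^esub> a) \<in> hom (add_monoid M) (add_monoid M)"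
  by (auto intro!: homI simp: ract_closed ract_l_distr)

lemma ract_additive_right: "x \<in> carrier M \<Longrightarrow> (\<lambda>a. x \<star>\<^bsub>M\<^esub> a) \<in> hom (add_monoid R) (add_monoid M)"
  by (auto intro!: homI simp: ract_closed ract_r_distr)

lemma ract_zero: "x \<in> carrier M \<Longrightarrow> x \<star>\<^bsub>M\<^esub> \<zero>\<^bsub>R\<^esub> = \<zero>\<^bsub>M\<^esub>"
  using additive_zero[OF R.abelian_group_axioms M.abelian_group_axioms ract_additive_right] .

lemma zero_ract: "a \<in> carrier R \<Longrightarrow> \<zero>\<^bsub>M\<^esub> \<star>\<^bsub>M\<^esub> a = \<zero>\<^bsub>M\<^esub>"
  using additive_zero[OF M.abelian_group_axioms M.abelian_group_axioms ract_additive] .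

lemma finsum_ract:
  assumes "a \<in> carrier R" "c \<in> F \<rightarrow> carrier M"
  shows "finsum M c F \<star>\<^bsub>M\<^esub> a = finsum M (\<lambda>i. c i \<star>\<^bsub>M\<^esub> a) F"
  using additive_finsum[OF M.abelian_group_axioms M.abelian_group_axioms ract_additive] assms .

lemma ract_finsum:
  assumes "x \<in> carrier M" "c \<in> F \<rightarrow> carrier R"
  shows "x \<star>\<^bsub>M\<^esub> finsum R c F = finsum M (\<lambda>i. x \<star>\<^bsub>M\<^esub> c i) F"
  using additive_finsum[OF R.abelian_group_axioms M.abelian_group_axioms ract_additive_right] assms .

end

lemma rhomI:
  assumes "f \<in> carrier M \<rightarrow>\<^sub>E carrier N"
    and "\<And>x y. x \<in> carrier M \<Longrightarrow> y \<in> carrier M \<Longrightarrow> f (x \<oplus>\<^bsub>M\<^esub> y) = f x \<oplus>\<^bsub>N\<^esub> f y"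
    and "\<And>x a. x \<in> carrier M \<Longrightarrow> a \<in> carrier R \<Longrightarrow> f (x \<star>\<^bsub>M\<^esub> a) = f x \<star>\<^bsub>N\<^esub> a"
  shows "f \<in> rhom R M N"
  using assms unfolding rhom_def by blast

lemma rhom_in: "f \<in> rhom R M N \<Longrightarrow> x \<in> carrier M \<Longrightarrow> f x \<in> carrier N"
  and rhom_add: "f \<in> rhom R M N \<Longrightarrow> x \<in> carrier M \<Longrightarrow> y \<in> carrier M \<Longrightarrow> f (x \<oplus>\<^bsub>M\<^esub> y) = f x \<oplus>\<^bsub>N\<^esub> f y"
  and rhom_ract: "f \<in> rhom R M N \<Longrightarrow> x \<in> carrier M \<Longrightarrow> a \<in> carrier R \<Longrightarrow> f (x \<star>\<^bsub>M\<^esub> a) = f x \<star>\<^bsub>N\<^esub> a"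
  and rhom_ext: "f \<in> rhom R M N \<Longrightarrow> f \<in> extensional (carrier M)"
  unfolding rhom_def by (auto simp: PiE_def)

lemma rhom_additive: "f \<in> rhom R M N \<Longrightarrow> f \<in> hom (add_monoid M) (add_monoid N)"
  by (auto intro!: homI simp: rhom_in rhom_add)

lemma rhom_eqI:
  assumes "f \<in> rhom R M N" "g \<in> rhom R M N'" "\<And>x. x \<in> carrier M \<Longrightarrow> f x = g x"
  shows "f = g"
  using assms by (intro extensionalityI[OF rhom_ext rhom_ext]) auto

lemma rhom_zero:
  assumes "right_module R M" "right_module R N" "f \<in> rhom R M N"
  shows "f \<zero>\<^bsub>M\<^esub> = \<zero>\<^bsub>N\<^esub>"
  using additive_zero[OF _ _ rhom_additive[OF assms(3)]] assms(1,2)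
  by (simp add: right_module_def)

lemma grhom_rhom: "f \<in> grhom A M N \<Longrightarrow> f \<in> rhom A M N"
  and grhom_homog: "f \<in> grhom A M N \<Longrightarrow> x \<in> homog M n \<Longrightarrow> f x \<in> homog N n"
  unfolding grhom_def by blast+

lemma grhomI:
  assumes "f \<in> rhom A M N" "\<And>n x. x \<in> homog M n \<Longrightarrow> f x \<in> homog N n"
  shows "f \<in> grhom A M N"
  using assms unfolding grhom_def by blast

lemma rhom_compose:
  assumes "f \<in> rhom R L M" "g \<in> rhom R M N"
    and "\<And>x y. x \<in> carrier L \<Longrightarrow> y \<in> carrier L \<Longrightarrow> x \<oplus>\<^bsub>L\<^esub> y \<in> carrier L"
    and "\<And>x a. x \<in> carrier L \<Longrightarrow> a \<in> carrier R \<Longrightarrow> x \<star>\<^bsub>L\<^esub> a \<in> carrier L"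
  shows "compose (carrier L) g f \<in> rhom R L N"
  by (rule rhomI) (simp_all add: compose_def assms rhom_in[OF assms(1)] rhom_in[OF assms(2)]
      rhom_add[OF assms(1)] rhom_add[OF assms(2)] rhom_ract[OF assms(1)] rhom_ract[OF assms(2)])

lemma right_module_closed:
  assumes "right_module R M"
  shows "x \<in> carrier M \<Longrightarrow> y \<in> carrier M \<Longrightarrow> x \<oplus>\<^bsub>M\<^esub> y \<in> carrier M"
    and "x \<in> carrier M \<Longrightarrow> a \<in> carrier R \<Longrightarrow> x \<star>\<^bsub>M\<^esub> a \<in> carrier M"
    and "\<zero>\<^bsub>M\<^esub> \<in> carrier M"
proof -
  interpret right_module R M by fact
  show "x \<in> carrier M \<Longrightarrow> y \<in> carrier M \<Longrightarrow> x \<oplus>\<^bsub>M\<^esub> y \<in> carrier M"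
    and "x \<in> carrier M \<Longrightarrow> a \<in> carrier R \<Longrightarrow> x \<star>\<^bsub>M\<^esub> a \<in> carrier M"
    and "\<zero>\<^bsub>M\<^esub> \<in> carrier M"
    by (simp_all add: ract_closed)
qed

lemma rhom_Id: "right_module R M \<Longrightarrow> (\<lambda>x\<in>carrier M. x) \<in> rhom R M M"
  by (rule rhomI) (simp_all add: right_module_closed)

lemma rhom_funcset: "f \<in> rhom R M N \<Longrightarrow> f \<in> carrier M \<rightarrow> carrier N"
  by (auto intro: rhom_in)

lemma rhom_compose_Id: "f \<in> rhom R M N \<Longrightarrow> compose (carrier M) f (\<lambda>x\<in>carrier M. x) = f"
  and rhom_Id_compose: "f \<in> rhom R M N \<Longrightarrow> compose (carrier M) (\<lambda>x\<in>carrier N. x) f = f"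
  using compose_Id[OF rhom_funcset rhom_ext] Id_compose[OF rhom_funcset rhom_ext] by blast+

lemma is_category_ModR: "is_category (ModR R)"
  unfolding is_category_def ModR_def
  by (simp add: rhom_Id rhom_compose right_module_closed rhom_compose_Id rhom_Id_compose
      compose_assoc[OF rhom_funcset, symmetric])

lemma graded_right_module_imp_right_module: "graded_right_module A gr M \<Longrightarrow> right_module A M"
  and graded_right_module_ract:
    "\<lbrakk>graded_right_module A gr M; x \<in> homog M n; a \<in> gr m\<rbrakk> \<Longrightarrow> x \<star>\<^bsub>M\<^esub> a \<in> homog M (n + m)"
  unfolding graded_right_module_def by blast+

lemma graded_right_module_graded_group:
  assumes "graded_right_module A gr M"
  shows "graded_group M (homog M)"
  using assms unfolding graded_right_module_def right_module_def graded_group_def graded_group_axioms_def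
  by blast

lemma graded_right_moduleI:
  assumes M: "right_module A M" and p: "graded_projections M (homog M) p"
    and act: "\<And>n m x a. x \<in> homog M n \<Longrightarrow> a \<in> gr m \<Longrightarrow> x \<star>\<^bsub>M\<^esub> a \<in> homog M (n + m)"
  shows "graded_right_module A gr M"
  using M graded_projections_imp_direct_sum[OF _ p] act
  unfolding graded_right_module_def right_module_def by blast

lemma grhom_compose:
  assumes L: "graded_right_module A gr L" and f: "f \<in> grhom A L M" and g: "g \<in> grhom A M N"
  shows "compose (carrier L) g f \<in> grhom A L N"
proof (rule grhomI)
  show "compose (carrier L) g f \<in> rhom A L N"
    using rhom_compose[OF grhom_rhom[OF f] grhom_rhom[OF g]]
      right_module_closed[OF graded_right_module_imp_right_module[OF L]] by blast
  show "compose (carrier L) g f x \<in> homog N n" if "x \<in> homog L n" for n x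
    using that graded_group.part_in_carrier[OF graded_right_module_graded_group[OF L] that]
    by (simp add: compose_eq grhom_homog[OF f] grhom_homog[OF g])
qed

lemma grhom_Id:
  assumes M: "graded_right_module A gr M"
  shows "(\<lambda>x\<in>carrier M. x) \<in> grhom A M M"
  using rhom_Id[OF graded_right_module_imp_right_module[OF M]]
    graded_group.part_in_carrier[OF graded_right_module_graded_group[OF M]]
  by (intro grhomI) auto

lemma is_category_GrR: "is_category (GrR A gr)"
  unfolding is_category_def GrR_def
  by (simp add: grhom_Id grhom_compose rhom_compose_Id[OF grhom_rhom] rhom_Id_compose[OF grhom_rhom]
      compose_assoc[OF rhom_funcset[OF grhom_rhom], symmetric])

lemma ModR_simps [simp]:
  "M \<in> Obj (ModR R) \<longleftrightarrow> right_module R M" "Hom (ModR R) = rhom R"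
  "Id (ModR R) M = (\<lambda>x\<in>carrier M. x)" "Comp (ModR R) L M N g f = compose (carrier L) g f"
  by (simp_all add: ModR_def)

lemma GrR_simps [simp]:
  "M \<in> Obj (GrR A gr) \<longleftrightarrow> graded_right_module A gr M" "Hom (GrR A gr) = grhom A"
  "Id (GrR A gr) M = (\<lambda>x\<in>carrier M. x)" "Comp (GrR A gr) L M N g f = compose (carrier L) g f"
  by (simp_all add: GrR_def)

lemma rhom_inverse:
  assumes M: "right_module R M" and f: "f \<in> rhom R M N" and bij: "bij_betw f (carrier M) (carrier N)"
  shows "restrict (inv_into (carrier M) f) (carrier N) \<in> rhom R N M" (is "?g \<in> _")
    and "compose (carrier M) (restrict (inv_into (carrier M) f) (carrier N)) f = (\<lambda>x\<in>carrier M. x)"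
    and "compose (carrier N) f (restrict (inv_into (carrier M) f) (carrier N)) = (\<lambda>x\<in>carrier N. x)"
proof -
  have inj: "inj_on f (carrier M)" and im: "f ` carrier M = carrier N"
    using bij by (auto simp: bij_betw_def)
  have gf: "inv_into (carrier M) f (f x) = x" if "x \<in> carrier M" for x
    using inj that by simp
  have g: "\<exists>x\<in>carrier M. y = f x" if "y \<in> carrier N" for y
    using im that by blast
  show "?g \<in> rhom R N M"
  proof (rule rhomI)
    show "?g \<in> carrier N \<rightarrow>\<^sub>E carrier M" using g gf by fastforce
    show "?g (y \<oplus>\<^bsub>N\<^esub> z) = ?g y \<oplus>\<^bsub>M\<^esub> ?g z" if yz: "y \<in> carrier N" "z \<in> carrier N" for y z
    proof -
      obtain u v where "u \<in> carrier M" "y = f u" "v \<in> carrier M" "z = f v" using g yz by blast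
      then show ?thesis
        using right_module_closed(1)[OF M, of u v] rhom_in[OF f, of "u \<oplus>\<^bsub>M\<^esub> v"] rhom_in[OF f]
        by (simp add: rhom_add[OF f, symmetric] gf)
    qed
    show "?g (y \<star>\<^bsub>N\<^esub> a) = ?g y \<star>\<^bsub>M\<^esub> a" if y: "y \<in> carrier N" and a: "a \<in> carrier R" for y a
    proof -
      obtain u where "u \<in> carrier M" "y = f u" using g y by blast
      then show ?thesis
        using right_module_closed(2)[OF M, of u a] rhom_in[OF f, of "u \<star>\<^bsub>M\<^esub> a"] rhom_in[OF f] a
        by (simp add: rhom_ract[OF f, symmetric] gf)
    qed
  qed
  show "compose (carrier M) ?g f = (\<lambda>x\<in>carrier M. x)"
    using rhom_in[OF f] gf by (auto simp: compose_def)
  show "compose (carrier N) f ?g = (\<lambda>x\<in>carrier N. x)"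
    using f_inv_into_f[of _ f "carrier M"] im by (auto simp: compose_def)
qed

lemma is_iso_ModR:
  assumes "right_module R M" and "f \<in> rhom R M N" and "bij_betw f (carrier M) (carrier N)"
  shows "is_iso (ModR R) M N f"
  using rhom_inverse[OF assms] assms(2) unfolding is_iso_def by auto

text \<open>
  Since \<open>f\<close> commutes with the projections, it kills the components of \<open>x\<close> in degrees other than
  \<open>n\<close>, and these vanish by injectivity. Therefore the inverse of a bijective graded homomorphism is
  graded.
\<close>

lemma grhom_reflects_homog:
  assumes M: "graded_right_module A gr M" and N: "graded_right_module A gr N"
    and f: "f \<in> grhom A M N" and inj: "inj_on f (carrier M)"
    and x: "x \<in> carrier M" and fx: "f x \<in> homog N n"
  shows "x \<in> homog M n"
proof -
  interpret M: graded_group M "homog M" by (rule graded_right_module_graded_group[OF M])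
  interpret N: graded_group N "homog N" by (rule graded_right_module_graded_group[OF N])
  have fadd: "f \<in> hom (add_monoid M) (add_monoid N)"
    by (rule rhom_additive[OF grhom_rhom[OF f]])
  have "f (component M (homog M) n x) = component N (homog N) n (f x)"
    using additive_component[OF M.graded_group_axioms N.graded_group_axioms inj_on_id fadd _ x, of n]
      grhom_homog[OF f] by (simp add: image_subset_iff)
  also have "\<dots> = f x" by (rule N.component_same[OF fx])
  finally have "component M (homog M) n x = x"
    using inj_onD[OF inj] M.component_carrier[OF x] x by blast
  then show ?thesis using M.component_in[OF x, of n] by simp
qed

lemma is_iso_GrR:
  assumes M: "graded_right_module A gr M" and N: "graded_right_module A gr N"
    and f: "f \<in> grhom A M N" and bij: "bij_betw f (carrier M) (carrier N)"
  shows "is_iso (GrR A gr) M N f"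
proof -
  note inv = rhom_inverse[OF graded_right_module_imp_right_module[OF M] grhom_rhom[OF f] bij]
  interpret N: graded_group N "homog N" by (rule graded_right_module_graded_group[OF N])
  have "restrict (inv_into (carrier M) f) (carrier N) \<in> grhom A N M"
  proof (rule grhomI[OF inv(1)])
    fix n y assume y: "y \<in> homog N n"
    then obtain x where x: "x \<in> carrier M" "y = f x"
      using bij N.part_in_carrier[OF y] unfolding bij_betw_def by blast
    moreover have "x \<in> homog M n"
      using grhom_reflects_homog[OF M N f _ x(1)] bij x y by (simp add: bij_betw_def)
    ultimately show "restrict (inv_into (carrier M) f) (carrier N) y \<in> homog M n"
      using bij rhom_in[OF grhom_rhom[OF f] x(1)] by (simp add: bij_betw_def)
  qed
  then show ?thesis
    using inv(2,3) f unfolding is_iso_def by auto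
qed

subsection \<open>Transport of structure\<close>

lemma right_module_transport:
  assumes M: "right_module R M" and im: "carrier N = e ` carrier M"
    and zero: "\<zero>\<^bsub>N\<^esub> = e \<zero>\<^bsub>M\<^esub>"
    and add: "\<And>x y. x \<in> carrier M \<Longrightarrow> y \<in> carrier M \<Longrightarrow> e x \<oplus>\<^bsub>N\<^esub> e y = e (x \<oplus>\<^bsub>M\<^esub> y)"
    and act: "\<And>x a. x \<in> carrier M \<Longrightarrow> a \<in> carrier R \<Longrightarrow> e x \<star>\<^bsub>N\<^esub> a = e (x \<star>\<^bsub>M\<^esub> a)"
  shows "right_module R N"
proof -
  interpret right_module R M by fact
  have "abelian_group N"
  proof (rule abelian_groupI, unfold im)
    show "\<zero>\<^bsub>N\<^esub> \<in> e ` carrier M" by (simp add: zero)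
    show "\<exists>y\<in>e ` carrier M. y \<oplus>\<^bsub>N\<^esub> x = \<zero>\<^bsub>N\<^esub>" if "x \<in> e ` carrier M" for x
    proof -
      obtain u where u: "u \<in> carrier M" "x = e u" using \<open>x \<in> e ` carrier M\<close> by blast
      then have "e (\<ominus>\<^bsub>M\<^esub> u) \<oplus>\<^bsub>N\<^esub> x = \<zero>\<^bsub>N\<^esub>"
        by (simp add: zero add M.l_neg)
      moreover have "e (\<ominus>\<^bsub>M\<^esub> u) \<in> e ` carrier M"
        using u by simp
      ultimately show ?thesis ..
    qed
    show "x \<oplus>\<^bsub>N\<^esub> y \<in> e ` carrier M" if "x \<in> e ` carrier M" "y \<in> e ` carrier M" for x y
      using that by (auto simp: add)
    show "(x \<oplus>\<^bsub>N\<^esub> y) \<oplus>\<^bsub>N\<^esub> z = x \<oplus>\<^bsub>N\<^esub> (y \<oplus>\<^bsub>N\<^esub> z)"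
      if "x \<in> e ` carrier M" "y \<in> e ` carrier M" "z \<in> e ` carrier M" for x y z
      using that by (auto simp: add M.a_assoc)
    show "x \<oplus>\<^bsub>N\<^esub> y = y \<oplus>\<^bsub>N\<^esub> x" if "x \<in> e ` carrier M" "y \<in> e ` carrier M" for x y
      using that by (auto simp: add M.a_comm)
    show "\<zero>\<^bsub>N\<^esub> \<oplus>\<^bsub>N\<^esub> x = x" if "x \<in> e ` carrier M" for x
      using that by (auto simp: zero add)
  qed
  then show ?thesis
  proof (intro right_module.intro right_module_axioms.intro R.ring_axioms, unfold im)
    show "x \<star>\<^bsub>N\<^esub> a \<in> e ` carrier M" if "x \<in> e ` carrier M" "a \<in> carrier R" for x a
      using that by (auto simp: act ract_closed)
    show "(x \<oplus>\<^bsub>N\<^esub> y) \<star>\<^bsub>N\<^esub> a = x \<star>\<^bsub>N\<^esub> a \<oplus>\<^bsub>N\<^esub> y \<star>\<^bsub>N\<^esub> a"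
      if "x \<in> e ` carrier M" "y \<in> e ` carrier M" "a \<in> carrier R" for x y a
      using that by (auto simp: act add ract_closed ract_l_distr)
    show "x \<star>\<^bsub>N\<^esub> (a \<oplus>\<^bsub>R\<^esub> b) = x \<star>\<^bsub>N\<^esub> a \<oplus>\<^bsub>N\<^esub> x \<star>\<^bsub>N\<^esub> b"
      if "x \<in> e ` carrier M" "a \<in> carrier R" "b \<in> carrier R" for x a b
      using that by (auto simp: act add ract_closed ract_r_distr)
    show "(x \<star>\<^bsub>N\<^esub> a) \<star>\<^bsub>N\<^esub> b = x \<star>\<^bsub>N\<^esub> (a \<otimes>\<^bsub>R\<^esub> b)"
      if "x \<in> e ` carrier M" "a \<in> carrier R" "b \<in> carrier R" for x a b
      using that by (auto simp: act ract_closed ract_assoc)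
    show "x \<star>\<^bsub>N\<^esub> \<one>\<^bsub>R\<^esub> = x" if "x \<in> e ` carrier M" for x
      using that by (auto simp: act ract_one)
  qed
qed

lemma graded_right_module_transport:
  assumes M: "graded_right_module A gr M" and N: "right_module A N"
    and bij: "bij_betw e (carrier M) (carrier N)"
    and zero: "\<zero>\<^bsub>N\<^esub> = e \<zero>\<^bsub>M\<^esub>"
    and add: "\<And>x y. x \<in> carrier M \<Longrightarrow> y \<in> carrier M \<Longrightarrow> e x \<oplus>\<^bsub>N\<^esub> e y = e (x \<oplus>\<^bsub>M\<^esub> y)"
    and act: "\<And>x a. x \<in> carrier M \<Longrightarrow> a \<in> carrier A \<Longrightarrow> e x \<star>\<^bsub>N\<^esub> a = e (x \<star>\<^bsub>M\<^esub> a)"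
    and hom: "\<And>n. homog N n = e ` homog M n" and gr: "\<And>n. gr n \<subseteq> carrier A"
  shows "graded_right_module A gr N"
proof -
  interpret M: graded_group M "homog M" by (rule graded_right_module_graded_group[OF M])
  have im: "carrier N = e ` carrier M" and inj: "inj_on e (carrier M)"
    using bij by (auto simp: bij_betw_def)
  let ?d = "inv_into (carrier M) e"
  have de: "?d (e x) = x" if "x \<in> carrier M" for x using inj that by simp
  have e_eq_zero: "e x = \<zero>\<^bsub>N\<^esub> \<longleftrightarrow> x = \<zero>\<^bsub>M\<^esub>" if "x \<in> carrier M" for x
    using inj that by (simp add: zero inj_on_eq_iff)
  have "graded_projections N (homog N) (\<lambda>n y. e (component M (homog M) n (?d y)))"
    unfolding graded_projections_def
  proof (intro conjI allI ballI impI)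
    show "(\<lambda>y. e (component M (homog M) n (?d y))) \<in> hom (add_monoid N) (add_monoid N)" for n
      by (rule homI) (auto simp: im de add M.component_add M.component_carrier)
    show "homog N n \<subseteq> carrier N" for n
      using M.part_subset by (auto simp: hom im)
    show "e (component M (homog M) n (?d y)) \<in> homog N n" if "y \<in> carrier N" for n y
      using that by (auto simp: hom im de M.component_in)
    show "e (component M (homog M) n (?d y)) = y" if "y \<in> homog N n" for n y
      using that by (auto simp: hom de M.component_same M.part_in_carrier)
    show "e (component M (homog M) n (?d y)) = \<zero>\<^bsub>N\<^esub>" if "y \<in> homog N m" "n \<noteq> m" for n m y
      using that by (auto simp: hom de M.component_other M.part_in_carrier zero)
    fix y assume "y \<in> carrier N"
    then obtain x where x: "x \<in> carrier M" "y = e x" using im by blast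
    show "finite {n. e (component M (homog M) n (?d y)) \<noteq> \<zero>\<^bsub>N\<^esub>}"
      using x M.component_finite[OF x(1)] by (simp add: de e_eq_zero M.component_carrier)
    show "y = \<zero>\<^bsub>N\<^esub>" if "\<forall>n. e (component M (homog M) n (?d y)) = \<zero>\<^bsub>N\<^esub>"
      using that x M.component_sep[OF x(1)] by (simp add: de e_eq_zero M.component_carrier)
  qed
  then show ?thesis
  proof (rule graded_right_moduleI[OF N])
    show "y \<star>\<^bsub>N\<^esub> a \<in> homog N (n + m)" if "y \<in> homog N n" "a \<in> gr m" for n m y a
    proof -
      obtain x where x: "x \<in> homog M n" "y = e x" using \<open>y \<in> homog N n\<close> hom by blast
      then have "y \<star>\<^bsub>N\<^esub> a = e (x \<star>\<^bsub>M\<^esub> a)"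
        using act M.part_in_carrier that(2) gr by blast
      then show ?thesis
        using graded_right_module_ract[OF M x(1) that(2)] hom by blast
    qed
  qed
qed

subsection \<open>Copies inside the universe\<close>

lemma inj_on_emb:
  assumes "S \<lesssim> (UNIV :: 'u set)"
  shows "inj_on (emb S :: 'v \<Rightarrow> 'u) S"
  using assms unfolding emb_def lepoll_def by (metis someI_ex)

lemma copy_module_carrier [simp]: "carrier (copy_module M) = emb (carrier M) ` carrier M"
  and copy_module_zero [simp]: "\<zero>\<^bsub>copy_module M\<^esub> = emb (carrier M) \<zero>\<^bsub>M\<^esub>"
  by (simp_all add: copy_module_def Let_def)

lemma copy_module_add:
  "\<lbrakk>inj_on (emb (carrier M) :: 'v \<Rightarrow> 'u) (carrier M); x \<in> carrier M; y \<in> carrier M\<rbrakk> \<Longrightarrow>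
    emb (carrier M) x \<oplus>\<^bsub>copy_module M\<^esub> emb (carrier M) y = (emb (carrier M) :: 'v \<Rightarrow> 'u) (x \<oplus>\<^bsub>M\<^esub> y)"
  by (simp add: copy_module_def Let_def)

lemma copy_module_ract:
  "\<lbrakk>inj_on (emb (carrier M) :: 'v \<Rightarrow> 'u) (carrier M); x \<in> carrier M\<rbrakk> \<Longrightarrow>
    emb (carrier M) x \<star>\<^bsub>copy_module M\<^esub> a = (emb (carrier M) :: 'v \<Rightarrow> 'u) (x \<star>\<^bsub>M\<^esub> a)"
  by (simp add: copy_module_def Let_def)

lemma copy_module_right_module:
  assumes "inj_on (emb (carrier M) :: 'v \<Rightarrow> 'u) (carrier M)" and "right_module R M"
  shows "right_module R (copy_module M :: ('a, 'u) rmodule)"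
  by (rule right_module_transport[OF assms(2), where e = "emb (carrier M)"])
    (simp_all add: copy_module_add[OF assms(1)] copy_module_ract[OF assms(1)])

lemma truncate_rmodule [simp]:
  "carrier (rmodule.truncate M) = carrier M" "\<zero>\<^bsub>rmodule.truncate M\<^esub> = \<zero>\<^bsub>M\<^esub>"
  "x \<oplus>\<^bsub>rmodule.truncate M\<^esub> y = x \<oplus>\<^bsub>M\<^esub> y" "x \<star>\<^bsub>rmodule.truncate M\<^esub> a = x \<star>\<^bsub>M\<^esub> a"
  by (simp_all add: rmodule.truncate_def)

lemma copy_grmodule_simps [simp]:
  "carrier (copy_grmodule M) = emb (carrier M) ` carrier M"
  "\<zero>\<^bsub>copy_grmodule M\<^esub> = emb (carrier M) \<zero>\<^bsub>M\<^esub>"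
  "homog (copy_grmodule M) n = emb (carrier M) ` homog M n"
  by (simp_all add: copy_grmodule_def rmodule.extend_def grmodule.fields_def)

lemma copy_grmodule_add:
  "\<lbrakk>inj_on (emb (carrier M) :: 'v \<Rightarrow> 'u) (carrier M); x \<in> carrier M; y \<in> carrier M\<rbrakk> \<Longrightarrow>
    emb (carrier M) x \<oplus>\<^bsub>copy_grmodule M\<^esub> emb (carrier M) y = (emb (carrier M) :: 'v \<Rightarrow> 'u) (x \<oplus>\<^bsub>M\<^esub> y)"
  using copy_module_add[of "rmodule.truncate M" x y]
  by (simp add: copy_grmodule_def rmodule.extend_def grmodule.fields_def)

lemma copy_grmodule_ract:
  "\<lbrakk>inj_on (emb (carrier M) :: 'v \<Rightarrow> 'u) (carrier M); x \<in> carrier M\<rbrakk> \<Longrightarrow>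
    emb (carrier M) x \<star>\<^bsub>copy_grmodule M\<^esub> a = (emb (carrier M) :: 'v \<Rightarrow> 'u) (x \<star>\<^bsub>M\<^esub> a)"
  using copy_module_ract[of "rmodule.truncate M" x a]
  by (simp add: copy_grmodule_def rmodule.extend_def grmodule.fields_def)

lemma copy_grmodule_graded:
  assumes inj: "inj_on (emb (carrier M) :: 'v \<Rightarrow> 'u) (carrier M)" and M: "graded_right_module A gr M"
    and gr: "\<And>n. gr n \<subseteq> carrier A"
  shows "graded_right_module A gr (copy_grmodule M :: ('a, 'u) grmodule)"
proof -
  have "right_module A (copy_grmodule M :: ('a, 'u) grmodule)"
    by (rule right_module_transport[OF graded_right_module_imp_right_module[OF M],
          where e = "emb (carrier M)"])
      (simp_all add: copy_grmodule_add[OF inj] copy_grmodule_ract[OF inj])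
  then show ?thesis
    by (rule graded_right_module_transport[OF M, where e = "emb (carrier M)"])
      (use inj gr in \<open>auto simp: copy_grmodule_add copy_grmodule_ract bij_betw_def\<close>)
qed

lemma rmodule_copy_iso:
  assumes "inj_on (emb (carrier M) :: 'v \<Rightarrow> 'u) (carrier M)" and "right_module R M"
  shows "restrict (emb (carrier M)) (carrier M) \<in> rhom R M (copy_module M :: ('a, 'u) rmodule)"
  using assms by (intro rhomI) (simp_all add: right_module_closed copy_module_add copy_module_ract)

lemma lepoll_UNIV_Times:
  assumes "infinite (UNIV :: 'u set)" "S \<lesssim> (UNIV :: 'u set)" "T \<lesssim> (UNIV :: 'u set)"
  shows "S \<times> T \<lesssim> (UNIV :: 'u set)"
proof -
  have "(UNIV :: 'u set) \<times> (UNIV :: 'u set) \<approx> (UNIV :: 'u set)"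
    unfolding eqpoll_iff_card_of_ordIso by (rule card_of_Times_same_infinite[OF assms(1)])
  then show ?thesis
    using times_lepoll_mono[OF assms(2,3)] lepoll_trans2 by blast
qed

lemma lepoll_UNIV_Fpow:
  assumes "infinite (UNIV :: 'u set)" "S \<lesssim> (UNIV :: 'u set)"
  shows "Fpow S \<lesssim> (UNIV :: 'u set)"
proof -
  obtain f :: "'a \<Rightarrow> 'u" where f: "inj_on f S"
    using assms(2) unfolding lepoll_def by blast
  then have "inj_on (image f) (Fpow S)"
    by (auto simp: Fpow_def intro!: inj_on_subset[OF inj_on_image_Pow])
  then have "Fpow S \<lesssim> Fpow (UNIV :: 'u set)"
    unfolding lepoll_def by (intro exI[of _ "image f"]) (auto simp: Fpow_def)
  then show ?thesis
    using eqpoll_Fpow[OF assms(1)] lepoll_trans2 by blast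
qed

section \<open>Graded rings\<close>

locale graded_ring = ring A for A (structure) +
  fixes gr :: "int \<Rightarrow> 'a set"
  assumes direct_sum: "direct_sum_of A UNIV gr"
    and gr_mult: "\<lbrakk>a \<in> gr n; b \<in> gr m\<rbrakk> \<Longrightarrow> a \<otimes> b \<in> gr (n + m)"
begin

sublocale gg: graded_group A gr
  by unfold_locales (rule direct_sum)

abbreviation (input) A0 where "A0 \<equiv> A\<lparr>carrier := gr 0\<rparr>"

lemma component_mult_left:
  assumes a: "a \<in> gr m" and x: "x \<in> carrier A"
  shows "component A gr (m + n) (a \<otimes> x) = a \<otimes> component A gr n x"
proof -
  have "(\<lambda>x. a \<otimes> x) \<in> hom (add_monoid A) (add_monoid A)"
    using gg.part_in_carrier[OF a] by (intro homI) (simp_all add: r_distr)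
  then show ?thesis
    using additive_component[OF gg.graded_group_axioms gg.graded_group_axioms,
        of "\<lambda>n. m + n" "\<lambda>x. a \<otimes> x" x n] gr_mult[OF a] x
    by (auto simp: inj_def)
qed

text \<open>
  The degree zero component \<open>e\<close> of \<open>1\<close> satisfies \<open>a e = a\<close> for homogeneous \<open>a\<close>, because \<open>a e\<close> is the
  component of \<open>a \<cdot> 1\<close> in the degree of \<open>a\<close>; hence \<open>e = 1\<close>.
\<close>

lemma one_in_gr0: "\<one> \<in> gr 0"
proof -
  let ?e = "component A gr 0 \<one>"
  have e: "?e \<in> carrier A" by (simp add: gg.component_carrier)
  have "a \<otimes> ?e = a" if "a \<in> carrier A" for a
    using that
  proof (induction a rule: gg.homogeneous_induct)
    case (homogeneous m a)
    then show ?case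
      using component_mult_left[OF homogeneous one_closed, of 0] gg.part_in_carrier
      by (simp add: gg.component_same)
  next
    case (add x y)
    then show ?case using e by (simp add: l_distr)
  qed
  then have "\<one> = ?e"
    using e by (metis l_one one_closed)
  then show ?thesis
    using gg.component_in[OF one_closed, of 0] by simp
qed

lemma ring_A0: "ring A0"
proof (rule subring_is_ring, rule subringI)
  show "a \<otimes> b \<in> gr 0" if "a \<in> gr 0" "b \<in> gr 0" for a b
    using gr_mult[OF that] by simp
qed (simp_all add: one_in_gr0 gg.part_subset gg.part_a_inv gg.part_add)

lemma degree_part_simps [simp]:
  "carrier (degree_part M n) = homog M n" "\<zero>\<^bsub>degree_part M n\<^esub> = \<zero>\<^bsub>M\<^esub>"
  "x \<oplus>\<^bsub>degree_part M n\<^esub> y = x \<oplus>\<^bsub>M\<^esub> y" "x \<star>\<^bsub>degree_part M n\<^esub> a = x \<star>\<^bsub>M\<^esub> a"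
  by (simp_all add: degree_part_def rmodule.truncate_def)

text \<open>
  All homogeneous parts are needed, not only \<open>M\<^sub>0\<close>: the bimodule \<open>A\<^sub>1\<close> and the values \<open>M(1)\<^sub>0 = M\<^sub>1\<close>
  of the shifted functor are of this kind.
\<close>

lemma degree_part_right_module:
  assumes M: "graded_right_module A gr M"
  shows "right_module A0 (degree_part M n)"
proof -
  interpret M: graded_group M "homog M" by (rule graded_right_module_graded_group[OF M])
  interpret MM: right_module A M by (rule graded_right_module_imp_right_module[OF M])
  have "abelian_group (degree_part M n)"
  proof (rule abelian_groupI, simp_all add: M.part_add M.part_zero M.part_in_carrier M.a_assoc)
    show "x \<oplus>\<^bsub>M\<^esub> y = y \<oplus>\<^bsub>M\<^esub> x" if "x \<in> homog M n" "y \<in> homog M n" for x y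
      using that by (simp add: M.a_comm M.part_in_carrier)
    show "\<exists>y\<in>homog M n. y \<oplus>\<^bsub>M\<^esub> x = \<zero>\<^bsub>M\<^esub>" if x: "x \<in> homog M n" for x
      using M.part_a_inv[OF x] M.l_neg[OF M.part_in_carrier[OF x]] by blast
  qed
  then show ?thesis
    using graded_right_module_ract[OF M, of _ n _ 0]
    by (intro right_module.intro right_module_axioms.intro ring_A0)
      (simp_all add: M.part_in_carrier gg.part_in_carrier MM.ract_l_distr MM.ract_r_distr
        MM.ract_assoc MM.ract_one)
qed

lemma regular_module_simps [simp]:
  "carrier (regular_module A gr) = carrier A" "\<zero>\<^bsub>regular_module A gr\<^esub> = \<zero>"
  "x \<oplus>\<^bsub>regular_module A gr\<^esub> y = x \<oplus> y" "x \<star>\<^bsub>regular_module A gr\<^esub> a = x \<otimes> a"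
  "homog (regular_module A gr) = gr"
  by (simp_all add: regular_module_def)

lemma regular_module_graded: "graded_right_module A gr (regular_module A gr)"
proof (rule graded_right_moduleI)
  have "abelian_group (regular_module A gr)"
    by (rule abelian_groupI) (auto simp: a_ac intro: l_neg exI[of _ "\<ominus> _"] bexI[of _ "\<ominus> _"])
  then show "right_module A (regular_module A gr)"
    by (intro right_module.intro right_module_axioms.intro ring_axioms)
      (simp_all add: l_distr r_distr m_assoc)
  show "graded_projections (regular_module A gr) (homog (regular_module A gr)) (component A gr)"
    using gg.projections by (simp add: graded_projections_def hom_def)
qed (simp add: gr_mult)

lemma degree_zero_ftor_simps [simp]:
  "fobj degree_zero_ftor M = degree_part M 0" "farr degree_zero_ftor M N f = restrict f (homog M 0)"
  by (simp_all add: degree_zero_ftor_def)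

lemma is_functor_degree_zero: 
  "is_functor (GrR A gr :: (('a, 'u) grmodule, 'u \<Rightarrow> 'u) cat) (ModR A0) degree_zero_ftor"
  unfolding is_functor_def GrR_simps ModR_simps degree_zero_ftor_simps mem_Collect_eq
proof (intro conjI ballI)
  fix X :: "('a, 'u) grmodule" assume "X \<in> Obj (GrR A gr)"
  then have X: "graded_right_module A gr X" by simp
  interpret X: graded_group X "homog X" by (rule graded_right_module_graded_group[OF X])
  show "right_module A0 (degree_part X 0)"
    by (simp add: degree_part_right_module[OF X])
  show "restrict (\<lambda>x\<in>carrier X. x) (homog X 0) = (\<lambda>x\<in>carrier (degree_part X 0). x)"
    by (auto simp: fun_eq_iff restrict_def X.part_in_carrier)
  have X0: "x \<star>\<^bsub>X\<^esub> a \<in> homog X 0" if "x \<in> homog X 0" "a \<in> gr 0" for x a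
    using that graded_right_module_ract[OF X, of x 0 a 0] by auto
  fix Y :: "('a, 'u) grmodule" and f assume f: "f \<in> grhom A X Y"
  show "restrict f (homog X 0) \<in> rhom A0 (degree_part X 0) (degree_part Y 0)"
    by (rule rhomI) (simp_all add: X.part_add X0 grhom_homog[OF f] X.part_in_carrier
        gg.part_in_carrier rhom_add[OF grhom_rhom[OF f]] rhom_ract[OF grhom_rhom[OF f]])
  fix Z :: "('a, 'u) grmodule" and g assume "g \<in> grhom A Y Z"
  show "restrict (compose (carrier X) g f) (homog X 0) =
      compose (carrier (degree_part X 0)) (restrict g (homog Y 0)) (restrict f (homog X 0))"
    by (auto simp: fun_eq_iff restrict_def compose_def grhom_homog[OF f] X.part_in_carrier)
qed

end

subsection \<open>The shift\<close>

text \<open>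
  Shifting by an arbitrary integer puts the shift and its inverse on the same footing.
\<close>

definition shift_by :: "int \<Rightarrow> ('a, 'u) grmodule \<Rightarrow> ('a, 'u) grmodule" where
  "shift_by k M = M\<lparr>homog := (\<lambda>n. homog M (n + k))\<rparr>"

definition shift_ftor ::
  "int \<Rightarrow> (('a, 'u) grmodule, 'u \<Rightarrow> 'u, ('a, 'u) grmodule, 'u \<Rightarrow> 'u) ftor" where
  "shift_ftor k = \<lparr>fobj = shift_by k, farr = (\<lambda>X Y f. f)\<rparr>"

lemma shift_by_simps [simp]:
  "carrier (shift_by k M) = carrier M" "\<zero>\<^bsub>shift_by k M\<^esub> = \<zero>\<^bsub>M\<^esub>"
  "x \<oplus>\<^bsub>shift_by k M\<^esub> y = x \<oplus>\<^bsub>M\<^esub> y" "x \<star>\<^bsub>shift_by k M\<^esub> a = x \<star>\<^bsub>M\<^esub> a"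
  "homog (shift_by k M) n = homog M (n + k)"
  by (simp_all add: shift_by_def)

lemma shift_by_1: "shift_by 1 = shift_module"
  by (simp add: shift_by_def shift_module_def fun_eq_iff)

lemma shift_by_inverse: "k + l = 0 \<Longrightarrow> shift_by k (shift_by l M) = M"
  by (simp add: shift_by_def add.assoc)

lemma shift_by_graded:
  assumes M: "graded_right_module A gr M"
  shows "graded_right_module A gr (shift_by k M)"
proof (rule graded_right_moduleI)
  interpret M: graded_group M "homog M" by (rule graded_right_module_graded_group[OF M])
  show "right_module A (shift_by k M)"
    using right_module_transport[OF graded_right_module_imp_right_module[OF M],
        of "shift_by k M" "\<lambda>x. x"] by simp
  show "graded_projections (shift_by k M) (homog (shift_by k M)) (\<lambda>n. component M (homog M) (n + k))"
    unfolding graded_projections_def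
  proof (intro conjI allI ballI impI)
    show "component M (homog M) (n + k) \<in> hom (add_monoid (shift_by k M)) (add_monoid (shift_by k M))" for n
      using M.component_additive by (simp add: hom_def)
    fix x assume "x \<in> carrier (shift_by k M)"
    then have x: "x \<in> carrier M" by simp
    show "finite {n. component M (homog M) (n + k) x \<noteq> \<zero>\<^bsub>shift_by k M\<^esub>}"
      using finite_vimageI[OF M.component_finite[OF x], of "\<lambda>n. n + k"]
      by (simp add: vimage_def inj_def)
    show "x = \<zero>\<^bsub>shift_by k M\<^esub>"
      if z: "\<forall>n. component M (homog M) (n + k) x = \<zero>\<^bsub>shift_by k M\<^esub>"
      using M.component_sep[OF x] z by (metis diff_add_cancel shift_by_simps(2))
  qed (simp_all add: M.part_subset M.component_in M.component_same M.component_other)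
  show "x \<star>\<^bsub>shift_by k M\<^esub> a \<in> homog (shift_by k M) (n + m)"
    if "x \<in> homog (shift_by k M) n" "a \<in> gr m" for n m x a
    using graded_right_module_ract[OF M, of x "n + k" a m] that by (simp add: ac_simps)
qed

lemma grhom_shift_by: "grhom A (shift_by k M) (shift_by k N) = grhom A M N"
proof -
  have "(\<forall>n. f ` homog M (n + k) \<subseteq> homog N (n + k)) \<longleftrightarrow> (\<forall>n. f ` homog M n \<subseteq> homog N n)" for f
    by (metis diff_add_cancel)
  then show ?thesis
    unfolding grhom_def rhom_def by simp
qed

lemma is_functor_shift: "is_functor (GrR A gr) (GrR A gr) (shift_ftor k)"
  unfolding is_functor_def shift_ftor_def
  by (simp add: shift_by_graded grhom_shift_by)

lemma shift_ftor_inverse: "k + l = 0 \<Longrightarrow> shift_ftor k \<circ>\<^sub>F shift_ftor l = id_ftor"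
  by (simp add: shift_ftor_def comp_ftor_def id_ftor_def shift_by_inverse)

lemma is_equivalence_shift: "is_equivalence (GrR A gr) (GrR A gr) (shift_ftor k)"
proof (rule is_equivalenceI)
  have "nat_isomorphic (GrR A gr) (GrR A gr) id_ftor id_ftor"
    by (rule nat_isomorphic_ftor_eq_on[OF is_category_GrR is_functor_id]) (simp add: ftor_eq_on_def)
  then show "nat_isomorphic (GrR A gr) (GrR A gr) (shift_ftor (- k) \<circ>\<^sub>F shift_ftor k) id_ftor"
    "nat_isomorphic (GrR A gr) (GrR A gr) (shift_ftor k \<circ>\<^sub>F shift_ftor (- k)) id_ftor"
    by (simp_all add: shift_ftor_inverse)
qed (rule is_functor_shift)+

section \<open>Strongly graded rings\<close>

context graded_ring
begin

text \<open>
  The elements \<open>y\<close> such that \<open>x + y\<close> is a sum of products whenever \<open>x\<close> is one contain the products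
  and are closed under addition; so they exhaust the inductively generated product.
\<close>

lemma ideal_prod_sum:
  assumes "y \<in> ideal_prod A I J" and IJ: "I \<subseteq> carrier A" "J \<subseteq> carrier A"
  shows "\<exists>(k :: nat) u v. (\<forall>i<k. u i \<in> I \<and> v i \<in> J) \<and> y = (\<Oplus>i\<in>{..<k}. u i \<otimes> v i)"
proof -
  define rep where "rep y \<longleftrightarrow> (\<exists>(k :: nat) u v. (\<forall>i<k. u i \<in> I \<and> v i \<in> J) \<and>
    y = (\<Oplus>i\<in>{..<k}. u i \<otimes> v i))" for y
  have rep_carrier: "rep x \<Longrightarrow> x \<in> carrier A" for x
    unfolding rep_def using IJ by (auto intro!: finsum_closed)
  have "y \<in> carrier A \<and> (\<forall>x. rep x \<longrightarrow> rep (x \<oplus> y))"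
    using assms(1)
  proof induction
    case (prod a b)
    have "rep (x \<oplus> a \<otimes> b)" if x: "rep x" for x
    proof -
      obtain k :: nat and u v where uv: "\<forall>i<k. u i \<in> I \<and> v i \<in> J" "x = (\<Oplus>i\<in>{..<k}. u i \<otimes> v i)"
        using x unfolding rep_def by blast
      let ?u = "u(k := a)" and ?v = "v(k := b)"
      have uvc: "u i \<in> carrier A" "v i \<in> carrier A" if "i < k" for i
        using uv(1) IJ that by blast+
      have ab: "a \<in> carrier A" "b \<in> carrier A"
        using prod IJ by blast+
      have c: "(\<lambda>i. ?u i \<otimes> ?v i) \<in> {..<k} \<rightarrow> carrier A" "?u k \<otimes> ?v k \<in> carrier A"
        using uvc ab by auto
      have "(\<Oplus>i\<in>{..<k}. ?u i \<otimes> ?v i) = x"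
        unfolding uv(2) using uvc by (intro finsum_cong') auto
      then have "(\<Oplus>i\<in>{..<Suc k}. ?u i \<otimes> ?v i) = a \<otimes> b \<oplus> x"
        using finsum_insert[of "{..<k}" k "\<lambda>i. ?u i \<otimes> ?v i"] c by (simp add: lessThan_Suc)
      then have "x \<oplus> a \<otimes> b = (\<Oplus>i\<in>{..<Suc k}. ?u i \<otimes> ?v i)"
        using rep_carrier[OF x] ab by (simp add: a_comm)
      moreover have "\<forall>i<Suc k. ?u i \<in> I \<and> ?v i \<in> J"
        using uv(1) prod by (auto simp: less_Suc_eq)
      ultimately show ?thesis unfolding rep_def by blast
    qed
    then show ?case using prod IJ by auto
  next
    case (sum s1 s2)
    have "x \<oplus> (s1 \<oplus> s2) = (x \<oplus> s1) \<oplus> s2" if "rep x" for x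
      using sum rep_carrier[OF that] by (simp add: a_assoc)
    then show ?case using sum by auto
  qed
  moreover have "rep \<zero>"
    unfolding rep_def by (rule exI[of _ 0]) simp
  ultimately have "rep y" by (metis l_zero)
  then show ?thesis unfolding rep_def .
qed

lemma graded_module_component_ract:
  assumes M: "graded_right_module A gr M" and x: "x \<in> carrier M" and a: "a \<in> gr m"
  shows "component M (homog M) (n + m) (x \<star>\<^bsub>M\<^esub> a) = component M (homog M) n x \<star>\<^bsub>M\<^esub> a"
proof -
  interpret M: graded_group M "homog M" by (rule graded_right_module_graded_group[OF M])
  interpret MM: right_module A M by (rule graded_right_module_imp_right_module[OF M])
  show ?thesis
    using additive_component[OF M.graded_group_axioms M.graded_group_axioms,
        of "\<lambda>n. n + m" "\<lambda>x. x \<star>\<^bsub>M\<^esub> a" x n]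
      MM.ract_additive[OF gg.part_in_carrier[OF a]] graded_right_module_ract[OF M _ a] x
    by (auto simp: inj_def)
qed

lemma component_mult_right:
  assumes "x \<in> carrier A" and "a \<in> gr m"
  shows "component A gr (n + m) (x \<otimes> a) = component A gr n x \<otimes> a"
proof -
  have "(\<lambda>x. x \<otimes> a) \<in> hom (add_monoid A) (add_monoid A)"
    using gg.part_in_carrier[OF assms(2)] by (intro homI) (simp_all add: l_distr)
  then show ?thesis
    using additive_component[OF gg.graded_group_axioms gg.graded_group_axioms,
        of "\<lambda>n. n + m" "\<lambda>x. x \<otimes> a" x n] gr_mult[OF _ assms(2)] assms(1)
    by (auto simp: inj_def)
qed

end

locale strongly_graded_ring = graded_ring +
  assumes strong: "ideal_prod A (gr n) (gr m) = gr (n + m)"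
begin

text \<open>
  Strong grading enters all arguments about modules through the relations \<open>1 = \<Sum>\<^sub>i u\<^sub>i v\<^sub>i\<close> with \<open>u\<^sub>i\<close> of
  degree \<open>- n\<close> and \<open>v\<^sub>i\<close> of degree \<open>n\<close>, which exist because \<open>1 \<in> A\<^sub>0 = A\<^sub>-\<^sub>n A\<^sub>n\<close>. One such relation
  is fixed for each \<open>n\<close>.
\<close>

definition is_unit_relation :: "int \<Rightarrow> nat \<times> (nat \<Rightarrow> 'a) \<times> (nat \<Rightarrow> 'a) \<Rightarrow> bool" where
  "is_unit_relation n = (\<lambda>(k, u, v). (\<forall>i<k. u i \<in> gr (- n) \<and> v i \<in> gr n) \<and>
    \<one> = (\<Oplus>i\<in>{..<k}. u i \<otimes> v i))"

definition unit_relation :: "int \<Rightarrow> nat \<times> (nat \<Rightarrow> 'a) \<times> (nat \<Rightarrow> 'a)" where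
  "unit_relation n = (SOME r. is_unit_relation n r)"

definition unit_index :: "int \<Rightarrow> nat set" where
  "unit_index n = {..<fst (unit_relation n)}"

definition unit_left :: "int \<Rightarrow> nat \<Rightarrow> 'a" where
  "unit_left n = fst (snd (unit_relation n))"

definition unit_right :: "int \<Rightarrow> nat \<Rightarrow> 'a" where
  "unit_right n = snd (snd (unit_relation n))"

lemma is_unit_relation: "is_unit_relation n (unit_relation n)"
proof -
  have "\<one> \<in> ideal_prod A (gr (- n)) (gr n)"
    using strong[of "- n" n] one_in_gr0 by simp
  then have "\<exists>r. is_unit_relation n r"
    using ideal_prod_sum[OF _ gg.part_subset gg.part_subset] unfolding is_unit_relation_def
    by (simp add: split_paired_Ex)
  then show ?thesis unfolding unit_relation_def by (rule someI_ex)
qed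

lemma unit_left_in: "i \<in> unit_index n \<Longrightarrow> unit_left n i \<in> gr (- n)"
  and unit_right_in: "i \<in> unit_index n \<Longrightarrow> unit_right n i \<in> gr n"
  and unit_sum: "(\<Oplus>i\<in>unit_index n. unit_left n i \<otimes> unit_right n i) = \<one>"
  using is_unit_relation[of n]
  unfolding is_unit_relation_def unit_index_def unit_left_def unit_right_def
  by (auto simp: split_beta)

lemma unit_left_carrier: "i \<in> unit_index n \<Longrightarrow> unit_left n i \<in> carrier A"
  and unit_right_carrier: "i \<in> unit_index n \<Longrightarrow> unit_right n i \<in> carrier A"
  using unit_left_in unit_right_in gg.part_in_carrier by blast+

lemma finite_unit_index [simp]: "finite (unit_index n)"
  by (simp add: unit_index_def)

lemma unit_sum_ract:
  assumes "right_module A M" and y: "y \<in> carrier M"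
  shows "finsum M (\<lambda>i. (y \<star>\<^bsub>M\<^esub> unit_left n i) \<star>\<^bsub>M\<^esub> unit_right n i) (unit_index n) = y"
proof -
  interpret M: right_module A M by fact
  have "y = y \<star>\<^bsub>M\<^esub> (\<Oplus>i\<in>unit_index n. unit_left n i \<otimes> unit_right n i)"
    by (simp add: unit_sum M.ract_one y)
  also have "\<dots> = finsum M (\<lambda>i. y \<star>\<^bsub>M\<^esub> (unit_left n i \<otimes> unit_right n i)) (unit_index n)"
    by (rule M.ract_finsum[OF y]) (auto simp: unit_left_carrier unit_right_carrier)
  also have "\<dots> = finsum M (\<lambda>i. (y \<star>\<^bsub>M\<^esub> unit_left n i) \<star>\<^bsub>M\<^esub> unit_right n i) (unit_index n)"
    using y by (intro M.finsum_cong')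
      (auto simp: M.ract_assoc M.ract_closed unit_left_carrier unit_right_carrier)
  finally show ?thesis by simp
qed

end

subsection \<open>Coinduction\<close>

text \<open>
  The quasi-inverse of \<open>M \<mapsto> M\<^sub>0\<close> is realised by coinduction: \<open>coind N\<close> consists of the
  \<open>A\<^sub>0\<close>-linear maps \<open>A \<rightarrow> N\<close> that vanish on all but finitely many \<open>A\<^sub>m\<close>, with \<open>(f a) b = f (a b)\<close>.
  The maps supported on \<open>A\<^sub>-\<^sub>n\<close> form its part of degree \<open>n\<close>. For a strongly graded ring it is
  isomorphic to \<open>N \<otimes> A\<close>, but it requires no quotient, and its grading is evident.
\<close>

definition degree_support ::
  "(int \<Rightarrow> 'a set) \<Rightarrow> ('n, 'z) ring_scheme \<Rightarrow> ('a \<Rightarrow> 'n) \<Rightarrow> int set" where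
  "degree_support gr N f = {m. \<exists>b\<in>gr m. f b \<noteq> \<zero>\<^bsub>N\<^esub>}"

lemma degree_support_Un:
  assumes "\<And>m b. \<lbrakk>b \<in> gr m; f b = \<zero>\<^bsub>N\<^esub>; g b = \<zero>\<^bsub>N\<^esub>\<rbrakk> \<Longrightarrow> h b = \<zero>\<^bsub>N\<^esub>"
  shows "degree_support gr N h \<subseteq> degree_support gr N f \<union> degree_support gr N g"
  using assms unfolding degree_support_def by blast

context graded_ring
begin

definition coind_carrier :: "('a, 'n) rmodule \<Rightarrow> ('a \<Rightarrow> 'n) set" where
  "coind_carrier N = {f \<in> rhom A0 (regular_module A gr) N. finite (degree_support gr N f)}"

definition coind :: "('a, 'n) rmodule \<Rightarrow> ('a, 'a \<Rightarrow> 'n) grmodule" where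
  "coind N = \<lparr>carrier = coind_carrier N, monoid.mult = (\<lambda>f g. f), one = (\<lambda>b\<in>carrier A. \<zero>\<^bsub>N\<^esub>),
    ring.zero = (\<lambda>b\<in>carrier A. \<zero>\<^bsub>N\<^esub>), ring.add = (\<lambda>f g. \<lambda>b\<in>carrier A. f b \<oplus>\<^bsub>N\<^esub> g b),
    ract = (\<lambda>f a. \<lambda>b\<in>carrier A. f (a \<otimes> b)),
    homog = (\<lambda>n. {f \<in> coind_carrier N. degree_support gr N f \<subseteq> {- n}})\<rparr>"

lemma coind_simps [simp]:
  "carrier (coind N) = coind_carrier N" "\<zero>\<^bsub>coind N\<^esub> = (\<lambda>b\<in>carrier A. \<zero>\<^bsub>N\<^esub>)"
  "f \<oplus>\<^bsub>coind N\<^esub> g = (\<lambda>b\<in>carrier A. f b \<oplus>\<^bsub>N\<^esub> g b)"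
  "f \<star>\<^bsub>coind N\<^esub> a = (\<lambda>b\<in>carrier A. f (a \<otimes> b))"
  "homog (coind N) n = {f \<in> coind_carrier N. degree_support gr N f \<subseteq> {- n}}"
  by (simp_all add: coind_def)

lemma coind_carrierI:
  assumes "f \<in> carrier A \<rightarrow>\<^sub>E carrier N"
    and "\<And>x y. x \<in> carrier A \<Longrightarrow> y \<in> carrier A \<Longrightarrow> f (x \<oplus> y) = f x \<oplus>\<^bsub>N\<^esub> f y"
    and "\<And>x a. x \<in> carrier A \<Longrightarrow> a \<in> gr 0 \<Longrightarrow> f (x \<otimes> a) = f x \<star>\<^bsub>N\<^esub> a"
    and "finite (degree_support gr N f)"
  shows "f \<in> coind_carrier N"
  using assms unfolding coind_carrier_def by (auto intro!: rhomI)

lemma coind_in: "f \<in> coind_carrier N \<Longrightarrow> x \<in> carrier A \<Longrightarrow> f x \<in> carrier N"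
  and coind_map_add:
    "f \<in> coind_carrier N \<Longrightarrow> x \<in> carrier A \<Longrightarrow> y \<in> carrier A \<Longrightarrow> f (x \<oplus> y) = f x \<oplus>\<^bsub>N\<^esub> f y"
  and coind_map_ract: "f \<in> coind_carrier N \<Longrightarrow> x \<in> carrier A \<Longrightarrow> a \<in> gr 0 \<Longrightarrow> f (x \<otimes> a) = f x \<star>\<^bsub>N\<^esub> a"
  and coind_ext: "f \<in> coind_carrier N \<Longrightarrow> f \<in> extensional (carrier A)"
  and coind_finite: "f \<in> coind_carrier N \<Longrightarrow> finite (degree_support gr N f)"
  unfolding coind_carrier_def
  using rhom_in[of f A0 "regular_module A gr" N x] rhom_add[of f A0 "regular_module A gr" N x y]
    rhom_ract[of f A0 "regular_module A gr" N x a] rhom_ext[of f A0 "regular_module A gr" N]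
  by auto

lemma coind_additive: "f \<in> coind_carrier N \<Longrightarrow> f \<in> hom (add_monoid A) (add_monoid N)"
  by (rule homI) (simp_all add: coind_in coind_map_add)

lemma degree_supportD: "b \<in> gr m \<Longrightarrow> m \<notin> degree_support gr N f \<Longrightarrow> f b = \<zero>\<^bsub>N\<^esub>"
  unfolding degree_support_def by blast

lemma coind_eqI:
  assumes f: "f \<in> coind_carrier N" and g: "g \<in> coind_carrier N"
    and eq: "\<And>m b. b \<in> gr m \<Longrightarrow> f b = g b"
  shows "f = g"
proof (rule extensionalityI[OF coind_ext[OF f] coind_ext[OF g]])
  show "f b = g b" if "b \<in> carrier A" for b
    using that
  proof (induction b rule: gg.homogeneous_induct)
    case (homogeneous m b)
    then show ?case by (rule eq)
  next
    case (add x y)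
    then show ?case by (simp add: coind_map_add[OF f] coind_map_add[OF g])
  qed
qed

context
  fixes N :: "('a, 'n) rmodule"
  assumes N: "right_module A0 N"
begin

interpretation N: right_module A0 N by (rule N)

lemma coind_map_zero: "f \<in> coind_carrier N \<Longrightarrow> f \<zero> = \<zero>\<^bsub>N\<^esub>"
  using additive_zero[OF abelian_group_axioms N.M.abelian_group_axioms coind_additive] .

lemma coind_add_closed:
  assumes f: "f \<in> coind_carrier N" and g: "g \<in> coind_carrier N"
  shows "(\<lambda>b\<in>carrier A. f b \<oplus>\<^bsub>N\<^esub> g b) \<in> coind_carrier N"
proof (rule coind_carrierI)
  have "degree_support gr N (\<lambda>b\<in>carrier A. f b \<oplus>\<^bsub>N\<^esub> g b) \<subseteq> degree_support gr N f \<union> degree_support gr N g"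
    by (rule degree_support_Un) (simp add: gg.part_in_carrier)
  then show "finite (degree_support gr N (\<lambda>b\<in>carrier A. f b \<oplus>\<^bsub>N\<^esub> g b))"
    using coind_finite[OF f] coind_finite[OF g] finite_subset by blast
qed (simp_all add: coind_in[OF f] coind_in[OF g] coind_map_add[OF f] coind_map_add[OF g]
    coind_map_ract[OF f] coind_map_ract[OF g] N.M.a_ac gg.part_in_carrier N.ract_l_distr)

lemma coind_zero_closed: "(\<lambda>b\<in>carrier A. \<zero>\<^bsub>N\<^esub>) \<in> coind_carrier N"
  by (rule coind_carrierI)
    (auto simp: N.zero_ract degree_support_def gg.part_in_carrier)

lemma coind_a_inv_closed:
  assumes f: "f \<in> coind_carrier N"
  shows "(\<lambda>b\<in>carrier A. \<ominus>\<^bsub>N\<^esub> f b) \<in> coind_carrier N"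
proof (rule coind_carrierI)
  have "degree_support gr N (\<lambda>b\<in>carrier A. \<ominus>\<^bsub>N\<^esub> f b) \<subseteq> degree_support gr N f \<union> degree_support gr N f"
    by (rule degree_support_Un) (simp add: gg.part_in_carrier)
  then show "finite (degree_support gr N (\<lambda>b\<in>carrier A. \<ominus>\<^bsub>N\<^esub> f b))"
    using coind_finite[OF f] finite_subset by blast
  show "(\<lambda>b\<in>carrier A. \<ominus>\<^bsub>N\<^esub> f b) (x \<otimes> a) = (\<lambda>b\<in>carrier A. \<ominus>\<^bsub>N\<^esub> f b) x \<star>\<^bsub>N\<^esub> a"
    if "x \<in> carrier A" "a \<in> gr 0" for x a
    using that additive_a_inv[OF N.M.abelian_group_axioms N.M.abelian_group_axioms N.ract_additive]
    by (simp add: coind_in[OF f] coind_map_ract[OF f] gg.part_in_carrier)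
qed (simp_all add: coind_in[OF f] coind_map_add[OF f] N.M.minus_add)

text \<open>
  Finiteness of the support is checked for homogeneous \<open>a\<close>, where \<open>f (a b)\<close> with \<open>b\<close> of degree \<open>j\<close>
  involves \<open>f\<close> in a degree which differs from \<open>j\<close> by a constant, and is then extended additively.
\<close>

lemma coind_ract_closed:
  assumes f: "f \<in> coind_carrier N" and a: "a \<in> carrier A"
  shows "(\<lambda>b\<in>carrier A. f (a \<otimes> b)) \<in> coind_carrier N"
proof (rule coind_carrierI)
  show "finite (degree_support gr N (\<lambda>b\<in>carrier A. f (a \<otimes> b)))"
    using a
  proof (induction a rule: gg.homogeneous_induct)
    case (homogeneous m a)
    have "j \<in> (\<lambda>n. n - m) ` degree_support gr N f"
      if "j \<in> degree_support gr N (\<lambda>b\<in>carrier A. f (a \<otimes> b))" for j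
    proof -
      obtain b where b: "b \<in> gr j" "f (a \<otimes> b) \<noteq> \<zero>\<^bsub>N\<^esub>"
        using \<open>j \<in> _\<close> gg.part_in_carrier unfolding degree_support_def by auto
      then have "m + j \<in> degree_support gr N f"
        using gr_mult[OF homogeneous b(1)] unfolding degree_support_def by blast
      then show ?thesis by force
    qed
    then show ?case
      using coind_finite[OF f] finite_subset by (metis finite_imageI subsetI)
  next
    case (add x y)
    have "degree_support gr N (\<lambda>b\<in>carrier A. f ((x \<oplus> y) \<otimes> b)) \<subseteq>
        degree_support gr N (\<lambda>b\<in>carrier A. f (x \<otimes> b)) \<union> degree_support gr N (\<lambda>b\<in>carrier A. f (y \<otimes> b))"
      using add(1,2)
      by (intro degree_support_Un) (simp add: gg.part_in_carrier l_distr coind_map_add[OF f])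
    then show ?case using add(3,4) finite_subset by blast
  qed
qed (use a in \<open>simp_all add: coind_in[OF f] coind_map_add[OF f] r_distr gg.part_in_carrier
    m_assoc[symmetric] coind_map_ract[OF f]\<close>)

lemma coind_right_module: "right_module A (coind N)"
proof -
  have "abelian_group (coind N)"
  proof (rule abelian_groupI, unfold coind_simps)
    show "(\<lambda>b\<in>carrier A. \<zero>\<^bsub>N\<^esub>) \<in> coind_carrier N" by (rule coind_zero_closed)
    fix f assume f: "f \<in> coind_carrier N"
    show "(\<lambda>b\<in>carrier A. (\<lambda>b\<in>carrier A. \<zero>\<^bsub>N\<^esub>) b \<oplus>\<^bsub>N\<^esub> f b) = f"
      by (rule coind_eqI[OF coind_add_closed[OF coind_zero_closed f] f])
        (simp add: coind_in[OF f] gg.part_in_carrier)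
    show "\<exists>g\<in>coind_carrier N. (\<lambda>b\<in>carrier A. g b \<oplus>\<^bsub>N\<^esub> f b) = (\<lambda>b\<in>carrier A. \<zero>\<^bsub>N\<^esub>)"
    proof (rule bexI[OF _ coind_a_inv_closed[OF f]])
      show "(\<lambda>b\<in>carrier A. (\<lambda>b\<in>carrier A. \<ominus>\<^bsub>N\<^esub> f b) b \<oplus>\<^bsub>N\<^esub> f b) = (\<lambda>b\<in>carrier A. \<zero>\<^bsub>N\<^esub>)"
        by (auto simp: fun_eq_iff restrict_def N.M.l_neg coind_in[OF f])
    qed
    fix g assume g: "g \<in> coind_carrier N"
    show "(\<lambda>b\<in>carrier A. f b \<oplus>\<^bsub>N\<^esub> g b) \<in> coind_carrier N" by (rule coind_add_closed[OF f g])
    show "(\<lambda>b\<in>carrier A. f b \<oplus>\<^bsub>N\<^esub> g b) = (\<lambda>b\<in>carrier A. g b \<oplus>\<^bsub>N\<^esub> f b)"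
      by (auto simp: fun_eq_iff restrict_def N.M.a_comm coind_in[OF f] coind_in[OF g])
    fix h assume h: "h \<in> coind_carrier N"
    show "(\<lambda>b\<in>carrier A. (\<lambda>b\<in>carrier A. f b \<oplus>\<^bsub>N\<^esub> g b) b \<oplus>\<^bsub>N\<^esub> h b) =
        (\<lambda>b\<in>carrier A. f b \<oplus>\<^bsub>N\<^esub> (\<lambda>b\<in>carrier A. g b \<oplus>\<^bsub>N\<^esub> h b) b)"
      by (auto simp: fun_eq_iff restrict_def N.M.a_assoc coind_in[OF f] coind_in[OF g] coind_in[OF h])
  qed
  then show ?thesis
  proof (intro right_module.intro right_module_axioms.intro ring_axioms, unfold coind_simps)
    fix f assume f: "f \<in> coind_carrier N"
    show "(\<lambda>b\<in>carrier A. f (\<one> \<otimes> b)) = f"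
      by (rule coind_eqI[OF coind_ract_closed[OF f one_closed] f]) (simp add: gg.part_in_carrier)
    fix a assume a: "a \<in> carrier A"
    show "(\<lambda>b\<in>carrier A. f (a \<otimes> b)) \<in> coind_carrier N" by (rule coind_ract_closed[OF f a])
    fix b assume b: "b \<in> carrier A"
    show "(\<lambda>c\<in>carrier A. f ((a \<oplus> b) \<otimes> c)) =
        (\<lambda>c\<in>carrier A. (\<lambda>c\<in>carrier A. f (a \<otimes> c)) c \<oplus>\<^bsub>N\<^esub> (\<lambda>c\<in>carrier A. f (b \<otimes> c)) c)"
      using a b by (auto simp: fun_eq_iff restrict_def l_distr coind_map_add[OF f])
    show "(\<lambda>c\<in>carrier A. (\<lambda>c\<in>carrier A. f (a \<otimes> c)) (b \<otimes> c)) = (\<lambda>c\<in>carrier A. f (a \<otimes> b \<otimes> c))"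
      using a b by (auto simp: fun_eq_iff restrict_def m_assoc)
  next
    fix f g a assume "f \<in> coind_carrier N" "g \<in> coind_carrier N" and a: "a \<in> carrier A"
    show "(\<lambda>b\<in>carrier A. (\<lambda>b\<in>carrier A. f b \<oplus>\<^bsub>N\<^esub> g b) (a \<otimes> b)) =
        (\<lambda>b\<in>carrier A. (\<lambda>b\<in>carrier A. f (a \<otimes> b)) b \<oplus>\<^bsub>N\<^esub> (\<lambda>b\<in>carrier A. g (a \<otimes> b)) b)"
      using a by (auto simp: fun_eq_iff restrict_def)
  qed
qed

lemma coind_component_closed:
  assumes f: "f \<in> coind_carrier N"
  shows "(\<lambda>b\<in>carrier A. f (component A gr (- n) b)) \<in> homog (coind N) n"
proof -
  let ?p = "\<lambda>b\<in>carrier A. f (component A gr (- n) b)"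
  have supp: "degree_support gr N ?p \<subseteq> {- n}"
  proof
    fix m assume "m \<in> degree_support gr N ?p"
    then obtain b where b: "b \<in> gr m" "?p b \<noteq> \<zero>\<^bsub>N\<^esub>"
      unfolding degree_support_def by blast
    then have "component A gr (- n) b \<noteq> \<zero>"
      using coind_map_zero[OF f] gg.part_in_carrier[OF b(1)] by auto
    then have "- n = m"
      using gg.component_other[OF b(1)] by blast
    then show "m \<in> {- n}" by simp
  qed
  have "?p \<in> coind_carrier N"
  proof (rule coind_carrierI)
    show "finite (degree_support gr N ?p)"
      using supp finite_subset by blast
    show "?p (x \<otimes> a) = ?p x \<star>\<^bsub>N\<^esub> a" if "x \<in> carrier A" "a \<in> gr 0" for x a
      using that component_mult_right[OF that, of "- n"]
      by (simp add: gg.part_in_carrier gg.component_carrier coind_map_ract[OF f])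
  qed (simp_all add: coind_in[OF f] coind_map_add[OF f] gg.component_add gg.component_carrier)
  then show ?thesis using supp by simp
qed

lemma coind_graded: "graded_right_module A gr (coind N)"
proof (rule graded_right_moduleI[OF coind_right_module])
  \<comment> \<open>The component of \<open>f\<close> in degree \<open>n\<close> is \<open>f\<close> after the projection onto \<open>A\<^sub>-\<^sub>n\<close>.\<close>
  show "graded_projections (coind N) (homog (coind N))
      (\<lambda>n f. \<lambda>b\<in>carrier A. f (component A gr (- n) b))" (is "graded_projections _ _ ?p")
    unfolding graded_projections_def
  proof (intro conjI allI ballI impI)
    show "homog (coind N) n \<subseteq> carrier (coind N)" for n by auto
    show "?p n f \<in> homog (coind N) n" if "f \<in> carrier (coind N)" for n f
      using coind_component_closed that by simp
    show "?p n \<in> hom (add_monoid (coind N)) (add_monoid (coind N))" for n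
    proof (rule homI)
      show "?p n f \<in> carrier (add_monoid (coind N))" if "f \<in> carrier (add_monoid (coind N))" for f
        using coind_component_closed[of f n] that by simp
    qed (auto simp: fun_eq_iff restrict_def gg.component_carrier)
    show "?p n f = f" if f: "f \<in> homog (coind N) n" for n f
    proof (rule coind_eqI)
      show "?p n f \<in> coind_carrier N" "f \<in> coind_carrier N"
        using f coind_component_closed[of f n] by auto
      show "?p n f b = f b" if b: "b \<in> gr m" for m b
      proof (cases "m = - n")
        case True
        then show ?thesis using b gg.part_in_carrier[OF b] gg.component_same[OF b] by simp
      next
        case False
        then have "f b = \<zero>\<^bsub>N\<^esub>" using f b by (auto simp: degree_support_def)
        then show ?thesis
          using False f b gg.part_in_carrier[OF b] gg.component_other[OF b, of "- n"]
          by (simp add: coind_map_zero)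
      qed
    qed
    have p_zero: "?p n f = \<zero>\<^bsub>coind N\<^esub>" if "- n \<notin> degree_support gr N f" for n f
    proof -
      have "f (component A gr (- n) b) = \<zero>\<^bsub>N\<^esub>" if "b \<in> carrier A" for b
        by (rule degree_supportD[OF gg.component_in[OF that]]) fact
      then show ?thesis by (auto simp: fun_eq_iff restrict_def)
    qed
    show "?p n f = \<zero>\<^bsub>coind N\<^esub>" if "f \<in> homog (coind N) m" and "n \<noteq> m" for n m f
      using that by (intro p_zero) auto
    fix f assume "f \<in> carrier (coind N)"
    then have f: "f \<in> coind_carrier N" by simp
    have "{n. ?p n f \<noteq> \<zero>\<^bsub>coind N\<^esub>} \<subseteq> uminus ` degree_support gr N f"
    proof
      fix n assume "n \<in> {n. ?p n f \<noteq> \<zero>\<^bsub>coind N\<^esub>}"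
      then have "- n \<in> degree_support gr N f" using p_zero by blast
      then show "n \<in> uminus ` degree_support gr N f" by (rule rev_image_eqI) simp
    qed
    then show "finite {n. ?p n f \<noteq> \<zero>\<^bsub>coind N\<^esub>}"
      using coind_finite[OF f] finite_subset by blast
    show "f = \<zero>\<^bsub>coind N\<^esub>" if z: "\<forall>n. ?p n f = \<zero>\<^bsub>coind N\<^esub>"
      unfolding coind_simps
    proof (rule coind_eqI[OF f coind_zero_closed])
      fix m b assume b: "b \<in> gr m"
      have "?p (- m) f b = \<zero>\<^bsub>N\<^esub>"
        using fun_cong[OF spec[OF z, of "- m"], of b] gg.part_in_carrier[OF b] by simp
      then show "f b = (\<lambda>b\<in>carrier A. \<zero>\<^bsub>N\<^esub>) b"
        using gg.part_in_carrier[OF b] gg.component_same[OF b] by simp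
    qed
  qed
  fix n m f a assume f: "f \<in> homog (coind N) n" and a: "a \<in> gr m"
  have "degree_support gr N (\<lambda>b\<in>carrier A. f (a \<otimes> b)) \<subseteq> {- (n + m)}"
  proof
    fix j assume "j \<in> degree_support gr N (\<lambda>b\<in>carrier A. f (a \<otimes> b))"
    then obtain b where b: "b \<in> gr j" "f (a \<otimes> b) \<noteq> \<zero>\<^bsub>N\<^esub>"
      using gg.part_in_carrier unfolding degree_support_def by auto
    then have "m + j \<in> degree_support gr N f"
      using gr_mult[OF a b(1)] unfolding degree_support_def by blast
    then have "m + j = - n" using f by auto
    then show "j \<in> {- (n + m)}" by simp
  qed
  then show "f \<star>\<^bsub>coind N\<^esub> a \<in> homog (coind N) (n + m)"
    using f coind_ract_closed[of f a] gg.part_in_carrier[OF a] by simp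
qed

end

end

subsection \<open>The unit and the counit\<close>

text \<open>
  Coinduction is right adjoint to \<open>M \<mapsto> M\<^sub>0\<close> over any graded ring. The unit sends \<open>y \<in> M\<close> to the map
  \<open>b \<mapsto> (y b)\<^sub>0\<close>, the counit is evaluation at \<open>1\<close>. The counit is always bijective; for the unit this is
  where the grading has to be strong.
\<close>

context graded_ring
begin

definition coind_unit :: "('a, 'm) grmodule \<Rightarrow> 'm \<Rightarrow> 'a \<Rightarrow> 'm" where
  "coind_unit M y = (\<lambda>b\<in>carrier A. component M (homog M) 0 (y \<star>\<^bsub>M\<^esub> b))"

context
  fixes M :: "('a, 'm) grmodule"
  assumes M: "graded_right_module A gr M"
begin

interpretation M: graded_group M "homog M" by (rule graded_right_module_graded_group[OF M])
interpretation MM: right_module A M by (rule graded_right_module_imp_right_module[OF M])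

lemma coind_unit_add:
  assumes x: "x \<in> carrier M" and y: "y \<in> carrier M"
  shows "coind_unit M (x \<oplus>\<^bsub>M\<^esub> y) = coind_unit M x \<oplus>\<^bsub>coind (degree_part M 0)\<^esub> coind_unit M y"
  using x y by (auto simp: coind_unit_def fun_eq_iff restrict_def MM.ract_l_distr M.component_add
      MM.ract_closed)

lemma coind_unit_support:
  assumes y: "y \<in> homog M n"
  shows "degree_support gr (degree_part M 0) (coind_unit M y) \<subseteq> {- n}"
proof
  fix m assume "m \<in> degree_support gr (degree_part M 0) (coind_unit M y)"
  then obtain b where b: "b \<in> gr m" "coind_unit M y b \<noteq> \<zero>\<^bsub>M\<^esub>"
    unfolding degree_support_def by auto
  then have "component M (homog M) 0 (y \<star>\<^bsub>M\<^esub> b) \<noteq> \<zero>\<^bsub>M\<^esub>"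
    by (simp add: coind_unit_def gg.part_in_carrier)
  then have "0 = n + m"
    using M.component_other[OF graded_right_module_ract[OF M y b(1)]] by blast
  then show "m \<in> {- n}" by simp
qed

lemma coind_unit_in:
  assumes y: "y \<in> carrier M"
  shows "coind_unit M y \<in> coind_carrier (degree_part M 0)"
proof (rule coind_carrierI)
  show "finite (degree_support gr (degree_part M 0) (coind_unit M y))"
    using y
  proof (induction y rule: M.homogeneous_induct)
    case (homogeneous n y)
    show ?case using coind_unit_support[OF homogeneous] finite_subset by blast
  next
    case (add x y)
    have "degree_support gr (degree_part M 0) (coind_unit M (x \<oplus>\<^bsub>M\<^esub> y)) \<subseteq>
        degree_support gr (degree_part M 0) (coind_unit M x) \<union>
        degree_support gr (degree_part M 0) (coind_unit M y)"
      unfolding coind_unit_add[OF add(1,2)]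
      by (rule degree_support_Un) (simp add: gg.part_in_carrier)
    then show ?case using add(3,4) finite_subset by blast
  qed
  show "coind_unit M y (x \<otimes> a) = coind_unit M y x \<star>\<^bsub>degree_part M 0\<^esub> a"
    if "x \<in> carrier A" "a \<in> gr 0" for x a
    using that y graded_module_component_ract[OF M, of "y \<star>\<^bsub>M\<^esub> x" a 0 0]
    by (simp add: coind_unit_def gg.part_in_carrier MM.ract_assoc MM.ract_closed)
qed (use y in \<open>simp_all add: coind_unit_def MM.ract_closed MM.ract_r_distr M.component_add
      M.component_in\<close>)

lemma coind_unit_ract:
  assumes y: "y \<in> carrier M" and a: "a \<in> carrier A"
  shows "coind_unit M (y \<star>\<^bsub>M\<^esub> a) = coind_unit M y \<star>\<^bsub>coind (degree_part M 0)\<^esub> a"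
  using y a by (auto simp: coind_unit_def fun_eq_iff restrict_def MM.ract_assoc)

lemma coind_unit_homog:
  "y \<in> homog M n \<Longrightarrow> coind_unit M y \<in> homog (coind (degree_part M 0)) n"
  using coind_unit_support coind_unit_in M.part_in_carrier by simp

end

definition coind_counit :: "('a \<Rightarrow> 'n) \<Rightarrow> 'n" where
  "coind_counit f = f \<one>"

context
  fixes N :: "('a, 'n) rmodule"
  assumes N: "right_module A0 N"
begin

interpretation N: right_module A0 N by (rule N)

lemma coind_counit_ract:
  assumes "f \<in> coind_carrier N" "a \<in> gr 0"
  shows "coind_counit (f \<star>\<^bsub>coind N\<^esub> a) = coind_counit f \<star>\<^bsub>N\<^esub> a"
  using assms coind_map_ract[OF assms(1) one_closed assms(2)]
  by (simp add: coind_counit_def gg.part_in_carrier)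

text \<open>
  A map of degree zero factors through the projection onto \<open>A\<^sub>0\<close>, on which it is determined by its
  value at \<open>1\<close>.
\<close>

lemma coind_counit_bij: "bij_betw coind_counit (homog (coind N) 0) (carrier N)"
proof (rule bij_betw_imageI)
  have val: "f b = f \<one> \<star>\<^bsub>N\<^esub> component A gr 0 b"
    if f: "f \<in> homog (coind N) 0" and b: "b \<in> carrier A" for f b
  proof -
    have fc: "f \<in> coind_carrier N" using f by simp
    have "f b = f (component A gr 0 b)"
      using b
    proof (induction b rule: gg.homogeneous_induct)
      case (homogeneous m b)
      show ?case
      proof (cases "m = 0")
        case False
        then have "f b = \<zero>\<^bsub>N\<^esub>" "component A gr 0 b = \<zero>"
          using f homogeneous gg.component_other[OF homogeneous, of 0]
          by (auto simp: degree_support_def)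
        then show ?thesis using coind_map_zero[OF N fc] by simp
      qed (use homogeneous gg.component_same in auto)
    next
      case (add x y)
      then show ?case
        by (simp add: coind_map_add[OF fc] gg.component_add gg.component_carrier)
    qed
    also have "\<dots> = f (\<one> \<otimes> component A gr 0 b)"
      using b by (simp add: gg.component_carrier)
    also have "\<dots> = f \<one> \<star>\<^bsub>N\<^esub> component A gr 0 b"
      by (rule coind_map_ract[OF fc one_closed gg.component_in[OF b]])
    finally show ?thesis .
  qed
  show "inj_on coind_counit (homog (coind N) 0)"
  proof (rule inj_onI)
    fix f g assume f: "f \<in> homog (coind N) 0" and g: "g \<in> homog (coind N) 0"
      and eq: "coind_counit f = coind_counit g"
    show "f = g"
    proof (rule coind_eqI)
      show "f \<in> coind_carrier N" "g \<in> coind_carrier N" using f g by auto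
      show "f b = g b" if "b \<in> gr m" for m b
        using val[OF f gg.part_in_carrier[OF that]] val[OF g gg.part_in_carrier[OF that]] eq
        by (simp add: coind_counit_def)
    qed
  qed
  show "coind_counit ` homog (coind N) 0 = carrier N"
  proof (intro equalityI subsetI)
    show "x \<in> carrier N" if "x \<in> coind_counit ` homog (coind N) 0" for x
      using that by (auto simp: coind_counit_def coind_in)
    fix x assume x: "x \<in> carrier N"
    let ?f = "\<lambda>b\<in>carrier A. x \<star>\<^bsub>N\<^esub> component A gr 0 b"
    have supp: "degree_support gr N ?f \<subseteq> {0}"
    proof
      fix m assume "m \<in> degree_support gr N ?f"
      then obtain b where b: "b \<in> gr m" "?f b \<noteq> \<zero>\<^bsub>N\<^esub>"
        unfolding degree_support_def by auto
      then have "component A gr 0 b \<noteq> \<zero>"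
        using N.ract_zero[OF x] gg.part_in_carrier[OF b(1)] by auto
      then have "0 = m"
        using gg.component_other[OF b(1)] by blast
      then show "m \<in> {0}" by simp
    qed
    have "?f \<in> coind_carrier N"
    proof (rule coind_carrierI)
      show "finite (degree_support gr N ?f)" using supp finite_subset by blast
      show "?f \<in> carrier A \<rightarrow>\<^sub>E carrier N"
        using N.ract_closed[OF x] gg.component_in by simp
      show "?f (y \<oplus> z) = ?f y \<oplus>\<^bsub>N\<^esub> ?f z" if "y \<in> carrier A" "z \<in> carrier A" for y z
        using that N.ract_r_distr[OF x] gg.component_in by (simp add: gg.component_add)
      show "?f (y \<otimes> a) = ?f y \<star>\<^bsub>N\<^esub> a" if "y \<in> carrier A" "a \<in> gr 0" for y a
        using that N.ract_assoc[OF x] gg.component_in[OF that(1), of 0] component_mult_right[OF that, of 0]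
        by (simp add: gg.part_in_carrier)
    qed
    moreover have "x = coind_counit ?f"
      using N.ract_one[OF x] gg.component_same[OF one_in_gr0] by (simp add: coind_counit_def)
    ultimately show "x \<in> coind_counit ` homog (coind N) 0"
      using supp by (intro image_eqI[of _ _ ?f]) auto
  qed
qed

end

end

context strongly_graded_ring
begin

text \<open>
  An element \<open>y\<close> of degree \<open>n\<close> is recovered as \<open>\<Sum>\<^sub>i (y u\<^sub>i) v\<^sub>i\<close> from the products \<open>y u\<^sub>i\<close> of degree \<open>0\<close>;
  and a map \<open>f\<close> supported on \<open>A\<^sub>-\<^sub>n\<close> is the image of \<open>\<Sum>\<^sub>i f(u\<^sub>i) v\<^sub>i\<close>.
\<close>

lemma coind_unit_bij:
  assumes M: "graded_right_module A gr M"
  shows "bij_betw (coind_unit M) (carrier M) (carrier (coind (degree_part M 0)))"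
proof (rule bij_betw_imageI)
  interpret M: graded_group M "homog M" by (rule graded_right_module_graded_group[OF M])
  interpret MM: right_module A M by (rule graded_right_module_imp_right_module[OF M])
  let ?N = "degree_part M 0"
  have N: "right_module A0 ?N" by (rule degree_part_right_module[OF M])
  interpret C: graded_group "coind ?N" "homog (coind ?N)"
    by (rule graded_right_module_graded_group[OF coind_graded[OF N]])
  have recover: "component M (homog M) n y =
      finsum M (\<lambda>i. coind_unit M y (unit_left n i) \<star>\<^bsub>M\<^esub> unit_right n i) (unit_index n)"
    if y: "y \<in> carrier M" for y n
  proof -
    have "component M (homog M) n y \<star>\<^bsub>M\<^esub> unit_left n i = coind_unit M y (unit_left n i)"
      if "i \<in> unit_index n" for i
      using graded_module_component_ract[OF M y unit_left_in[OF that], of n] unit_left_carrier[OF that]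
      by (simp add: coind_unit_def)
    moreover have "component M (homog M) n y \<star>\<^bsub>M\<^esub> unit_left n i \<in> carrier M"
      if "i \<in> unit_index n" for i
      using that y by (simp add: MM.ract_closed M.component_carrier unit_left_carrier)
    ultimately have "finsum M (\<lambda>i. (component M (homog M) n y \<star>\<^bsub>M\<^esub> unit_left n i) \<star>\<^bsub>M\<^esub> unit_right n i)
        (unit_index n) = finsum M (\<lambda>i. coind_unit M y (unit_left n i) \<star>\<^bsub>M\<^esub> unit_right n i) (unit_index n)"
      by (intro M.finsum_cong') (auto simp: MM.ract_closed unit_right_carrier)
    then show ?thesis
      using unit_sum_ract[OF MM.right_module_axioms M.component_carrier[OF y]] by simp
  qed
  show "inj_on (coind_unit M) (carrier M)"
    by (rule inj_onI, rule M.component_eqI) (simp_all add: recover)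
  show "coind_unit M ` carrier M = carrier (coind ?N)"
  proof (intro equalityI subsetI)
    show "f \<in> carrier (coind ?N)" if "f \<in> coind_unit M ` carrier M" for f
      using that coind_unit_in[OF M] by auto
    show "f \<in> coind_unit M ` carrier M" if "f \<in> carrier (coind ?N)" for f
      using that
    proof (induction f rule: C.homogeneous_induct)
      case (add f g)
      then obtain x y where "x \<in> carrier M" "f = coind_unit M x" "y \<in> carrier M" "g = coind_unit M y"
        by blast
      then show ?case
        by (intro image_eqI[of _ _ "x \<oplus>\<^bsub>M\<^esub> y"]) (simp_all only: coind_unit_add[OF M] M.a_closed)
    next
      case (homogeneous n f)
      then have f: "f \<in> coind_carrier ?N" by simp
      have f0: "f b \<in> homog M 0" if "b \<in> carrier A" for b
        using coind_in[OF f that] by simp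
      define y where "y = finsum M (\<lambda>i. f (unit_left n i) \<star>\<^bsub>M\<^esub> unit_right n i) (unit_index n)"
      have summand: "f (unit_left n i) \<star>\<^bsub>M\<^esub> unit_right n i \<in> homog M n" if "i \<in> unit_index n" for i
        using graded_right_module_ract[OF M f0 unit_right_in] that unit_left_carrier by fastforce
      have "finsum M (\<lambda>i. f (unit_left n i) \<star>\<^bsub>M\<^esub> unit_right n i) J \<in> homog M n"
        if "finite J" "J \<subseteq> unit_index n" for J
        using that
      proof induction
        case empty
        show ?case by (simp add: M.part_zero)
      next
        case (insert i J)
        have "finsum M (\<lambda>i. f (unit_left n i) \<star>\<^bsub>M\<^esub> unit_right n i) (insert i J) =
            f (unit_left n i) \<star>\<^bsub>M\<^esub> unit_right n i \<oplus>\<^bsub>M\<^esub>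
            finsum M (\<lambda>i. f (unit_left n i) \<star>\<^bsub>M\<^esub> unit_right n i) J"
          using insert summand M.part_in_carrier by (intro M.finsum_insert) auto
        then show ?case using insert summand by (simp add: M.part_add)
      qed
      then have yn: "y \<in> homog M n"
        unfolding y_def by simp
      then have y: "y \<in> carrier M" by (rule M.part_in_carrier)
      have "coind_unit M y = f"
      proof (rule coind_eqI[OF coind_unit_in[OF M y] f])
        fix m b assume b: "b \<in> gr m"
        then have bA: "b \<in> carrier A" by (rule gg.part_in_carrier)
        show "coind_unit M y b = f b"
        proof (cases "m = - n")
          case False
          then have "m \<notin> degree_support gr ?N (coind_unit M y)" "m \<notin> degree_support gr ?N f"
            using coind_unit_support[OF M yn] homogeneous by auto
          then have "coind_unit M y b = \<zero>\<^bsub>?N\<^esub>" "f b = \<zero>\<^bsub>?N\<^esub>"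
            using degree_supportD[OF b] by blast+
          then show ?thesis by simp
        next
          case True
          have vb: "unit_right n i \<otimes> b \<in> gr 0" if "i \<in> unit_index n" for i
            using gr_mult[OF unit_right_in[OF that] b] True by simp
          have term_eq: "(f (unit_left n i) \<star>\<^bsub>M\<^esub> unit_right n i) \<star>\<^bsub>M\<^esub> b =
              f ((unit_left n i \<otimes> unit_right n i) \<otimes> b)" if i: "i \<in> unit_index n" for i
          proof -
            have "(f (unit_left n i) \<star>\<^bsub>M\<^esub> unit_right n i) \<star>\<^bsub>M\<^esub> b =
                f (unit_left n i) \<star>\<^bsub>M\<^esub> (unit_right n i \<otimes> b)"
              using i bA M.part_in_carrier[OF f0] by (simp add: MM.ract_assoc unit_left_carrier unit_right_carrier)
            also have "\<dots> = f (unit_left n i \<otimes> (unit_right n i \<otimes> b))"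
              using coind_map_ract[OF f unit_left_carrier[OF i] vb[OF i]] by simp
            finally show ?thesis
              using i bA by (simp add: m_assoc unit_left_carrier unit_right_carrier)
          qed
          have "y \<star>\<^bsub>M\<^esub> b = finsum M (\<lambda>i. (f (unit_left n i) \<star>\<^bsub>M\<^esub> unit_right n i) \<star>\<^bsub>M\<^esub> b) (unit_index n)"
            unfolding y_def using summand M.part_in_carrier by (intro MM.finsum_ract[OF bA]) auto
          also have "\<dots> = finsum M (\<lambda>i. f ((unit_left n i \<otimes> unit_right n i) \<otimes> b)) (unit_index n)"
            using term_eq M.part_in_carrier[OF f0] bA unit_left_carrier unit_right_carrier
            by (intro M.finsum_cong') auto
          also have "\<dots> = f (\<Oplus>i\<in>unit_index n. (unit_left n i \<otimes> unit_right n i) \<otimes> b)"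
          proof -
            have "f \<in> hom (add_monoid A) (add_monoid M)"
              using coind_map_add[OF f] M.part_in_carrier[OF f0] by (intro homI) simp_all
            then show ?thesis
              using bA unit_left_carrier unit_right_carrier
              by (intro additive_finsum[OF abelian_group_axioms M.abelian_group_axioms, symmetric]) auto
          qed
          also have "(\<Oplus>i\<in>unit_index n. (unit_left n i \<otimes> unit_right n i) \<otimes> b) = b"
            using finsum_ldistr[OF finite_unit_index bA, of "\<lambda>i. unit_left n i \<otimes> unit_right n i" n]
              bA unit_left_carrier unit_right_carrier by (simp add: unit_sum Pi_iff)
          finally have "y \<star>\<^bsub>M\<^esub> b = f b" .
          then show ?thesis
            using bA M.component_same[OF f0[OF bA]] by (simp add: coind_unit_def)
        qed
      qed
      then show ?case using y by blast
    qed
  qed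
qed

text \<open>
  A coinduced map is determined on \<open>A\<^sub>m\<close> by its values at finitely many elements, since
  \<open>f b = \<Sum>\<^sub>i f(u\<^sub>i) v\<^sub>i b\<close>. Its graph over these elements, for the finitely many \<open>m\<close> in its support, is
  a finite set which determines it. So coinduction does not leave the universe.
\<close>

lemma coind_lepoll:
  fixes N :: "('a, 'u) rmodule"
  assumes N: "right_module A0 N" and inf: "infinite (UNIV :: 'u set)"
    and A: "carrier A \<lesssim> (UNIV :: 'u set)"
  shows "carrier (coind N) \<lesssim> (UNIV :: 'u set)"
proof -
  interpret N: right_module A0 N by (rule N)
  let ?pts = "\<lambda>f. {unit_left (- m) i | m i. m \<in> degree_support gr N f \<and> i \<in> unit_index (- m)}"
  let ?code = "\<lambda>f. (\<lambda>b. (b, f b)) ` ?pts f"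
  have fin: "finite (?pts f)" if "f \<in> coind_carrier N" for f
  proof -
    have "?pts f = (\<Union>m\<in>degree_support gr N f. unit_left (- m) ` unit_index (- m))" by blast
    then show ?thesis using coind_finite[OF that] by simp
  qed
  have agree: "f b = g b"
    if f: "f \<in> coind_carrier N" and g: "g \<in> coind_carrier N" and b: "b \<in> gr m"
      and eq: "\<And>i. i \<in> unit_index (- m) \<Longrightarrow> f (unit_left (- m) i) = g (unit_left (- m) i)" for f g m b
  proof -
    let ?u = "unit_left (- m)" and ?v = "unit_right (- m)" and ?J = "unit_index (- m)"
    have bA: "b \<in> carrier A" by (rule gg.part_in_carrier[OF b])
    have "(\<Oplus>i\<in>?J. (?u i \<otimes> ?v i) \<otimes> b) = b"
      using finsum_ldistr[OF finite_unit_index bA, of "\<lambda>i. ?u i \<otimes> ?v i" "- m"]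
        bA unit_left_carrier unit_right_carrier by (simp add: unit_sum Pi_iff)
    moreover have "(\<Oplus>i\<in>?J. (?u i \<otimes> ?v i) \<otimes> b) = (\<Oplus>i\<in>?J. ?u i \<otimes> (?v i \<otimes> b))"
      using bA unit_left_carrier unit_right_carrier by (intro finsum_cong') (auto simp: m_assoc)
    ultimately have b_eq: "b = (\<Oplus>i\<in>?J. ?u i \<otimes> (?v i \<otimes> b))" by simp
    have h: "h b = finsum N (\<lambda>i. h (?u i) \<star>\<^bsub>N\<^esub> (?v i \<otimes> b)) ?J" if h: "h \<in> coind_carrier N" for h
    proof -
      have "h b = finsum N (\<lambda>i. h (?u i \<otimes> (?v i \<otimes> b))) ?J"
        using b_eq additive_finsum[OF abelian_group_axioms N.M.abelian_group_axioms coind_additive[OF h],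
            of "\<lambda>i. ?u i \<otimes> (?v i \<otimes> b)" ?J] bA unit_left_carrier unit_right_carrier
        by (simp add: Pi_iff)
      also have "\<dots> = finsum N (\<lambda>i. h (?u i) \<star>\<^bsub>N\<^esub> (?v i \<otimes> b)) ?J"
      proof (rule N.M.finsum_cong')
        show vb: "h (?u i \<otimes> (?v i \<otimes> b)) = h (?u i) \<star>\<^bsub>N\<^esub> (?v i \<otimes> b)" if "i \<in> ?J" for i
          using coind_map_ract[OF h unit_left_carrier[OF that]] gr_mult[OF unit_right_in[OF that] b]
          by simp
        show "(\<lambda>i. h (?u i) \<star>\<^bsub>N\<^esub> (?v i \<otimes> b)) \<in> ?J \<rightarrow> carrier N"
          using coind_in[OF h] bA unit_left_carrier unit_right_carrier by (auto simp: vb[symmetric])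
      qed simp
      finally show ?thesis .
    qed
    have "h (?u i) \<star>\<^bsub>N\<^esub> (?v i \<otimes> b) \<in> carrier N" if "h \<in> coind_carrier N" "i \<in> ?J" for h i
      using N.ract_closed[OF coind_in[OF that(1) unit_left_carrier[OF that(2)]]]
        gr_mult[OF unit_right_in[OF that(2)] b] by simp
    then have "finsum N (\<lambda>i. f (?u i) \<star>\<^bsub>N\<^esub> (?v i \<otimes> b)) ?J = finsum N (\<lambda>i. g (?u i) \<star>\<^bsub>N\<^esub> (?v i \<otimes> b)) ?J"
      using eq g by (intro N.M.finsum_cong') auto
    then show ?thesis using h[OF f] h[OF g] by simp
  qed
  have "inj_on ?code (coind_carrier N)"
  proof (rule inj_onI)
    fix f g assume f: "f \<in> coind_carrier N" and g: "g \<in> coind_carrier N" and eq: "?code f = ?code g"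
    have pts: "f b = g b" if "b \<in> ?pts f \<union> ?pts g" for b
    proof -
      have "(b, f b) \<in> ?code f \<or> (b, g b) \<in> ?code g"
        using that by (elim UnE) (rule disjI1 disjI2, erule imageI)+
      then have "(b, f b) \<in> ?code g \<or> (b, g b) \<in> ?code f"
        unfolding eq .
      then show ?thesis by (elim disjE imageE) simp_all
    qed
    show "f = g"
    proof (rule coind_eqI[OF f g])
      fix m b assume b: "b \<in> gr m"
      show "f b = g b"
      proof (cases "m \<in> degree_support gr N f \<union> degree_support gr N g")
        case True
        then have "unit_left (- m) i \<in> ?pts f \<union> ?pts g" if "i \<in> unit_index (- m)" for i
          using that by blast
        then show ?thesis using agree[OF f g b] pts by blast
      next
        case False
        then show ?thesis using degree_supportD[OF b, of N f] degree_supportD[OF b, of N g] by simp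
      qed
    qed
  qed
  moreover have "?code f \<in> Fpow (carrier A \<times> (UNIV :: 'u set))" if f: "f \<in> coind_carrier N" for f
  proof -
    have "?pts f \<subseteq> carrier A" using unit_left_carrier by blast
    then show ?thesis using finite_imageI[OF fin[OF f], of "\<lambda>b. (b, f b)"] unfolding Fpow_def by blast
  qed
  ultimately have "carrier (coind N) \<lesssim> Fpow (carrier A \<times> (UNIV :: 'u set))"
    unfolding lepoll_def coind_simps by (intro exI[of _ ?code] conjI image_subsetI)
  then show ?thesis
    using lepoll_trans lepoll_UNIV_Fpow[OF inf lepoll_UNIV_Times[OF inf A lepoll_refl]] by blast
qed

end

subsection \<open>The degree zero part determines a graded module\<close>

context graded_ring
begin

lemma coind_push:
  assumes N: "right_module A0 N" and N': "right_module A0 N'" and g: "g \<in> rhom A0 N N'"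
    and f: "f \<in> coind_carrier N"
  shows "(\<lambda>b\<in>carrier A. g (f b)) \<in> coind_carrier N'"
    and "degree_support gr N' (\<lambda>b\<in>carrier A. g (f b)) \<subseteq> degree_support gr N f"
proof -
  have "degree_support gr N' (\<lambda>b\<in>carrier A. g (f b)) \<subseteq> degree_support gr N f \<union> degree_support gr N f"
  proof
    fix m assume "m \<in> degree_support gr N' (\<lambda>b\<in>carrier A. g (f b))"
    then obtain b where b: "b \<in> gr m" "g (f b) \<noteq> \<zero>\<^bsub>N'\<^esub>"
      using gg.part_in_carrier unfolding degree_support_def by auto
    then have "f b \<noteq> \<zero>\<^bsub>N\<^esub>" using rhom_zero[OF N N' g] by auto
    then show "m \<in> degree_support gr N f \<union> degree_support gr N f"
      using b(1) unfolding degree_support_def by blast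
  qed
  then show supp: "degree_support gr N' (\<lambda>b\<in>carrier A. g (f b)) \<subseteq> degree_support gr N f" by simp
  show "(\<lambda>b\<in>carrier A. g (f b)) \<in> coind_carrier N'"
  proof (rule coind_carrierI)
    show "finite (degree_support gr N' (\<lambda>b\<in>carrier A. g (f b)))"
      using supp coind_finite[OF f] finite_subset by blast
  qed (simp_all add: coind_in[OF f] rhom_in[OF g] rhom_add[OF g] rhom_ract[OF g] coind_map_add[OF f]
      coind_map_ract[OF f] gg.part_in_carrier)
qed

text \<open>
  \<open>coind N\<close> consists of functions, so it is moved into the universe by \<open>copy_grmodule\<close>. On the copies,
  a morphism acts by decoding, composing with it, and encoding again.
\<close>

definition coind_ftor ::
  "(('a, 'u) rmodule, 'u \<Rightarrow> 'u, ('a, 'u) grmodule, 'u \<Rightarrow> 'u) ftor" where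
  "coind_ftor = \<lparr>fobj = (\<lambda>N. copy_grmodule (coind N)),
    farr = (\<lambda>N N' g. \<lambda>y\<in>emb (coind_carrier N) ` coind_carrier N.
      emb (coind_carrier N') (\<lambda>b\<in>carrier A. g (inv_into (coind_carrier N) (emb (coind_carrier N)) y b)))\<rparr>"

end

context strongly_graded_ring
begin

context
  assumes inf: "infinite (UNIV :: 'u set)" and A_small: "carrier A \<lesssim> (UNIV :: 'u set)"
begin

abbreviation (input) coind_emb :: "('a, 'u) rmodule \<Rightarrow> ('a \<Rightarrow> 'u) \<Rightarrow> 'u" where
  "coind_emb N \<equiv> emb (coind_carrier N)"

lemma coind_emb_inj: "right_module A0 N \<Longrightarrow> inj_on (coind_emb N) (coind_carrier N)"
  using inj_on_emb[OF coind_lepoll[OF _ inf A_small]] by simp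

lemma coind_emb_inv:
  "right_module A0 N \<Longrightarrow> f \<in> coind_carrier N \<Longrightarrow> inv_into (coind_carrier N) (coind_emb N) (coind_emb N f) = f"
  using coind_emb_inj by simp

lemma coind_ftor_obj:
  fixes N :: "('a, 'u) rmodule"
  assumes "right_module A0 N"
  shows "graded_right_module A gr (fobj coind_ftor N)"
  unfolding coind_ftor_def
  using copy_grmodule_graded[OF _ coind_graded[OF assms] gg.part_subset] coind_emb_inj[OF assms] by simp

lemma coind_copy_simps:
  fixes N :: "('a, 'u) rmodule"
  shows "carrier (fobj coind_ftor N) = coind_emb N ` coind_carrier N"
    and "homog (fobj coind_ftor N) n = coind_emb N ` homog (coind N) n"
  by (simp_all add: coind_ftor_def)

lemma coind_copy_add:
  fixes N :: "('a, 'u) rmodule"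
  assumes "right_module A0 N" "f \<in> coind_carrier N" "g \<in> coind_carrier N"
  shows "coind_emb N f \<oplus>\<^bsub>fobj coind_ftor N\<^esub> coind_emb N g = coind_emb N (f \<oplus>\<^bsub>coind N\<^esub> g)"
  using copy_grmodule_add[of "coind N" f g] coind_emb_inj[OF assms(1)] assms(2,3)
  by (simp add: coind_ftor_def)

lemma coind_copy_ract:
  fixes N :: "('a, 'u) rmodule"
  assumes "right_module A0 N" "f \<in> coind_carrier N"
  shows "coind_emb N f \<star>\<^bsub>fobj coind_ftor N\<^esub> a = coind_emb N (f \<star>\<^bsub>coind N\<^esub> a)"
  using copy_grmodule_ract[of "coind N" f a] coind_emb_inj[OF assms(1)] assms(2)
  by (simp add: coind_ftor_def)

lemma coind_ftor_apply:
  fixes N N' :: "('a, 'u) rmodule"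
  assumes "right_module A0 N" "f \<in> coind_carrier N"
  shows "farr coind_ftor N N' g (coind_emb N f) = coind_emb N' (\<lambda>b\<in>carrier A. g (f b))"
  using coind_emb_inv[OF assms] assms(2) by (simp add: coind_ftor_def)

lemma coind_ftor_arr:
  fixes N N' :: "('a, 'u) rmodule"
  assumes N: "right_module A0 N" and N': "right_module A0 N'" and g: "g \<in> rhom A0 N N'"
  shows "farr coind_ftor N N' g \<in> grhom A (fobj coind_ftor N) (fobj coind_ftor N')"
proof (rule grhomI)
  note push = coind_push[OF N N' g]
  show "farr coind_ftor N N' g \<in> rhom A (fobj coind_ftor N) (fobj coind_ftor N')"
  proof (rule rhomI)
    have "farr coind_ftor N N' g \<in> extensional (coind_emb N ` coind_carrier N)"
      by (simp add: coind_ftor_def)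
    then show "farr coind_ftor N N' g \<in> carrier (fobj coind_ftor N) \<rightarrow>\<^sub>E carrier (fobj coind_ftor N')"
      using push(1) by (auto simp: PiE_def coind_copy_simps coind_ftor_apply[OF N])
    fix x assume "x \<in> carrier (fobj coind_ftor N)"
    then obtain f where f: "f \<in> coind_carrier N" "x = coind_emb N f"
      by (auto simp: coind_copy_simps)
    show "farr coind_ftor N N' g (x \<star>\<^bsub>fobj coind_ftor N\<^esub> a) =
        farr coind_ftor N N' g x \<star>\<^bsub>fobj coind_ftor N'\<^esub> a" if a: "a \<in> carrier A" for a
    proof -
      have "(\<lambda>b\<in>carrier A. g ((f \<star>\<^bsub>coind N\<^esub> a) b)) = (\<lambda>b\<in>carrier A. g (f b)) \<star>\<^bsub>coind N'\<^esub> a"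
        using a by (auto simp: fun_eq_iff restrict_def)
      then show ?thesis
        using f coind_ract_closed[OF N f(1) a] push(1)[OF f(1)]
        by (simp add: coind_copy_ract[OF N] coind_copy_ract[OF N'] coind_ftor_apply[OF N] del: coind_simps(4))
          (simp add: coind_ftor_apply[OF N])
    qed
    fix y assume "y \<in> carrier (fobj coind_ftor N)"
    then obtain h where h: "h \<in> coind_carrier N" "y = coind_emb N h"
      by (auto simp: coind_copy_simps)
    have "(\<lambda>b\<in>carrier A. g ((f \<oplus>\<^bsub>coind N\<^esub> h) b)) =
        (\<lambda>b\<in>carrier A. g (f b)) \<oplus>\<^bsub>coind N'\<^esub> (\<lambda>b\<in>carrier A. g (h b))"
      using f h by (auto simp: fun_eq_iff restrict_def coind_in rhom_add[OF g])
    then show "farr coind_ftor N N' g (x \<oplus>\<^bsub>fobj coind_ftor N\<^esub> y) =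
        farr coind_ftor N N' g x \<oplus>\<^bsub>fobj coind_ftor N'\<^esub> farr coind_ftor N N' g y"
      using f h coind_add_closed[OF N f(1) h(1)] push(1)[OF f(1)] push(1)[OF h(1)]
      by (simp add: coind_copy_add[OF N] coind_copy_add[OF N'] coind_ftor_apply[OF N] del: coind_simps(3))
        (simp add: coind_ftor_apply[OF N])
  qed
  show "farr coind_ftor N N' g x \<in> homog (fobj coind_ftor N') n"
    if x: "x \<in> homog (fobj coind_ftor N) n" for n x
  proof -
    obtain f where f: "f \<in> coind_carrier N" "degree_support gr N f \<subseteq> {- n}" "x = coind_emb N f"
      using x by (auto simp: coind_copy_simps)
    then have "(\<lambda>b\<in>carrier A. g (f b)) \<in> homog (coind N') n"
      using push(1)[OF f(1)] subset_trans[OF push(2)[OF f(1)]] by simp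
    then show ?thesis
      unfolding coind_copy_simps f(3) coind_ftor_apply[OF N f(1)] by (rule imageI)
  qed
qed

lemma is_functor_coind: "is_functor (ModR A0) (GrR A gr) (coind_ftor :: (_, 'u \<Rightarrow> 'u, _, _) ftor)"
  unfolding is_functor_def GrR_simps ModR_simps mem_Collect_eq
proof (intro conjI ballI)
  fix N :: "('a, 'u) rmodule" assume "N \<in> Obj (ModR A0)"
  then have N: "right_module A0 N" by simp
  show "graded_right_module A gr (fobj coind_ftor N)"
    by (rule coind_ftor_obj[OF N])
  have Id: "(\<lambda>x\<in>carrier N. x) \<in> rhom A0 N N" by (rule rhom_Id[OF N])
  show "farr coind_ftor N N (\<lambda>x\<in>carrier N. x) = (\<lambda>x\<in>carrier (fobj coind_ftor N). x)"
  proof (rule rhom_eqI[OF grhom_rhom[OF coind_ftor_arr[OF N N Id]]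
        rhom_Id[OF graded_right_module_imp_right_module[OF coind_ftor_obj[OF N]]]])
    fix x assume x: "x \<in> carrier (fobj coind_ftor N)"
    then obtain f where f: "f \<in> coind_carrier N" "x = coind_emb N f"
      by (auto simp: coind_copy_simps)
    have "(\<lambda>b\<in>carrier A. (\<lambda>x\<in>carrier N. x) (f b)) = f"
      using coind_ext[OF f(1)] coind_in[OF f(1)] by (auto simp: fun_eq_iff extensional_def)
    then show "farr coind_ftor N N (\<lambda>x\<in>carrier N. x) x = (\<lambda>x\<in>carrier (fobj coind_ftor N). x) x"
      using x f by (simp only: coind_ftor_apply[OF N f(1)] restrict_apply')
  qed
  fix N' :: "('a, 'u) rmodule" and g assume "N' \<in> Obj (ModR A0)" and g: "g \<in> rhom A0 N N'"
  then have N': "right_module A0 N'" by simp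
  show "farr coind_ftor N N' g \<in> grhom A (fobj coind_ftor N) (fobj coind_ftor N')"
    by (rule coind_ftor_arr[OF N N' g])
  fix N'' :: "('a, 'u) rmodule" and h assume "N'' \<in> Obj (ModR A0)" and h: "h \<in> rhom A0 N' N''"
  then have N'': "right_module A0 N''" by simp
  have hg: "compose (carrier N) h g \<in> rhom A0 N N''"
    by (rule rhom_compose[OF g h right_module_closed(1,2)[OF N]])
  note cg = coind_ftor_arr[OF N N' g] and ch = coind_ftor_arr[OF N' N'' h]
  show "farr coind_ftor N N'' (compose (carrier N) h g) =
      compose (carrier (fobj coind_ftor N)) (farr coind_ftor N' N'' h) (farr coind_ftor N N' g)"
  proof (rule rhom_eqI[OF grhom_rhom[OF coind_ftor_arr[OF N N'' hg]]
        grhom_rhom[OF grhom_compose[OF coind_ftor_obj[OF N] cg ch]]])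
    fix x assume x: "x \<in> carrier (fobj coind_ftor N)"
    then obtain f where f: "f \<in> coind_carrier N" "x = coind_emb N f"
      by (auto simp: coind_copy_simps)
    have "(\<lambda>b\<in>carrier A. compose (carrier N) h g (f b)) =
        (\<lambda>b\<in>carrier A. h ((\<lambda>b\<in>carrier A. g (f b)) b))"
      using coind_in[OF f(1)] by (auto simp: fun_eq_iff restrict_def compose_def)
    then show "farr coind_ftor N N'' (compose (carrier N) h g) x =
        compose (carrier (fobj coind_ftor N)) (farr coind_ftor N' N'' h) (farr coind_ftor N N' g) x"
      using x f coind_push(1)[OF N N' g f(1)]
      by (simp only: compose_eq coind_ftor_apply[OF N] coind_ftor_apply[OF N'])
  qed
qed

text \<open>
  This is Dade's theorem. The unit and the counit of the coinduction adjunction are bijective, and both are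
  natural: a graded homomorphism commutes with the projection onto degree \<open>0\<close> and with the action of
  \<open>b\<close>, and evaluation at \<open>1\<close> commutes with composing from the left.
\<close>

theorem is_equivalence_degree_zero:
  "is_equivalence (GrR A gr :: (('a, 'u) grmodule, 'u \<Rightarrow> 'u) cat) (ModR A0) degree_zero_ftor"
proof (rule is_equivalenceI[OF is_functor_degree_zero is_functor_coind])
  let ?G = "GrR A gr :: (('a, 'u) grmodule, 'u \<Rightarrow> 'u) cat"
  let ?M = "ModR A0 :: (('a, 'u) rmodule, 'u \<Rightarrow> 'u) cat"
  have "nat_isomorphic ?G ?G id_ftor (coind_ftor \<circ>\<^sub>F degree_zero_ftor)"
  proof (rule nat_isomorphicI[where \<eta> = "\<lambda>M. \<lambda>y\<in>carrier M. coind_emb (degree_part M 0) (coind_unit M y)"])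
    fix X :: "('a, 'u) grmodule" assume "X \<in> Obj ?G"
    then have X: "graded_right_module A gr X" by simp
    interpret X: graded_group X "homog X" by (rule graded_right_module_graded_group[OF X])
    interpret XX: right_module A X by (rule graded_right_module_imp_right_module[OF X])
    let ?N = "degree_part X 0" and ?f = "\<lambda>y\<in>carrier X. coind_emb (degree_part X 0) (coind_unit X y)"
    have N: "right_module A0 ?N" by (rule degree_part_right_module[OF X])
    note unit_in = coind_unit_in[OF X]
    have f: "?f \<in> grhom A X (fobj coind_ftor ?N)"
    proof (rule grhomI)
      show "?f \<in> rhom A X (fobj coind_ftor ?N)"
        by (rule rhomI) (simp_all add: unit_in coind_copy_simps coind_copy_add[OF N] coind_copy_ract[OF N]
            coind_unit_add[OF X] coind_unit_ract[OF X] XX.ract_closed del: coind_simps(3,4))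
      show "?f x \<in> homog (fobj coind_ftor ?N) n" if "x \<in> homog X n" for n x
        using coind_unit_homog[OF X that] X.part_in_carrier[OF that]
        unfolding coind_copy_simps by (simp only: restrict_apply' imageI)
    qed
    have "bij_betw (coind_emb ?N \<circ> coind_unit X) (carrier X) (carrier (fobj coind_ftor ?N))"
      by (rule bij_betw_trans[OF coind_unit_bij[OF X]])
        (simp add: bij_betw_def coind_copy_simps coind_emb_inj[OF N])
    then have "bij_betw ?f (carrier X) (carrier (fobj coind_ftor ?N))"
      by (rule bij_betw_cong[THEN iffD1, rotated]) simp
    then show "is_iso ?G (fobj id_ftor X) (fobj (coind_ftor \<circ>\<^sub>F degree_zero_ftor) X) ?f"
      using is_iso_GrR[OF X coind_ftor_obj[OF N] f] by simp
    fix Y :: "('a, 'u) grmodule" and h assume "Y \<in> Obj ?G" "h \<in> Hom ?G X Y"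
    then have Y: "graded_right_module A gr Y" and h: "h \<in> grhom A X Y" by simp_all
    interpret Y: graded_group Y "homog Y" by (rule graded_right_module_graded_group[OF Y])
    have *: "coind_emb (degree_part Y 0) (coind_unit Y (h x)) =
        farr coind_ftor ?N (degree_part Y 0) (restrict h (homog X 0)) (coind_emb ?N (coind_unit X x))"
      if x: "x \<in> carrier X" for x
    proof -
      have "component Y (homog Y) 0 (h x \<star>\<^bsub>Y\<^esub> b) = h (component X (homog X) 0 (x \<star>\<^bsub>X\<^esub> b))"
        if b: "b \<in> carrier A" for b
        using additive_component[OF X.graded_group_axioms Y.graded_group_axioms inj_on_id
            rhom_additive[OF grhom_rhom[OF h]] _ XX.ract_closed[OF x b], of 0]
          grhom_homog[OF h] rhom_ract[OF grhom_rhom[OF h] x b] by (simp add: image_subset_iff)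
      then have "coind_unit Y (h x) = (\<lambda>b\<in>carrier A. restrict h (homog X 0) (coind_unit X x b))"
        using x X.component_in XX.ract_closed[OF x] by (auto simp: coind_unit_def fun_eq_iff restrict_def)
      then show ?thesis
        using coind_ftor_apply[OF N unit_in[OF x]] by simp
    qed
    show "Comp ?G (fobj id_ftor X) (fobj id_ftor Y) (fobj (coind_ftor \<circ>\<^sub>F degree_zero_ftor) Y)
          (\<lambda>y\<in>carrier Y. coind_emb (degree_part Y 0) (coind_unit Y y)) (farr id_ftor X Y h) =
        Comp ?G (fobj id_ftor X) (fobj (coind_ftor \<circ>\<^sub>F degree_zero_ftor) X)
          (fobj (coind_ftor \<circ>\<^sub>F degree_zero_ftor) Y) (farr (coind_ftor \<circ>\<^sub>F degree_zero_ftor) X Y h) ?f"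
      using * rhom_in[OF grhom_rhom[OF h]] by (auto simp: compose_def fun_eq_iff restrict_def)
  qed
  then show "nat_isomorphic ?G ?G (coind_ftor \<circ>\<^sub>F degree_zero_ftor) id_ftor"
    by (rule nat_isomorphic_sym[OF is_category_GrR is_functor_id
          is_functor_comp[OF is_functor_degree_zero is_functor_coind]])
  let ?\<epsilon> = "\<lambda>N. \<lambda>x\<in>coind_emb N ` homog (coind N) 0.
    coind_counit (inv_into (coind_carrier N) (coind_emb N) x)"
  show "nat_isomorphic ?M ?M (degree_zero_ftor \<circ>\<^sub>F coind_ftor) id_ftor"
  proof (rule nat_isomorphicI[where \<eta> = ?\<epsilon>])
    fix N :: "('a, 'u) rmodule" assume "N \<in> Obj ?M"
    then have N: "right_module A0 N" by simp
    interpret N: right_module A0 N by (rule N)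
    interpret C: graded_group "coind N" "homog (coind N)"
      by (rule graded_right_module_graded_group[OF coind_graded[OF N]])
    let ?P = "degree_part (fobj coind_ftor N) 0"
    have P: "right_module A0 ?P"
      by (rule degree_part_right_module[OF coind_ftor_obj[OF N]])
    have H: "homog (coind N) 0 \<subseteq> coind_carrier N" by auto
    have eps: "?\<epsilon> N (coind_emb N f) = coind_counit f" if "f \<in> homog (coind N) 0" for f
      using that coind_emb_inv[OF N] by simp
    have "?\<epsilon> N \<in> rhom A0 ?P N"
    proof (rule rhomI)
      have in_N: "coind_counit f \<in> carrier N" if "f \<in> homog (coind N) 0" for f
        using that by (simp add: coind_counit_def coind_in)
      show "?\<epsilon> N \<in> carrier ?P \<rightarrow>\<^sub>E carrier N"
        using in_N eps by (auto simp: coind_copy_simps simp del: coind_simps(5))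
      fix x assume "x \<in> carrier ?P"
      then obtain f where f: "f \<in> homog (coind N) 0" "x = coind_emb N f"
        unfolding degree_part_simps coind_copy_simps by blast
      then have fc: "f \<in> coind_carrier N" using H by blast
      show "?\<epsilon> N (x \<star>\<^bsub>?P\<^esub> a) = ?\<epsilon> N x \<star>\<^bsub>N\<^esub> a" if "a \<in> carrier A0" for a
      proof -
        have a: "a \<in> gr 0" using that by simp
        have "f \<star>\<^bsub>coind N\<^esub> a \<in> homog (coind N) 0"
          using graded_right_module_ract[OF coind_graded[OF N] f(1) a] by simp
        then show ?thesis
          unfolding degree_part_simps f(2) coind_copy_ract[OF N fc]
          using eps[OF f(1)] eps coind_counit_ract[OF N fc a] by metis
      qed
      fix y assume "y \<in> carrier ?P"
      then obtain g where g: "g \<in> homog (coind N) 0" "y = coind_emb N g"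
        unfolding degree_part_simps coind_copy_simps by blast
      then have gc: "g \<in> coind_carrier N" using H by blast
      have "coind_counit (f \<oplus>\<^bsub>coind N\<^esub> g) = coind_counit f \<oplus>\<^bsub>N\<^esub> coind_counit g"
        by (simp add: coind_counit_def)
      then show "?\<epsilon> N (x \<oplus>\<^bsub>?P\<^esub> y) = ?\<epsilon> N x \<oplus>\<^bsub>N\<^esub> ?\<epsilon> N y"
        unfolding degree_part_simps f(2) g(2) coind_copy_add[OF N fc gc]
        using eps[OF f(1)] eps[OF g(1)] eps[OF C.part_add[OF f(1) g(1)]] by metis
    qed
    moreover have "bij_betw (?\<epsilon> N) (carrier ?P) (carrier N)"
    proof (rule bij_betw_imageI)
      show "inj_on (?\<epsilon> N) (carrier ?P)"
        unfolding degree_part_simps coind_copy_simps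
        using bij_betw_imp_inj_on[OF coind_counit_bij[OF N]] eps
        by (auto simp: inj_on_def simp del: coind_simps(5))
      show "?\<epsilon> N ` carrier ?P = carrier N"
        unfolding degree_part_simps coind_copy_simps image_image
        by (rule trans[OF image_cong[OF refl eps] bij_betw_imp_surj_on[OF coind_counit_bij[OF N]]])
    qed
    ultimately show "is_iso ?M (fobj (degree_zero_ftor \<circ>\<^sub>F coind_ftor) N) (fobj id_ftor N) (?\<epsilon> N)"
      using is_iso_ModR[OF P] by simp
    fix N' :: "('a, 'u) rmodule" and g assume "N' \<in> Obj ?M" "g \<in> Hom ?M N N'"
    then have N': "right_module A0 N'" and g: "g \<in> rhom A0 N N'" by simp_all
    have *: "?\<epsilon> N' (farr coind_ftor N N' g x) = g (?\<epsilon> N x)" and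
      **: "farr coind_ftor N N' g x \<in> coind_emb N' ` homog (coind N') 0"
      if x: "x \<in> coind_emb N ` homog (coind N) 0" for x
    proof -
      obtain f where f: "f \<in> homog (coind N) 0" "x = coind_emb N f"
        using x by blast
      then have fc: "f \<in> coind_carrier N" using H by blast
      have gf: "(\<lambda>b\<in>carrier A. g (f b)) \<in> homog (coind N') 0"
        using coind_push[OF N N' g fc] f(1) by auto
      show "farr coind_ftor N N' g x \<in> coind_emb N' ` homog (coind N') 0"
        unfolding f(2) coind_ftor_apply[OF N fc] using gf by (rule imageI)
      have "inv_into (coind_carrier N') (coind_emb N') (coind_emb N' (\<lambda>b\<in>carrier A. g (f b))) =
          (\<lambda>b\<in>carrier A. g (f b))"
        using gf by (intro coind_emb_inv[OF N']) simp
      then show "?\<epsilon> N' (farr coind_ftor N N' g x) = g (?\<epsilon> N x)"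
        unfolding f(2) coind_ftor_apply[OF N fc]
        using eps[OF f(1)] gf by (simp add: coind_counit_def del: coind_simps(5))
    qed
    show "Comp ?M (fobj (degree_zero_ftor \<circ>\<^sub>F coind_ftor) N) (fobj (degree_zero_ftor \<circ>\<^sub>F coind_ftor) N')
          (fobj id_ftor N') (?\<epsilon> N') (farr (degree_zero_ftor \<circ>\<^sub>F coind_ftor) N N' g) =
        Comp ?M (fobj (degree_zero_ftor \<circ>\<^sub>F coind_ftor) N) (fobj id_ftor N) (fobj id_ftor N')
          (farr id_ftor N N' g) (?\<epsilon> N)"
      unfolding ModR_simps fobj_comp_ftor farr_comp_ftor degree_zero_ftor_simps fobj_id_ftor farr_id_ftor
        degree_part_simps coind_copy_simps compose_def
      using * by (intro restrict_ext) simp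
  qed
qed

end

end

section \<open>Tensor products\<close>

text \<open>
  The part of a bimodule structure on \<open>B\<close> which is needed for the right action of \<open>R\<close> on \<open>B\<close> to descend
  to the tensor product: it has to respect the balancing relations.
\<close>

locale left_acted_module = B: right_module R B
  for R :: "('a, 'x) ring_scheme" (structure) and B :: "('a, 'b) rmodule" (structure) +
  fixes l :: "'a \<Rightarrow> 'b \<Rightarrow> 'b"
  assumes l_closed: "\<lbrakk>r \<in> carrier R; b \<in> carrier B\<rbrakk> \<Longrightarrow> l r b \<in> carrier B"
    and l_ract: "\<lbrakk>r \<in> carrier R; b \<in> carrier B; a \<in> carrier R\<rbrakk> \<Longrightarrow> l r b \<star>\<^bsub>B\<^esub> a = l r (b \<star>\<^bsub>B\<^esub> a)"
begin

abbreviation rels :: "('a, 'm) rmodule \<Rightarrow> (('m \<times> 'b) \<Rightarrow>\<^sub>0 int) set" where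
  "rels N \<equiv> tensor_rels R N l B"

abbreviation supported :: "('a, 'm) rmodule \<Rightarrow> (('m \<times> 'b) \<Rightarrow>\<^sub>0 int) \<Rightarrow> bool" where
  "supported N c \<equiv> Poly_Mapping.keys c \<subseteq> carrier N \<times> carrier B"

abbreviation cls :: "('a, 'm) rmodule \<Rightarrow> (('m \<times> 'b) \<Rightarrow>\<^sub>0 int) \<Rightarrow> (('m \<times> 'b) \<Rightarrow>\<^sub>0 int) set" where
  "cls N c \<equiv> rels N #>\<^bsub>tensor_free N B\<^esub> c"

lemma mult_tensor_free [simp]: "x \<otimes>\<^bsub>tensor_free N B\<^esub> y = x + y"
  by (simp add: tensor_free_def)

lemma carrier_tensor_free [simp]:
  "c \<in> carrier (tensor_free N B) \<longleftrightarrow> supported N c"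
  by (simp add: tensor_free_def)

lemma keys_diff_subset:
  "\<lbrakk>Poly_Mapping.keys c \<subseteq> S; Poly_Mapping.keys d \<subseteq> S\<rbrakk> \<Longrightarrow> Poly_Mapping.keys (c - d) \<subseteq> S"
  using keys_diff[of c d] by blast

lemma keys_add_subset:
  "\<lbrakk>Poly_Mapping.keys c \<subseteq> S; Poly_Mapping.keys d \<subseteq> S\<rbrakk> \<Longrightarrow> Poly_Mapping.keys (c + d) \<subseteq> S"
  using keys_add[of c d] by blast

lemma frag_of_keys: "x \<in> S \<Longrightarrow> Poly_Mapping.keys (frag_of x) \<subseteq> S"
  by simp

text \<open>
  The right action on the free group, before passing to classes.
\<close>

definition act :: "'a \<Rightarrow> (('m \<times> 'b) \<Rightarrow>\<^sub>0 int) \<Rightarrow> (('m \<times> 'b) \<Rightarrow>\<^sub>0 int)" where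
  "act a = frag_extend (\<lambda>(x, b). frag_of (x, b \<star>\<^bsub>B\<^esub> a))"

lemma act_simps:
  "act a (frag_of (x, b)) = frag_of (x, b \<star>\<^bsub>B\<^esub> a)" "act a 0 = 0" "act a (- c) = - act a c"
  "act a (c + d) = act a c + act a d" "act a (c - d) = act a c - act a d"
  by (simp_all add: act_def frag_extend_minus frag_extend_add frag_extend_diff)

context
  fixes N :: "('a, 'm) rmodule"
  assumes N: "right_module R N"
begin

interpretation N: right_module R N by (rule N)

lemma rel_left:
  "\<lbrakk>x \<in> carrier N; y \<in> carrier N; b \<in> carrier B\<rbrakk> \<Longrightarrow>
    frag_of (x \<oplus>\<^bsub>N\<^esub> y, b) - frag_of (x, b) - frag_of (y, b) \<in> rels N"
  unfolding tensor_rels_def by (intro generate.incl) blast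

lemma rel_right:
  "\<lbrakk>x \<in> carrier N; b \<in> carrier B; c \<in> carrier B\<rbrakk> \<Longrightarrow>
    frag_of (x, b \<oplus>\<^bsub>B\<^esub> c) - frag_of (x, b) - frag_of (x, c) \<in> rels N"
  unfolding tensor_rels_def by (intro generate.incl) blast

lemma rel_balanced:
  "\<lbrakk>x \<in> carrier N; r \<in> carrier R; b \<in> carrier B\<rbrakk> \<Longrightarrow>
    frag_of (x \<star>\<^bsub>N\<^esub> r, b) - frag_of (x, l r b) \<in> rels N"
  unfolding tensor_rels_def by (intro generate.incl) blast

lemma rels_zero: "0 \<in> rels N"
  unfolding tensor_rels_def using generate.one[of "tensor_free N B"] by (simp add: tensor_free_def)

lemma rels_add: "\<lbrakk>c \<in> rels N; d \<in> rels N\<rbrakk> \<Longrightarrow> c + d \<in> rels N"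
  unfolding tensor_rels_def using generate.eng[of c "tensor_free N B" _ d] by simp

lemma rels_subgroup: "subgroup (rels N) (tensor_free N B)"
  unfolding tensor_rels_def
proof (rule group.generate_is_subgroup)
  show "group (tensor_free N B)" by (simp add: tensor_free_def)
qed (intro Un_least subsetI; elim CollectE exE conjE; hypsubst; unfold carrier_tensor_free;
    intro keys_diff_subset frag_of_keys SigmaI; simp add: N.ract_closed l_closed)

lemma rels_minus: "c \<in> rels N \<Longrightarrow> - c \<in> rels N"
  using subgroup.m_inv_closed[OF rels_subgroup, of c] subgroup.mem_carrier[OF rels_subgroup, of c]
  by (simp add: tensor_free_def)

lemma rels_diff: "\<lbrakk>c \<in> rels N; d \<in> rels N\<rbrakk> \<Longrightarrow> c - d \<in> rels N"
  using rels_add[OF _ rels_minus, of c d] by simp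

lemma rels_sum: "(\<And>i. i \<in> J \<Longrightarrow> g i \<in> rels N) \<Longrightarrow> sum g J \<in> rels N"
  by (induction J rule: infinite_finite_induct) (auto simp: rels_zero rels_add)

lemma rels_keys: "c \<in> rels N \<Longrightarrow> supported N c"
  using subgroup.mem_carrier[OF rels_subgroup] by simp

lemma rels_induct:
  assumes c: "c \<in> rels N" and zero: "P 0"
    and left: "\<And>x y b. \<lbrakk>x \<in> carrier N; y \<in> carrier N; b \<in> carrier B\<rbrakk> \<Longrightarrow>
      P (frag_of (x \<oplus>\<^bsub>N\<^esub> y, b) - frag_of (x, b) - frag_of (y, b))"
    and right: "\<And>x b c. \<lbrakk>x \<in> carrier N; b \<in> carrier B; c \<in> carrier B\<rbrakk> \<Longrightarrow>
      P (frag_of (x, b \<oplus>\<^bsub>B\<^esub> c) - frag_of (x, b) - frag_of (x, c))"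
    and balanced: "\<And>x r b. \<lbrakk>x \<in> carrier N; r \<in> carrier R; b \<in> carrier B\<rbrakk> \<Longrightarrow>
      P (frag_of (x \<star>\<^bsub>N\<^esub> r, b) - frag_of (x, l r b))"
    and minus: "\<And>c. c \<in> rels N \<Longrightarrow> P c \<Longrightarrow> P (- c)"
    and add: "\<And>c d. c \<in> rels N \<Longrightarrow> d \<in> rels N \<Longrightarrow> P c \<Longrightarrow> P d \<Longrightarrow> P (c + d)"
  shows "P c"
proof -
  let ?gens = "{frag_of (x \<oplus>\<^bsub>N\<^esub> y, b) - frag_of (x, b) - frag_of (y, b) | x y b.
        x \<in> carrier N \<and> y \<in> carrier N \<and> b \<in> carrier B} \<union>
     {frag_of (x, b \<oplus>\<^bsub>B\<^esub> c) - frag_of (x, b) - frag_of (x, c) | x b c.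
        x \<in> carrier N \<and> b \<in> carrier B \<and> c \<in> carrier B} \<union>
     {frag_of (x \<star>\<^bsub>N\<^esub> r, b) - frag_of (x, l r b) | x r b.
        x \<in> carrier N \<and> r \<in> carrier R \<and> b \<in> carrier B}"
  have rels_eq: "rels N = generate (tensor_free N B) ?gens"
    by (simp only: tensor_rels_def)
  have gens: "P h" if "h \<in> ?gens" for h
    using that by (elim UnE CollectE exE conjE) (simp_all only: left right balanced)
  have gens_in: "h \<in> rels N" if "h \<in> ?gens" for h
    unfolding rels_eq using that by (rule generate.incl)
  have "c \<in> generate (tensor_free N B) ?gens"
    using c unfolding rels_eq .
  then show ?thesis
  proof induction
    case one
    show ?case using zero by (simp add: tensor_free_def)
  next
    case (incl h)
    then show ?case by (rule gens)
  next
    case (inv h)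
    then show ?case
      using minus[OF gens_in gens] rels_keys[OF gens_in] by (simp add: tensor_free_def)
  next
    case (eng c d)
    then have "c \<in> rels N" "d \<in> rels N" unfolding rels_eq by blast+
    then show ?case using add[OF _ _ eng.IH] by simp
  qed
qed

lemma cls_mem_iff: "d \<in> cls N c \<longleftrightarrow> d - c \<in> rels N"
  by (force simp: r_coset_def)

lemma cls_self: "c \<in> cls N c"
  by (simp add: cls_mem_iff rels_zero)

lemma cls_eq_iff: "cls N c = cls N d \<longleftrightarrow> c - d \<in> rels N"
proof
  assume "cls N c = cls N d"
  then show "c - d \<in> rels N" using cls_self[of c] cls_mem_iff by blast
next
  assume cd: "c - d \<in> rels N"
  have "e - c \<in> rels N \<longleftrightarrow> e - d \<in> rels N" for e
    using rels_add[OF _ cd, of "e - c"] rels_diff[OF _ cd, of "e - d"] by auto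
  then show "cls N c = cls N d" by (auto simp: cls_mem_iff)
qed

lemma cls_eqI: "c - d \<in> rels N \<Longrightarrow> cls N c = cls N d"
  by (simp add: cls_eq_iff)

lemma tensor_carrier: "carrier (tensor R N l B) = cls N ` carrier (tensor_free N B)"
  by (simp add: tensor_def Let_def carrier_FactGroup)

lemma tensor_zero: "\<zero>\<^bsub>tensor R N l B\<^esub> = cls N 0"
  by (force simp: tensor_def Let_def r_coset_def)

lemma tensor_add: "cls N c \<oplus>\<^bsub>tensor R N l B\<^esub> cls N d = cls N (c + d)"
proof -
  have "(\<exists>h k. h - c \<in> rels N \<and> k - d \<in> rels N \<and> e = h + k) \<longleftrightarrow> e - (c + d) \<in> rels N" for e
  proof
    assume "\<exists>h k. h - c \<in> rels N \<and> k - d \<in> rels N \<and> e = h + k"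
    then obtain h k where "h - c \<in> rels N" "k - d \<in> rels N" "e = h + k" by blast
    then show "e - (c + d) \<in> rels N"
      using rels_add[of "h - c" "k - d"] by (simp add: algebra_simps)
  next
    assume "e - (c + d) \<in> rels N"
    then show "\<exists>h k. h - c \<in> rels N \<and> k - d \<in> rels N \<and> e = h + k"
      by (intro exI[of _ "e - d"] exI[of _ d]) (simp add: algebra_simps rels_zero)
  qed
  moreover have "e \<in> cls N c <#>\<^bsub>tensor_free N B\<^esub> cls N d \<longleftrightarrow>
      (\<exists>h k. h - c \<in> rels N \<and> k - d \<in> rels N \<and> e = h + k)" for e
    unfolding set_mult_def by (simp add: Bex_def cls_mem_iff)
  ultimately have "cls N c <#>\<^bsub>tensor_free N B\<^esub> cls N d = cls N (c + d)"
    by (simp add: set_eq_iff cls_mem_iff)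
  then show ?thesis
    by (simp add: tensor_def Let_def FactGroup_def)
qed

lemma act_keys:
  assumes "supported N c" and "a \<in> carrier R"
  shows "supported N (act a c)"
proof -
  have "supported N (case p of (x, b) \<Rightarrow> frag_of (x, b \<star>\<^bsub>B\<^esub> a))"
    if "p \<in> Poly_Mapping.keys c" for p
    using that assms B.ract_closed by (cases p) auto
  then show ?thesis
    unfolding act_def by (intro order_trans[OF keys_frag_extend] UN_least)
qed

end

text \<open>
  Additive maps on the free groups that preserve the relations act on classes through
  representatives; this covers the module structure of a tensor product and its functoriality.
\<close>

lemma cls_map:
  assumes N: "right_module R N" and N': "right_module R N'"
    and diff: "\<And>c d. \<phi> (c - d) = \<phi> c - \<phi> d" and rels: "\<And>h. h \<in> rels N \<Longrightarrow> \<phi> h \<in> rels N'"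
  shows "(\<Union>c'\<in>cls N c. cls N' (\<phi> c')) = cls N' (\<phi> c)"
proof -
  have "cls N' (\<phi> c') = cls N' (\<phi> c)" if "c' \<in> cls N c" for c'
    using rels[of "c' - c"] that by (simp add: cls_eq_iff[OF N'] cls_mem_iff[OF N] diff)
  then show ?thesis using cls_self[OF N] by blast
qed

context
  fixes N :: "('a, 'm) rmodule"
  assumes N: "right_module R N"
begin

interpretation N: right_module R N by (rule N)

lemma act_rels:
  assumes a: "a \<in> carrier R" and h: "h \<in> rels N"
  shows "act a h \<in> rels N"
  by (rule rels_induct[OF N h, where P = "\<lambda>h. act a h \<in> rels N"])
    (use a in \<open>simp_all add: act_simps rels_zero[OF N] rels_minus[OF N] rels_add[OF N]
      B.ract_l_distr l_ract B.ract_closed rel_left[OF N] rel_right[OF N] rel_balanced[OF N]\<close>)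

lemma tensor_ract:
  assumes a: "a \<in> carrier R"
  shows "cls N c \<star>\<^bsub>tensor R N l B\<^esub> a = cls N (act a c)"
  using cls_map[OF N N act_simps(5) act_rels[OF a]]
  by (simp add: tensor_def Let_def act_def)

lemma tensor_right_module: "right_module R (tensor R N l B)"
proof -
  let ?T = "tensor R N l B" and ?S = "carrier N \<times> carrier B"
  have cases: "\<exists>c. Poly_Mapping.keys c \<subseteq> ?S \<and> C = cls N c" if "C \<in> carrier ?T" for C
    using that unfolding tensor_carrier[OF N] carrier_tensor_free[symmetric] by blast
  have mem: "cls N c \<in> carrier ?T" if "Poly_Mapping.keys c \<subseteq> ?S" for c
    using that unfolding tensor_carrier[OF N] by simp
  note simps = tensor_zero[OF N] tensor_add[OF N]
  have "abelian_group ?T"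
  proof (rule abelian_groupI)
    fix C assume "C \<in> carrier ?T"
    then obtain c where c: "Poly_Mapping.keys c \<subseteq> ?S" "C = cls N c" using cases by blast
    show "\<zero>\<^bsub>?T\<^esub> \<oplus>\<^bsub>?T\<^esub> C = C" by (simp add: c simps)
    show "\<exists>D\<in>carrier ?T. D \<oplus>\<^bsub>?T\<^esub> C = \<zero>\<^bsub>?T\<^esub>"
      by (rule bexI[OF _ mem[of "- c"]]) (simp_all add: c simps)
    fix D assume "D \<in> carrier ?T"
    then obtain d where d: "Poly_Mapping.keys d \<subseteq> ?S" "D = cls N d" using cases by blast
    show "C \<oplus>\<^bsub>?T\<^esub> D \<in> carrier ?T"
      by (simp add: c d simps mem keys_add_subset)
    show "C \<oplus>\<^bsub>?T\<^esub> D = D \<oplus>\<^bsub>?T\<^esub> C" by (simp add: c d simps add.commute)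
    fix E assume "E \<in> carrier ?T"
    then obtain e where e: "E = cls N e" using cases by blast
    show "C \<oplus>\<^bsub>?T\<^esub> D \<oplus>\<^bsub>?T\<^esub> E = C \<oplus>\<^bsub>?T\<^esub> (D \<oplus>\<^bsub>?T\<^esub> E)" by (simp add: c d e simps add.assoc)
  next
    show "\<zero>\<^bsub>?T\<^esub> \<in> carrier ?T" by (simp add: simps mem)
  qed
  then show ?thesis
  proof (intro right_module.intro right_module_axioms.intro B.R.ring_axioms)
    fix C a assume "C \<in> carrier ?T" and a: "a \<in> carrier R"
    then obtain c where c: "Poly_Mapping.keys c \<subseteq> ?S" "C = cls N c" using cases by blast
    show "C \<star>\<^bsub>?T\<^esub> a \<in> carrier ?T"
      using a c by (simp add: tensor_ract mem act_keys[OF N])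
    show "(C \<oplus>\<^bsub>?T\<^esub> D) \<star>\<^bsub>?T\<^esub> a = C \<star>\<^bsub>?T\<^esub> a \<oplus>\<^bsub>?T\<^esub> D \<star>\<^bsub>?T\<^esub> a" if "D \<in> carrier ?T" for D
    proof -
      obtain d where "D = cls N d" using cases \<open>D \<in> carrier ?T\<close> by blast
      then show ?thesis using a c by (simp add: tensor_ract simps act_simps)
    qed
    fix b assume b: "b \<in> carrier R"
    have "act (a \<oplus> b) c - (act a c + act b c) \<in> rels N"
      using c(1)
    proof (induction c rule: frag_induction)
      case (one p)
      obtain x y where p: "p = (x, y)" "x \<in> carrier N" "y \<in> carrier B" using one by blast
      then show ?case
        using rel_right[OF N p(2) B.ract_closed[OF p(3) a] B.ract_closed[OF p(3) b]] a b
        by (simp add: act_simps B.ract_r_distr algebra_simps)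
    next
      case (diff c d)
      then show ?case
        using rels_diff[OF N diff] by (simp add: act_simps algebra_simps)
    qed (simp add: act_simps rels_zero[OF N])
    then show "C \<star>\<^bsub>?T\<^esub> (a \<oplus> b) = C \<star>\<^bsub>?T\<^esub> a \<oplus>\<^bsub>?T\<^esub> C \<star>\<^bsub>?T\<^esub> b"
      using a b c by (simp add: tensor_ract simps cls_eq_iff[OF N])
    have "act b (act a c) = act (a \<otimes> b) c"
      using c(1)
    proof (induction c rule: frag_induction)
      case (one p)
      then show ?case using a b by (auto simp: act_simps B.ract_assoc)
    qed (simp_all add: act_simps)
    then show "C \<star>\<^bsub>?T\<^esub> a \<star>\<^bsub>?T\<^esub> b = C \<star>\<^bsub>?T\<^esub> (a \<otimes> b)"
      using a b c by (simp add: tensor_ract)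
  next
    fix C assume "C \<in> carrier ?T"
    then obtain c where c: "Poly_Mapping.keys c \<subseteq> ?S" "C = cls N c" using cases by blast
    have "act \<one> c = c"
      using c(1)
    proof (induction c rule: frag_induction)
      case (one p)
      then show ?case by (auto simp: act_simps B.ract_one)
    qed (simp_all add: act_simps)
    then show "C \<star>\<^bsub>?T\<^esub> \<one> = C" using c by (simp add: tensor_ract)
  qed
qed

end

end

subsection \<open>Functoriality\<close>

context left_acted_module
begin

text \<open>
  The map induced by \<open>f\<close> on the free groups.
\<close>

definition push :: "('m \<Rightarrow> 'n) \<Rightarrow> (('m \<times> 'b) \<Rightarrow>\<^sub>0 int) \<Rightarrow> (('n \<times> 'b) \<Rightarrow>\<^sub>0 int)" where
  "push f = frag_extend (\<lambda>(x, b). frag_of (f x, b))"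

lemma push_simps:
  "push f (frag_of (x, b)) = frag_of (f x, b)" "push f 0 = 0" "push f (- c) = - push f c"
  "push f (c + d) = push f c + push f d" "push f (c - d) = push f c - push f d"
  by (simp_all add: push_def frag_extend_minus frag_extend_add frag_extend_diff)

lemma push_keys:
  assumes "supported N c" and "\<And>x. x \<in> carrier N \<Longrightarrow> f x \<in> carrier N'"
  shows "supported N' (push f c)"
proof -
  have "supported N' (case p of (x, b) \<Rightarrow> frag_of (f x, b))"
    if "p \<in> Poly_Mapping.keys c" for p
    using that assms by (cases p) auto
  then show ?thesis
    unfolding push_def by (intro order_trans[OF keys_frag_extend] UN_least)
qed

lemma push_rels:
  assumes N: "right_module R N" and N': "right_module R N'" and f: "f \<in> rhom R N N'"
    and h: "h \<in> rels N"
  shows "push f h \<in> rels N'"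
  by (rule rels_induct[OF N h, where P = "\<lambda>h. push f h \<in> rels N'"])
    (simp_all add: push_simps rels_zero[OF N'] rels_minus[OF N'] rels_add[OF N'] rhom_in[OF f]
      rhom_add[OF f] rhom_ract[OF f] rel_left[OF N'] rel_right[OF N'] rel_balanced[OF N'])

lemma tensor_map_cls:
  assumes N: "right_module R N" and N': "right_module R N'" and f: "f \<in> rhom R N N'"
  shows "tensor_map R l B N' f (cls N c) = cls N' (push f c)"
  using cls_map[OF N N' push_simps(5) push_rels[OF N N' f]]
  by (simp add: tensor_map_def push_def)

lemma push_act:
  assumes "supported N c"
  shows "push f (act a c) = act a (push f c)"
  using assms by (induction c rule: frag_induction) (auto simp: push_simps act_simps)

text \<open>The tensor product is a quotient of a free group on a set of pairs, so it fits into the universe.\<close>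

lemma tensor_lepoll:
  fixes N :: "('a, 'u) rmodule"
  assumes N: "right_module R N" and inf: "infinite (UNIV :: 'u set)"
    and B: "carrier B \<lesssim> (UNIV :: 'u set)"
  shows "carrier (tensor R N l B) \<lesssim> (UNIV :: 'u set)"
proof -
  let ?S = "(UNIV :: 'u set) \<times> carrier B"
  have "\<zero>\<^bsub>B\<^esub> \<in> carrier B" by simp
  then have "infinite ?S"
    using inf finite_cartesian_productD1[of "UNIV :: 'u set" "carrier B"] by blast
  then have "carrier (free_Abelian_group ?S) \<approx> ?S"
    by (rule eqpoll_free_Abelian_group_infinite)
  moreover have "carrier (tensor_free N B) \<subseteq> carrier (free_Abelian_group ?S)"
    by (auto simp: tensor_free_def)
  ultimately have "carrier (tensor_free N B) \<lesssim> ?S"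
    using subset_imp_lepoll lepoll_trans2 by blast
  moreover have "?S \<lesssim> (UNIV :: 'u set)"
    by (rule lepoll_UNIV_Times[OF inf lepoll_refl B])
  ultimately have "carrier (tensor_free N B) \<lesssim> (UNIV :: 'u set)"
    using lepoll_trans by blast
  then show ?thesis
    unfolding tensor_carrier[OF N] using image_lepoll lepoll_trans by blast
qed

context
  assumes inf: "infinite (UNIV :: 'u set)" and B_small: "carrier B \<lesssim> (UNIV :: 'u set)"
begin

abbreviation (input) tensor_emb :: "('a, 'u) rmodule \<Rightarrow> (('u \<times> 'b) \<Rightarrow>\<^sub>0 int) set \<Rightarrow> 'u" where
  "tensor_emb N \<equiv> emb (carrier (tensor R N l B))"

lemma tensor_emb_inj: "right_module R N \<Longrightarrow> inj_on (tensor_emb N) (carrier (tensor R N l B))"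
  using inj_on_emb[OF tensor_lepoll[OF _ inf B_small]] .

lemma tensor_ftor_obj:
  fixes N :: "('a, 'u) rmodule"
  assumes "right_module R N"
  shows "right_module R (fobj (tensor_ftor R l B) N)"
  using copy_module_right_module[OF tensor_emb_inj[OF assms] tensor_right_module[OF assms]]
  by (simp add: tensor_ftor_def)

lemma tensor_copy_cases:
  fixes N :: "('a, 'u) rmodule"
  assumes N: "right_module R N" and x: "x \<in> carrier (fobj (tensor_ftor R l B) N)"
  obtains c where "supported N c" "x = tensor_emb N (cls N c)"
  using x unfolding tensor_ftor_def by (auto simp: tensor_carrier[OF N])

lemma tensor_mem:
  assumes "right_module R N" "supported N c"
  shows "cls N c \<in> carrier (tensor R N l B)"
  using assms by (simp add: tensor_carrier)

lemma tensor_copy_mem: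
  fixes N :: "('a, 'u) rmodule"
  assumes "right_module R N" "supported N c"
  shows "tensor_emb N (cls N c) \<in> carrier (fobj (tensor_ftor R l B) N)"
  using tensor_mem[OF assms] by (simp add: tensor_ftor_def)

lemma tensor_copy_add:
  fixes N :: "('a, 'u) rmodule"
  assumes N: "right_module R N" and "supported N c"
    "supported N d"
  shows "tensor_emb N (cls N c) \<oplus>\<^bsub>fobj (tensor_ftor R l B) N\<^esub> tensor_emb N (cls N d) =
    tensor_emb N (cls N (c + d))"
  using copy_module_add[OF tensor_emb_inj[OF N] tensor_mem[OF N assms(2)] tensor_mem[OF N assms(3)]]
  by (simp add: tensor_ftor_def tensor_add[OF N])

lemma tensor_copy_ract:
  fixes N :: "('a, 'u) rmodule"
  assumes N: "right_module R N" and "supported N c" and a: "a \<in> carrier R"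
  shows "tensor_emb N (cls N c) \<star>\<^bsub>fobj (tensor_ftor R l B) N\<^esub> a = tensor_emb N (cls N (act a c))"
  using copy_module_ract[OF tensor_emb_inj[OF N] tensor_mem[OF N assms(2)]]
  by (simp add: tensor_ftor_def tensor_ract[OF N a])

lemma tensor_ftor_apply:
  fixes N N' :: "('a, 'u) rmodule"
  assumes N: "right_module R N" and N': "right_module R N'" and f: "f \<in> rhom R N N'"
    and c: "supported N c"
  shows "farr (tensor_ftor R l B) N N' f (tensor_emb N (cls N c)) = tensor_emb N' (cls N' (push f c))"
  using tensor_mem[OF N c] tensor_emb_inj[OF N]
  by (simp add: tensor_ftor_def Let_def tensor_map_cls[OF N N' f])

lemma tensor_ftor_arr:
  fixes N N' :: "('a, 'u) rmodule"
  assumes N: "right_module R N" and N': "right_module R N'" and f: "f \<in> rhom R N N'"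
  shows "farr (tensor_ftor R l B) N N' f \<in>
    rhom R (fobj (tensor_ftor R l B) N) (fobj (tensor_ftor R l B) N')"
proof (rule rhomI)
  let ?F = "tensor_ftor R l B"
  have pk: "supported N' (push f c)"
    if "supported N c" for c
    using push_keys[OF that rhom_in[OF f]] .
  have "farr ?F N N' f \<in> extensional (carrier (fobj ?F N))"
    by (simp add: tensor_ftor_def Let_def)
  moreover have "farr ?F N N' f x \<in> carrier (fobj ?F N')" if x: "x \<in> carrier (fobj ?F N)" for x
  proof (rule tensor_copy_cases[OF N x])
    fix c assume "supported N c" "x = tensor_emb N (cls N c)"
    then show ?thesis using tensor_copy_mem[OF N' pk] by (simp add: tensor_ftor_apply[OF N N' f])
  qed
  ultimately show "farr ?F N N' f \<in> carrier (fobj ?F N) \<rightarrow>\<^sub>E carrier (fobj ?F N')"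
    by (auto simp: PiE_def)
  fix x assume "x \<in> carrier (fobj ?F N)"
  then obtain c where c: "supported N c" "x = tensor_emb N (cls N c)"
    using tensor_copy_cases[OF N] by blast
  show "farr ?F N N' f (x \<star>\<^bsub>fobj ?F N\<^esub> a) = farr ?F N N' f x \<star>\<^bsub>fobj ?F N'\<^esub> a" if a: "a \<in> carrier R" for a
    using c a pk[OF c(1)] act_keys[OF N c(1) a]
    by (simp add: tensor_copy_ract[OF N] tensor_copy_ract[OF N'] tensor_ftor_apply[OF N N' f]
        push_act[OF c(1)])
  fix y assume "y \<in> carrier (fobj ?F N)"
  then obtain d where d: "supported N d" "y = tensor_emb N (cls N d)"
    using tensor_copy_cases[OF N] by blast
  show "farr ?F N N' f (x \<oplus>\<^bsub>fobj ?F N\<^esub> y) = farr ?F N N' f x \<oplus>\<^bsub>fobj ?F N'\<^esub> farr ?F N N' f y"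
    using c d pk[OF c(1)] pk[OF d(1)] keys_add_subset[OF c(1) d(1)]
    by (simp add: tensor_copy_add[OF N] tensor_copy_add[OF N'] tensor_ftor_apply[OF N N' f] push_simps)
qed

lemma is_functor_tensor:
  "is_functor (ModR R) (ModR R) (tensor_ftor R l B :: (('a, 'u) rmodule, 'u \<Rightarrow> 'u, _, _) ftor)"
  unfolding is_functor_def ModR_simps mem_Collect_eq
proof (intro conjI ballI)
  let ?F = "tensor_ftor R l B :: (('a, 'u) rmodule, 'u \<Rightarrow> 'u, _, _) ftor"
  fix N :: "('a, 'u) rmodule" assume "N \<in> Obj (ModR R)"
  then have N: "right_module R N" by simp
  show "right_module R (fobj ?F N)" by (rule tensor_ftor_obj[OF N])
  have Id: "(\<lambda>x\<in>carrier N. x) \<in> rhom R N N" by (rule rhom_Id[OF N])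
  show "farr ?F N N (\<lambda>x\<in>carrier N. x) = (\<lambda>x\<in>carrier (fobj ?F N). x)"
  proof (rule rhom_eqI[OF tensor_ftor_arr[OF N N Id] rhom_Id[OF tensor_ftor_obj[OF N]]])
    fix x assume x: "x \<in> carrier (fobj ?F N)"
    then obtain c where c: "supported N c" "x = tensor_emb N (cls N c)"
      using tensor_copy_cases[OF N] by blast
    have "push (\<lambda>x\<in>carrier N. x) c = c"
      using c(1) by (induction c rule: frag_induction) (auto simp: push_simps)
    then show "farr ?F N N (\<lambda>x\<in>carrier N. x) x = (\<lambda>x\<in>carrier (fobj ?F N). x) x"
      using x c(1) unfolding c(2) by (simp add: tensor_ftor_apply[OF N N Id])
  qed
  fix N' :: "('a, 'u) rmodule" and f assume "N' \<in> Obj (ModR R)" and f: "f \<in> rhom R N N'"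
  then have N': "right_module R N'" by simp
  show "farr ?F N N' f \<in> rhom R (fobj ?F N) (fobj ?F N')" by (rule tensor_ftor_arr[OF N N' f])
  fix N'' :: "('a, 'u) rmodule" and g assume "N'' \<in> Obj (ModR R)" and g: "g \<in> rhom R N' N''"
  then have N'': "right_module R N''" by simp
  have gf: "compose (carrier N) g f \<in> rhom R N N''"
    by (rule rhom_compose[OF f g right_module_closed(1,2)[OF N]])
  show "farr ?F N N'' (compose (carrier N) g f) =
      compose (carrier (fobj ?F N)) (farr ?F N' N'' g) (farr ?F N N' f)"
  proof (rule rhom_eqI[OF tensor_ftor_arr[OF N N'' gf] rhom_compose[OF tensor_ftor_arr[OF N N' f]
          tensor_ftor_arr[OF N' N'' g] right_module_closed(1,2)[OF tensor_ftor_obj[OF N]]]])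
    fix x assume x: "x \<in> carrier (fobj ?F N)"
    then obtain c where c: "supported N c" "x = tensor_emb N (cls N c)"
      using tensor_copy_cases[OF N] by blast
    have "push (compose (carrier N) g f) c = push g (push f c)"
      using c(1) by (induction c rule: frag_induction) (auto simp: push_simps compose_def)
    then show "farr ?F N N'' (compose (carrier N) g f) x =
        compose (carrier (fobj ?F N)) (farr ?F N' N'' g) (farr ?F N N' f) x"
      using x c(1) push_keys[OF c(1) rhom_in[OF f]] unfolding c(2)
      by (simp add: compose_eq tensor_ftor_apply[OF N N' f] tensor_ftor_apply[OF N' N'' g]
          tensor_ftor_apply[OF N N'' gf])
  qed
qed

end

end

section \<open>The shift corresponds to tensoring with the part of degree one\<close>

context strongly_graded_ring
begin

abbreviation (input) A1 where "A1 \<equiv> degree_part (regular_module A gr) 1"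

lemma left_acted_module_A1: "left_acted_module A0 A1 (\<otimes>)"
proof (intro left_acted_module.intro left_acted_module_axioms.intro)
  show "right_module A0 A1"
    by (rule degree_part_right_module[OF regular_module_graded])
  show "r \<otimes> b \<in> carrier A1" if "r \<in> carrier A0" "b \<in> carrier A1" for r b
    using gr_mult[of r 0 b 1] that by simp
qed (simp add: m_assoc gg.part_in_carrier)

sublocale T: left_acted_module A0 A1 "(\<otimes>)"
  by (rule left_acted_module_A1)

text \<open>
  A representative of \<open>\<Sum>\<^sub>i y u\<^sub>i \<otimes> v\<^sub>i\<close>, where \<open>1 = \<Sum>\<^sub>i u\<^sub>i v\<^sub>i\<close> with \<open>u\<^sub>i \<in> A\<^sub>-\<^sub>1\<close> and \<open>v\<^sub>i \<in> A\<^sub>1\<close>. It will turn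
  out to be the inverse of the multiplication \<open>X\<^sub>0 \<otimes> A\<^sub>1 \<rightarrow> X\<^sub>1\<close>.
\<close>

definition tensor_section :: "('a, 'm) grmodule \<Rightarrow> 'm \<Rightarrow> ('m \<times> 'a) \<Rightarrow>\<^sub>0 int" where
  "tensor_section X y = (\<Sum>i\<in>unit_index 1. frag_of (y \<star>\<^bsub>X\<^esub> unit_left 1 i, unit_right 1 i))"

context
  fixes X :: "('a, 'm) grmodule"
  assumes X: "graded_right_module A gr X"
begin

interpretation X: graded_group X "homog X" by (rule graded_right_module_graded_group[OF X])
interpretation XX: right_module A X by (rule graded_right_module_imp_right_module[OF X])

abbreviation (input) X0 where "X0 \<equiv> degree_part X 0"

lemma degree_zero_part: "right_module A0 X0"
  by (rule degree_part_right_module[OF X])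

lemma section_factor: "y \<in> homog X 1 \<Longrightarrow> i \<in> unit_index 1 \<Longrightarrow> y \<star>\<^bsub>X\<^esub> unit_left 1 i \<in> homog X 0"
  using graded_right_module_ract[OF X, of y 1 "unit_left 1 i" "- 1"] unit_left_in[of i 1] by simp

lemma section_keys:
  assumes y: "y \<in> homog X 1"
  shows "T.supported X0 (tensor_section X y)"
proof -
  have "T.supported X0 (frag_of (y \<star>\<^bsub>X\<^esub> unit_left 1 i, unit_right 1 i))"
    if "i \<in> unit_index 1" for i
    using section_factor[OF y that] unit_right_in[OF that] by simp
  then show ?thesis
    unfolding tensor_section_def by (intro order_trans[OF keys_sum] UN_least)
qed

lemma section_add:
  assumes y: "y \<in> homog X 1" and z: "z \<in> homog X 1"
  shows "tensor_section X (y \<oplus>\<^bsub>X\<^esub> z) - tensor_section X y - tensor_section X z \<in> T.rels X0"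
proof -
  have "tensor_section X (y \<oplus>\<^bsub>X\<^esub> z) - tensor_section X y - tensor_section X z =
      (\<Sum>i\<in>unit_index 1. frag_of ((y \<oplus>\<^bsub>X\<^esub> z) \<star>\<^bsub>X\<^esub> unit_left 1 i, unit_right 1 i) -
        frag_of (y \<star>\<^bsub>X\<^esub> unit_left 1 i, unit_right 1 i) - frag_of (z \<star>\<^bsub>X\<^esub> unit_left 1 i, unit_right 1 i))"
    by (simp add: tensor_section_def sum_subtractf)
  also have "\<dots> \<in> T.rels X0"
  proof (rule T.rels_sum[OF degree_zero_part])
    fix i assume i: "i \<in> unit_index 1"
    show "frag_of ((y \<oplus>\<^bsub>X\<^esub> z) \<star>\<^bsub>X\<^esub> unit_left 1 i, unit_right 1 i) -
        frag_of (y \<star>\<^bsub>X\<^esub> unit_left 1 i, unit_right 1 i) - frag_of (z \<star>\<^bsub>X\<^esub> unit_left 1 i, unit_right 1 i)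
        \<in> T.rels X0"
      using T.rel_left[OF degree_zero_part, of "y \<star>\<^bsub>X\<^esub> unit_left 1 i" "z \<star>\<^bsub>X\<^esub> unit_left 1 i" "unit_right 1 i"]
        section_factor[OF y i] section_factor[OF z i] unit_right_in[OF i] y z unit_left_carrier[OF i]
      by (simp add: XX.ract_l_distr X.part_in_carrier)
  qed
  finally show ?thesis .
qed

lemma frag_of_finsum:
  assumes x: "x \<in> homog X 0" and g: "\<And>i. i \<in> J \<Longrightarrow> g i \<in> gr 1" and fin: "finite J"
  shows "frag_of (x, finsum A g J) - (\<Sum>i\<in>J. frag_of (x, g i)) \<in> T.rels X0 \<and> finsum A g J \<in> gr 1"
  using fin g
proof (induction J)
  case empty
  \<comment> \<open>\<open>x \<otimes> (0 + 0) - x \<otimes> 0 - x \<otimes> 0\<close> is \<open>- (x \<otimes> 0)\<close>.\<close>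
  show ?case
    using T.rels_minus[OF degree_zero_part T.rel_right[OF degree_zero_part, of x \<zero> \<zero>]] x gg.part_zero[of 1] by simp
next
  case (insert i J)
  then have sum: "finsum A g (insert i J) = g i \<oplus> finsum A g J"
    using gg.part_in_carrier by (intro finsum_insert) auto
  have "frag_of (x, g i \<oplus> finsum A g J) - frag_of (x, g i) - frag_of (x, finsum A g J) \<in> T.rels X0"
    using T.rel_right[OF degree_zero_part, of x "g i" "finsum A g J"] insert x by simp
  from T.rels_add[OF degree_zero_part this, of "frag_of (x, finsum A g J) - (\<Sum>i\<in>J. frag_of (x, g i))"]
  show ?case
    using insert by (simp add: sum gg.part_add algebra_simps)
qed

text \<open>
  Modulo the relations, \<open>\<Sum>\<^sub>i x b u\<^sub>i \<otimes> v\<^sub>i = \<Sum>\<^sub>i x \<otimes> b u\<^sub>i v\<^sub>i = x \<otimes> b\<close>, because \<open>b u\<^sub>i \<in> A\<^sub>0\<close> may be moved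
  across the tensor sign.
\<close>

lemma section_of_product:
  assumes x: "x \<in> homog X 0" and b: "b \<in> gr 1"
  shows "tensor_section X (x \<star>\<^bsub>X\<^esub> b) - frag_of (x, b) \<in> T.rels X0"
proof -
  let ?u = "unit_left 1" and ?v = "unit_right 1" and ?J = "unit_index 1"
  have bA: "b \<in> carrier A" using gg.part_in_carrier[OF b] .
  have bu: "b \<otimes> ?u i \<in> gr 0" if "i \<in> ?J" for i
    using gr_mult[OF b unit_left_in[OF that]] by simp
  have buv: "(b \<otimes> ?u i) \<otimes> ?v i \<in> gr 1" if "i \<in> ?J" for i
    using gr_mult[OF bu[OF that] unit_right_in[OF that]] by simp
  have "tensor_section X (x \<star>\<^bsub>X\<^esub> b) - (\<Sum>i\<in>?J. frag_of (x, (b \<otimes> ?u i) \<otimes> ?v i)) =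
      (\<Sum>i\<in>?J. frag_of (x \<star>\<^bsub>X0\<^esub> (b \<otimes> ?u i), ?v i) - frag_of (x, (b \<otimes> ?u i) \<otimes> ?v i))"
    using x bA unit_left_carrier
    by (simp add: tensor_section_def sum_subtractf XX.ract_assoc X.part_in_carrier)
  also have "\<dots> \<in> T.rels X0"
    using x bu unit_right_in by (intro T.rels_sum[OF degree_zero_part] T.rel_balanced[OF degree_zero_part]) simp_all
  finally have 1: "tensor_section X (x \<star>\<^bsub>X\<^esub> b) - (\<Sum>i\<in>?J. frag_of (x, (b \<otimes> ?u i) \<otimes> ?v i)) \<in> T.rels X0" .
  have "(\<Oplus>i\<in>?J. (b \<otimes> ?u i) \<otimes> ?v i) = b"
  proof -
    have "(\<Oplus>i\<in>?J. (b \<otimes> ?u i) \<otimes> ?v i) = (\<Oplus>i\<in>?J. b \<otimes> (?u i \<otimes> ?v i))"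
      using bA unit_left_carrier unit_right_carrier by (intro finsum_cong') (auto simp: m_assoc)
    also have "\<dots> = b \<otimes> (\<Oplus>i\<in>?J. ?u i \<otimes> ?v i)"
      using bA unit_left_carrier unit_right_carrier by (intro finsum_rdistr[symmetric]) auto
    finally show ?thesis using bA by (simp add: unit_sum)
  qed
  then have 2: "frag_of (x, b) - (\<Sum>i\<in>?J. frag_of (x, (b \<otimes> ?u i) \<otimes> ?v i)) \<in> T.rels X0"
    using frag_of_finsum[OF x, of ?J "\<lambda>i. (b \<otimes> ?u i) \<otimes> ?v i"] buv by simp
  show ?thesis
    using T.rels_diff[OF degree_zero_part 1 2] by simp
qed

text \<open>
  The multiplication \<open>X\<^sub>0 \<otimes> A\<^sub>1 \<rightarrow> X\<^sub>1\<close> on representatives, from the universal property of the free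
  abelian group.
\<close>

lemma tensor_evaluation:
  "\<exists>m \<in> hom (tensor_free X0 A1) (add_monoid (degree_part X 1)).
    \<forall>x\<in>homog X 0. \<forall>b\<in>gr 1. m (frag_of (x, b)) = x \<star>\<^bsub>X\<^esub> b"
proof -
  have "comm_group (add_monoid (degree_part X 1))"
    using degree_part_right_module[OF X, of 1] abelian_group.a_comm_group
    unfolding right_module_def by blast
  moreover have "(\<lambda>(x, b). x \<star>\<^bsub>X\<^esub> b) ` (carrier X0 \<times> carrier A1) \<subseteq> carrier (add_monoid (degree_part X 1))"
    using graded_right_module_ract[OF X, of _ 0 _ 1] by auto
  ultimately obtain m where m: "m \<in> hom (free_Abelian_group (carrier X0 \<times> carrier A1))
      (add_monoid (degree_part X 1))"
    "\<And>p. p \<in> carrier X0 \<times> carrier A1 \<Longrightarrow> m (frag_of p) = (\<lambda>(x, b). x \<star>\<^bsub>X\<^esub> b) p"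
    by (rule comm_group.free_Abelian_group_universal) blast
  show ?thesis
    by (rule bexI[of _ m]) (use m in \<open>auto simp: tensor_free_def\<close>)
qed

text \<open>
  The evaluation \<open>m\<close> kills the relations, and it is inverse to the section in both orders: \<open>m\<close> sends the
  section of \<open>y\<close> to \<open>\<Sum>\<^sub>i y u\<^sub>i v\<^sub>i = y\<close>, and the section of \<open>m c\<close> is \<open>c\<close> modulo the relations. The section
  is linear because \<open>m\<close> is.
\<close>

lemma section_properties:
  shows "inj_on (\<lambda>y. T.cls X0 (tensor_section X y)) (homog X 1)"
    and "(\<lambda>y. T.cls X0 (tensor_section X y)) ` homog X 1 = carrier (tensor A0 X0 (\<otimes>) A1)"
    and "\<And>y a. \<lbrakk>y \<in> homog X 1; a \<in> gr 0\<rbrakk> \<Longrightarrow>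
      T.cls X0 (tensor_section X (y \<star>\<^bsub>X\<^esub> a)) = T.cls X0 (T.act a (tensor_section X y))"
proof -
  let ?X1 = "degree_part X 1"
  obtain m where m: "m \<in> hom (tensor_free X0 A1) (add_monoid ?X1)"
    and m_of: "\<And>x b. \<lbrakk>x \<in> homog X 0; b \<in> gr 1\<rbrakk> \<Longrightarrow> m (frag_of (x, b)) = x \<star>\<^bsub>X\<^esub> b"
    using tensor_evaluation by blast
  have m_in: "m c \<in> homog X 1" if "T.supported X0 c" for c
    using m that by (auto simp: hom_def)
  have m_add: "m (c + d) = m c \<oplus>\<^bsub>X\<^esub> m d"
    if "T.supported X0 c" "T.supported X0 d" for c d
    using m that by (auto simp: hom_def)
  have m_zero: "m 0 = \<zero>\<^bsub>X\<^esub>"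
    using m_add[of 0 0] m_in[of 0] X.part_in_carrier[of "m 0" 1] by (simp add: X.add.r_cancel_one')
  have m_diff: "m (c - d) = m c \<ominus>\<^bsub>X\<^esub> m d"
    if c: "T.supported X0 c" and d: "T.supported X0 d" for c d
  proof -
    have "m c = m (c - d) \<oplus>\<^bsub>X\<^esub> m d"
      using m_add[OF T.keys_diff_subset[OF c d] d] by simp
    then show ?thesis
      using X.part_in_carrier[OF m_in[OF d]] X.part_in_carrier[OF m_in[OF T.keys_diff_subset[OF c d]]]
      by (simp add: X.minus_eq X.a_assoc X.r_neg)
  qed
  have m_rels: "m h = \<zero>\<^bsub>X\<^esub>" if h: "h \<in> T.rels X0" for h
  proof (rule T.rels_induct[OF degree_zero_part h, where P = "\<lambda>h. m h = \<zero>\<^bsub>X\<^esub>"])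
    have mem: "T.supported X0 (frag_of (x, b))" if "x \<in> homog X 0" "b \<in> gr 1" for x b
      using that by simp
    have ract: "x \<star>\<^bsub>X\<^esub> b \<in> carrier X" if "x \<in> homog X 0" "b \<in> gr 1" for x b
      using that by (simp add: XX.ract_closed X.part_in_carrier gg.part_in_carrier)
    have cancel: "p \<oplus>\<^bsub>X\<^esub> q \<ominus>\<^bsub>X\<^esub> p \<ominus>\<^bsub>X\<^esub> q = \<zero>\<^bsub>X\<^esub>" if "p \<in> carrier X" "q \<in> carrier X" for p q
      using that by (subst X.a_comm[of p q]) (simp_all add: X.minus_eq X.a_assoc X.r_neg X.r_neg2)
    show "m 0 = \<zero>\<^bsub>X\<^esub>" by (rule m_zero)
    show "m (frag_of (x \<oplus>\<^bsub>X0\<^esub> y, b) - frag_of (x, b) - frag_of (y, b)) = \<zero>\<^bsub>X\<^esub>"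
      if "x \<in> carrier X0" "y \<in> carrier X0" "b \<in> carrier A1" for x y b
      using that ract[of x b] ract[of y b]
      by (simp add: m_diff T.keys_diff_subset mem m_of X.part_add XX.ract_l_distr X.part_in_carrier
          gg.part_in_carrier cancel)
    show "m (frag_of (x, b \<oplus>\<^bsub>A1\<^esub> c) - frag_of (x, b) - frag_of (x, c)) = \<zero>\<^bsub>X\<^esub>"
      if "x \<in> carrier X0" "b \<in> carrier A1" "c \<in> carrier A1" for x b c
      using that ract[of x b] ract[of x c]
      by (simp add: m_diff T.keys_diff_subset mem m_of gg.part_add XX.ract_r_distr X.part_in_carrier
          gg.part_in_carrier cancel)
    show "m (frag_of (x \<star>\<^bsub>X0\<^esub> r, b) - frag_of (x, r \<otimes> b)) = \<zero>\<^bsub>X\<^esub>"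
      if "x \<in> carrier X0" "r \<in> carrier A0" "b \<in> carrier A1" for x r b
    proof -
      have "x \<star>\<^bsub>X\<^esub> r \<in> homog X 0" "r \<otimes> b \<in> gr 1"
        using that graded_right_module_ract[OF X, of x 0 r 0] gr_mult[of r 0 b 1] by auto
      then show ?thesis
        using that ract[of "x \<star>\<^bsub>X\<^esub> r" b]
        by (simp add: m_diff mem m_of XX.ract_assoc X.part_in_carrier gg.part_in_carrier X.minus_eq X.r_neg)
    qed
    show "m (- c) = \<zero>\<^bsub>X\<^esub>" if "c \<in> T.rels X0" "m c = \<zero>\<^bsub>X\<^esub>" for c
      using m_diff[of 0 c] T.rels_keys[OF degree_zero_part that(1)] that(2) by (simp add: m_zero X.minus_eq)
    show "m (c + d) = \<zero>\<^bsub>X\<^esub>" if "c \<in> T.rels X0" "d \<in> T.rels X0" "m c = \<zero>\<^bsub>X\<^esub>" "m d = \<zero>\<^bsub>X\<^esub>" for c d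
      using m_add[OF T.rels_keys[OF degree_zero_part that(1)] T.rels_keys[OF degree_zero_part that(2)]] that(3,4) by simp
  qed
  have m_section: "m (tensor_section X y) = y" if y: "y \<in> homog X 1" for y
  proof -
    have summand: "T.supported X0 (frag_of (y \<star>\<^bsub>X\<^esub> unit_left 1 i, unit_right 1 i))"
      "m (frag_of (y \<star>\<^bsub>X\<^esub> unit_left 1 i, unit_right 1 i)) = (y \<star>\<^bsub>X\<^esub> unit_left 1 i) \<star>\<^bsub>X\<^esub> unit_right 1 i"
      if "i \<in> unit_index 1" for i
      using section_factor[OF y that] unit_right_in[OF that] by (simp_all add: m_of)
    have "m (\<Sum>i\<in>J. frag_of (y \<star>\<^bsub>X\<^esub> unit_left 1 i, unit_right 1 i)) =
        finsum X (\<lambda>i. (y \<star>\<^bsub>X\<^esub> unit_left 1 i) \<star>\<^bsub>X\<^esub> unit_right 1 i) J \<and>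
        T.supported X0 (\<Sum>i\<in>J. frag_of (y \<star>\<^bsub>X\<^esub> unit_left 1 i, unit_right 1 i))"
      if "finite J" "J \<subseteq> unit_index 1" for J
      using that
    proof induction
      case empty
      show ?case by (simp add: m_zero)
    next
      case (insert i J)
      then have i: "i \<in> unit_index 1" by blast
      have "finsum X (\<lambda>i. (y \<star>\<^bsub>X\<^esub> unit_left 1 i) \<star>\<^bsub>X\<^esub> unit_right 1 i) (insert i J) =
          (y \<star>\<^bsub>X\<^esub> unit_left 1 i) \<star>\<^bsub>X\<^esub> unit_right 1 i \<oplus>\<^bsub>X\<^esub>
          finsum X (\<lambda>i. (y \<star>\<^bsub>X\<^esub> unit_left 1 i) \<star>\<^bsub>X\<^esub> unit_right 1 i) J"
        using insert X.part_in_carrier[OF y] unit_left_carrier unit_right_carrier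
        by (intro X.finsum_insert) (auto intro!: XX.ract_closed)
      then show ?case
        using insert m_add[OF summand(1)[OF i], of "\<Sum>i\<in>J. frag_of (y \<star>\<^bsub>X\<^esub> unit_left 1 i, unit_right 1 i)"]
          summand[OF i] T.keys_add_subset[OF summand(1)[OF i]] by simp
    qed
    then show ?thesis
      using unit_sum_ract[OF graded_right_module_imp_right_module[OF X] X.part_in_carrier[OF y], of 1]
      by (simp add: tensor_section_def)
  qed
  have section_m: "tensor_section X (m c) - c \<in> T.rels X0" if "T.supported X0 c" for c
  proof -
    have "T.supported X0 c \<and> tensor_section X (m c) - c \<in> T.rels X0"
      using that
    proof (induction c rule: frag_induction)
      case zero
      \<comment> \<open>Additivity of the section \<open>s\<close> at \<open>0 + 0\<close> says that \<open>- s 0\<close> is a relation.\<close>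
      show ?case
        using section_add[OF X.part_zero X.part_zero] T.rels_minus[OF degree_zero_part]
        by (fastforce simp: m_zero)
    next
      case (one p)
      then show ?case
        using section_of_product by (cases p) (auto simp: m_of)
    next
      case (diff c d)
      then have cd: "T.supported X0 c" "T.supported X0 d" by blast+
      have cmd: "T.supported X0 (c - d)" by (rule T.keys_diff_subset[OF cd])
      have "tensor_section X (m (c - d) \<oplus>\<^bsub>X\<^esub> m d) - tensor_section X (m (c - d)) - tensor_section X (m d)
          \<in> T.rels X0"
        by (rule section_add[OF m_in[OF cmd] m_in[OF cd(2)]])
      moreover have "m (c - d) \<oplus>\<^bsub>X\<^esub> m d = m c"
        using m_add[OF cmd cd(2)] by simp
      ultimately have e: "tensor_section X (m c) - tensor_section X (m (c - d)) - tensor_section X (m d)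
          \<in> T.rels X0" by simp
      have "(tensor_section X (m c) - c) - (tensor_section X (m d) - d) -
          (tensor_section X (m c) - tensor_section X (m (c - d)) - tensor_section X (m d)) \<in> T.rels X0"
        using T.rels_diff[OF degree_zero_part T.rels_diff[OF degree_zero_part conjunct2[OF diff(1)] conjunct2[OF diff(2)]] e] .
      then show ?case using cmd by (simp add: algebra_simps)
    qed
    then show ?thesis by blast
  qed
  show "inj_on (\<lambda>y. T.cls X0 (tensor_section X y)) (homog X 1)"
  proof (rule inj_onI)
    fix y z assume y: "y \<in> homog X 1" and z: "z \<in> homog X 1"
      and "T.cls X0 (tensor_section X y) = T.cls X0 (tensor_section X z)"
    then have "m (tensor_section X y - tensor_section X z) = \<zero>\<^bsub>X\<^esub>"
      by (intro m_rels) (simp add: T.cls_eq_iff[OF degree_zero_part])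
    then have "y \<ominus>\<^bsub>X\<^esub> z = \<zero>\<^bsub>X\<^esub>"
      using m_diff[OF section_keys[OF y] section_keys[OF z]] by (simp add: m_section y z)
    then show "y = z"
      using X.minus_equality[of y "\<ominus>\<^bsub>X\<^esub> z"] X.part_in_carrier[OF y] X.part_in_carrier[OF z]
      by (simp add: X.minus_eq)
  qed
  show "(\<lambda>y. T.cls X0 (tensor_section X y)) ` homog X 1 = carrier (tensor A0 X0 (\<otimes>) A1)"
  proof (intro equalityI subsetI)
    fix C assume "C \<in> (\<lambda>y. T.cls X0 (tensor_section X y)) ` homog X 1"
    then show "C \<in> carrier (tensor A0 X0 (\<otimes>) A1)"
      using section_keys by (auto simp: T.tensor_carrier[OF degree_zero_part] simp del: degree_part_simps)
  next
    fix C assume "C \<in> carrier (tensor A0 X0 (\<otimes>) A1)"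
    then obtain c where c: "T.supported X0 c" "C = T.cls X0 c"
      by (auto simp: T.tensor_carrier[OF degree_zero_part] simp del: degree_part_simps)
    then have "C = T.cls X0 (tensor_section X (m c))"
      using section_m[OF c(1)] by (simp add: T.cls_eq_iff[OF degree_zero_part])
        (metis T.rels_minus[OF degree_zero_part] minus_diff_eq)
    then show "C \<in> (\<lambda>y. T.cls X0 (tensor_section X y)) ` homog X 1"
      using m_in[OF c(1)] by blast
  qed
  fix y a assume y: "y \<in> homog X 1" and a: "a \<in> gr 0"
  have act_keys: "T.supported X0 (T.act a c)" if "T.supported X0 c" for c
    using T.act_keys[OF degree_zero_part that, of a] a by simp
  have m_act: "m (T.act a c) = m c \<star>\<^bsub>X\<^esub> a" if "T.supported X0 c" for c
  proof -
    have "T.supported X0 c \<and> m (T.act a c) = m c \<star>\<^bsub>X\<^esub> a"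
      using that
    proof (induction c rule: frag_induction)
      case zero
      show ?case using a by (simp add: T.act_simps m_zero XX.zero_ract gg.part_in_carrier)
    next
      case (one p)
      then obtain x b where p: "p = (x, b)" "x \<in> homog X 0" "b \<in> gr 1" by auto
      then show ?case
        using a gr_mult[of b 1 a 0]
        by (simp add: T.act_simps m_of XX.ract_assoc X.part_in_carrier gg.part_in_carrier)
    next
      case (diff c d)
      then have cd: "T.supported X0 c" "T.supported X0 d" by blast+
      have inv: "(\<ominus>\<^bsub>X\<^esub> x) \<star>\<^bsub>X\<^esub> a = \<ominus>\<^bsub>X\<^esub> (x \<star>\<^bsub>X\<^esub> a)" if "x \<in> carrier X" for x
        using additive_a_inv[OF X.abelian_group_axioms X.abelian_group_axioms
            XX.ract_additive[OF gg.part_in_carrier[OF a]] that] .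
      show ?case
        using diff cd X.part_in_carrier[OF m_in[OF cd(1)]] X.part_in_carrier[OF m_in[OF cd(2)]]
          gg.part_in_carrier[OF a] T.keys_diff_subset[OF cd]
          m_diff[OF act_keys[OF cd(1)] act_keys[OF cd(2)]]
        by (simp add: T.act_simps m_diff act_keys X.minus_eq XX.ract_l_distr inv)
    qed
    then show ?thesis by blast
  qed
  have "tensor_section X (y \<star>\<^bsub>X\<^esub> a) - T.act a (tensor_section X y) \<in> T.rels X0"
    using section_m[OF act_keys[OF section_keys[OF y]]]
    by (simp add: m_act[OF section_keys[OF y]] m_section[OF y])
  then show "T.cls X0 (tensor_section X (y \<star>\<^bsub>X\<^esub> a)) = T.cls X0 (T.act a (tensor_section X y))"
    by (rule T.cls_eqI[OF degree_zero_part])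
qed

end

end

lemma degree_part_shift: "degree_part (shift_by k X) n = degree_part X (n + k)"
  by (simp add: degree_part_def shift_by_def rmodule.truncate_def)

context strongly_graded_ring
begin

text \<open>
  The section is natural even before passing to classes.
\<close>

lemma push_tensor_section:
  assumes X: "graded_right_module A gr X" and h: "h \<in> grhom A X Y" and y: "y \<in> homog X 1"
  shows "T.push (restrict h (homog X 0)) (tensor_section X y) = tensor_section Y (h y)"
proof -
  interpret X: graded_group X "homog X" by (rule graded_right_module_graded_group[OF X])
  have "T.push (restrict h (homog X 0)) (tensor_section X y) =
      (\<Sum>i\<in>unit_index 1. T.push (restrict h (homog X 0)) (frag_of (y \<star>\<^bsub>X\<^esub> unit_left 1 i, unit_right 1 i)))"
    by (simp add: tensor_section_def T.push_def frag_extend_sum)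
  also have "\<dots> = tensor_section Y (h y)"
    unfolding tensor_section_def
    using section_factor[OF X y] X.part_in_carrier[OF y] unit_left_carrier
    by (intro sum.cong) (simp_all add: T.push_simps rhom_ract[OF grhom_rhom[OF h]])
  finally show ?thesis .
qed

context
  assumes inf: "infinite (UNIV :: 'u set)" and A_small: "carrier A \<lesssim> (UNIV :: 'u set)"
begin

lemma A1_small: "carrier A1 \<lesssim> (UNIV :: 'u set)"
  using lepoll_trans[OF subset_imp_lepoll[OF gg.part_subset] A_small] by simp

abbreviation (input) tensor_A1 :: "(('a, 'u) rmodule, 'u \<Rightarrow> 'u, ('a, 'u) rmodule, 'u \<Rightarrow> 'u) ftor" where
  "tensor_A1 \<equiv> tensor_ftor A0 (\<otimes>) A1"

lemma is_functor_tensor_A1: "is_functor (ModR A0) (ModR A0) tensor_A1"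
  by (rule T.is_functor_tensor[OF inf A1_small])

text \<open>
  Both functors are compared through \<open>X(1)\<^sub>0 = X\<^sub>1 \<cong> X\<^sub>0 \<otimes> A\<^sub>1\<close>.
\<close>

lemma shift_tensor_nat_isomorphic:
  "nat_isomorphic (GrR A gr) (ModR A0) (degree_zero_ftor \<circ>\<^sub>F shift_ftor 1) (tensor_A1 \<circ>\<^sub>F degree_zero_ftor)"
proof (rule nat_isomorphicI[where \<eta> = "\<lambda>X. \<lambda>y\<in>homog X 1.
    emb (carrier (tensor A0 (degree_part X 0) (\<otimes>) A1)) (T.cls (degree_part X 0) (tensor_section X y))"])
  fix X :: "('a, 'u) grmodule" assume "X \<in> Obj (GrR A gr)"
  then have X: "graded_right_module A gr X" by simp
  interpret X: graded_group X "homog X" by (rule graded_right_module_graded_group[OF X])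
  let ?X0 = "degree_part X 0" and ?X1 = "degree_part X 1"
  let ?e = "emb (carrier (tensor A0 ?X0 (\<otimes>) A1)) :: _ \<Rightarrow> 'u"
  let ?\<eta> = "\<lambda>y\<in>homog X 1. ?e (T.cls ?X0 (tensor_section X y))"
  note XR = degree_zero_part[OF X]
  have X1: "right_module A0 ?X1" by (rule degree_part_right_module[OF X])
  note props = section_properties[OF X] and keys = section_keys[OF X]
  note e_inj = T.tensor_emb_inj[OF inf A1_small XR]
  have TX: "carrier (fobj tensor_A1 ?X0) = ?e ` carrier (tensor A0 ?X0 (\<otimes>) A1)"
    by (simp add: tensor_ftor_def)
  have \<eta>: "?\<eta> \<in> rhom A0 ?X1 (fobj tensor_A1 ?X0)"
  proof (rule rhomI)
    show "?\<eta> \<in> carrier ?X1 \<rightarrow>\<^sub>E carrier (fobj tensor_A1 ?X0)"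
      unfolding TX props(2)[symmetric] by auto
    fix y assume "y \<in> carrier ?X1"
    then have y: "y \<in> homog X 1" by simp
    show "?\<eta> (y \<star>\<^bsub>?X1\<^esub> a) = ?\<eta> y \<star>\<^bsub>fobj tensor_A1 ?X0\<^esub> a" if "a \<in> carrier A0" for a
      using T.tensor_copy_ract[OF inf A1_small XR keys[OF y] that] props(3)[OF y] that
        graded_right_module_ract[OF X y, of a 0] y by simp
    fix z assume "z \<in> carrier ?X1"
    then have z: "z \<in> homog X 1" by simp
    have "T.cls ?X0 (tensor_section X (y \<oplus>\<^bsub>X\<^esub> z)) = T.cls ?X0 (tensor_section X y + tensor_section X z)"
      using section_add[OF X y z] by (simp add: T.cls_eq_iff[OF XR] algebra_simps)
    then show "?\<eta> (y \<oplus>\<^bsub>?X1\<^esub> z) = ?\<eta> y \<oplus>\<^bsub>fobj tensor_A1 ?X0\<^esub> ?\<eta> z"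
      using T.tensor_copy_add[OF inf A1_small XR keys[OF y] keys[OF z]] y z X.part_add[OF y z] by simp
  qed
  have "bij_betw (\<lambda>y. T.cls ?X0 (tensor_section X y)) (homog X 1) (carrier (tensor A0 ?X0 (\<otimes>) A1))"
    using props(1,2) by (simp add: bij_betw_def)
  moreover have "bij_betw ?e (carrier (tensor A0 ?X0 (\<otimes>) A1)) (carrier (fobj tensor_A1 ?X0))"
    using e_inj by (simp add: bij_betw_def TX)
  ultimately have "bij_betw (?e \<circ> (\<lambda>y. T.cls ?X0 (tensor_section X y))) (homog X 1)
      (carrier (fobj tensor_A1 ?X0))"
    by (rule bij_betw_trans)
  then have "bij_betw ?\<eta> (carrier ?X1) (carrier (fobj tensor_A1 ?X0))"
    unfolding degree_part_simps by (rule bij_betw_cong[THEN iffD1, rotated]) simp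
  then show "is_iso (ModR A0) (fobj (degree_zero_ftor \<circ>\<^sub>F shift_ftor 1) X)
      (fobj (tensor_A1 \<circ>\<^sub>F degree_zero_ftor) X) ?\<eta>"
    using is_iso_ModR[OF X1 \<eta>] by (simp add: shift_ftor_def degree_part_shift)
  fix Y :: "('a, 'u) grmodule" and h assume "Y \<in> Obj (GrR A gr)" "h \<in> Hom (GrR A gr) X Y"
  then have Y: "graded_right_module A gr Y" and h: "h \<in> grhom A X Y" by simp_all
  have h0: "restrict h (homog X 0) \<in> rhom A0 ?X0 (degree_part Y 0)"
    using ftor_arr[OF is_functor_degree_zero, of X Y h] X Y h by simp
  have "farr tensor_A1 ?X0 (degree_part Y 0) (restrict h (homog X 0)) (?e (T.cls ?X0 (tensor_section X y))) =
      emb (carrier (tensor A0 (degree_part Y 0) (\<otimes>) A1)) (T.cls (degree_part Y 0) (tensor_section Y (h y)))"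
    if "y \<in> homog X 1" for y
    using T.tensor_ftor_apply[OF inf A1_small XR degree_zero_part[OF Y] h0 keys[OF that]]
      push_tensor_section[OF X h that] by simp
  then show "Comp (ModR A0) (fobj (degree_zero_ftor \<circ>\<^sub>F shift_ftor 1) X)
        (fobj (degree_zero_ftor \<circ>\<^sub>F shift_ftor 1) Y) (fobj (tensor_A1 \<circ>\<^sub>F degree_zero_ftor) Y)
        (\<lambda>y\<in>homog Y 1. emb (carrier (tensor A0 (degree_part Y 0) (\<otimes>) A1))
          (T.cls (degree_part Y 0) (tensor_section Y y)))
        (farr (degree_zero_ftor \<circ>\<^sub>F shift_ftor 1) X Y h) =
      Comp (ModR A0) (fobj (degree_zero_ftor \<circ>\<^sub>F shift_ftor 1) X)
        (fobj (tensor_A1 \<circ>\<^sub>F degree_zero_ftor) X) (fobj (tensor_A1 \<circ>\<^sub>F degree_zero_ftor) Y)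
        (farr (tensor_A1 \<circ>\<^sub>F degree_zero_ftor) X Y h) ?\<eta>"
    using grhom_homog[OF h]
    by (auto simp: shift_ftor_def compose_def fun_eq_iff restrict_def)
qed

lemma is_equivalence_tensor_A1: "is_equivalence (ModR A0) (ModR A0) tensor_A1"
  by (rule is_equivalence_conjugate[OF is_category_GrR is_category_ModR
        is_equivalence_degree_zero[OF inf A_small] is_equivalence_shift is_functor_tensor_A1
        shift_tensor_nat_isomorphic])

end

section \<open>Torsion\<close>

text \<open>
  As \<open>1 \<in> A\<^sub>0 = A\<^sub>1 A\<^sub>-\<^sub>1\<close>, every \<open>x\<close> is a sum of elements \<open>1 \<cdot> u \<cdot> (v x)\<close> with \<open>u\<close> of degree \<open>1 \<noteq> 0\<close>.
\<close>

lemma I_ideal_eq: "I_ideal A gr = carrier A"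
proof
  let ?N = "nonzero_degrees A gr" and ?P = "ideal_prod A (carrier A) (nonzero_degrees A gr)"
  have N_sub: "?N \<subseteq> carrier A"
  proof
    fix x assume "x \<in> ?N"
    then obtain c F where x: "x = finsum A c F" "\<forall>n\<in>F. c n \<in> gr n"
      unfolding nonzero_degrees_def by blast
    then show "x \<in> carrier A"
      unfolding x(1) using gg.part_in_carrier by (intro finsum_closed) blast
  qed
  have ideal_prod_sub: "ideal_prod A I J \<subseteq> carrier A" if "I \<subseteq> carrier A" "J \<subseteq> carrier A" for I J
  proof
    show "x \<in> carrier A" if "x \<in> ideal_prod A I J" for x
      using that by induction (use \<open>I \<subseteq> carrier A\<close> \<open>J \<subseteq> carrier A\<close> in auto)
  qed
  show "I_ideal A gr \<subseteq> carrier A"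
    unfolding I_ideal_def using ideal_prod_sub N_sub by simp
  have N1: "u \<in> ?N" if "u \<in> gr 1" for u
    unfolding nonzero_degrees_def
    using that gg.part_in_carrier[OF that]
    by (intro CollectI exI[of _ "\<lambda>n. u"] exI[of _ "{1}"]) (simp add: finsum_insert)
  show "carrier A \<subseteq> I_ideal A gr"
  proof
    fix x assume x: "x \<in> carrier A"
    have closed: "w \<otimes> x \<in> I_ideal A gr" if "w \<in> ideal_prod A (gr 1) (gr (- 1))" for w
      using that
    proof induction
      case (prod u v)
      then have uA: "u \<in> carrier A" and vA: "v \<in> carrier A" using gg.part_in_carrier by blast+
      have "\<one> \<otimes> u \<in> ?P" by (rule ideal_prod.prod[OF one_closed N1[OF prod(1)]])
      then have "u \<otimes> (v \<otimes> x) \<in> I_ideal A gr"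
        unfolding I_ideal_def using uA vA x by (intro ideal_prod.prod) simp_all
      then show ?case using uA vA x by (simp add: m_assoc)
    next
      case (sum s1 s2)
      have "s1 \<in> carrier A" "s2 \<in> carrier A"
        using sum(1,2) ideal_prod_sub[OF gg.part_subset gg.part_subset] by blast+
      then show ?case
        using ideal_prod.sum[of "s1 \<otimes> x" A ?P "carrier A" "s2 \<otimes> x"] sum(3,4) x
        unfolding I_ideal_def by (simp add: l_distr)
    qed
    have "\<one> \<in> ideal_prod A (gr 1) (gr (- 1))"
      using strong[of 1 "- 1"] one_in_gr0 by simp
    then show "x \<in> I_ideal A gr" using closed[of \<one>] x by simp
  qed
qed

end

subsection \<open>The class of zero modules\<close>

definition zero_modules ::
  "('a, 'x) ring_scheme \<Rightarrow> (int \<Rightarrow> 'a set) \<Rightarrow> ('a, 'u) grmodule set" where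
  "zero_modules A gr = {M. graded_right_module A gr M \<and> carrier M = {\<zero>\<^bsub>M\<^esub>}}"

lemma zero_modulesD:
  assumes "M \<in> zero_modules A gr"
  shows "right_module A M" and "carrier M = {\<zero>\<^bsub>M\<^esub>}"
  using assms graded_right_module_imp_right_module unfolding zero_modules_def by blast+

lemma zero_modulesI:
  assumes M: "graded_right_module A gr M" and "\<And>x. x \<in> carrier M \<Longrightarrow> x = \<zero>\<^bsub>M\<^esub>"
  shows "M \<in> zero_modules A gr"
  using assms(2) right_module_closed(3)[OF graded_right_module_imp_right_module[OF M]] M
  unfolding zero_modules_def by blast

lemma zero_modules_localizing:
  "localizing A gr (zero_modules A gr :: ('a, 'u) grmodule set)"
  unfolding localizing_def
proof (intro conjI allI ballI impI)
  let ?Z = "zero_modules A gr :: ('a, 'u) grmodule set"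
  show "?Z \<subseteq> Obj (GrR A gr)" by (auto simp: zero_modules_def)
next
  fix M N :: "('a, 'u) grmodule" and f
  assume M: "M \<in> zero_modules A gr" and "N \<in> Obj (GrR A gr)" and f: "f \<in> grhom A N M"
    and inj: "inj_on f (carrier N)"
  then have N: "graded_right_module A gr N" by simp
  have zero: "\<zero>\<^bsub>N\<^esub> \<in> carrier N"
    by (rule right_module_closed(3)[OF graded_right_module_imp_right_module[OF N]])
  show "N \<in> zero_modules A gr"
  proof (rule zero_modulesI[OF N])
    fix x assume x: "x \<in> carrier N"
    have "f x = f \<zero>\<^bsub>N\<^esub>"
      using rhom_in[OF grhom_rhom[OF f] x] rhom_in[OF grhom_rhom[OF f] zero] zero_modulesD(2)[OF M]
      by simp
    then show "x = \<zero>\<^bsub>N\<^esub>" by (rule inj_onD[OF inj _ x zero])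
  qed
next
  fix M N :: "('a, 'u) grmodule" and f
  assume M: "M \<in> zero_modules A gr" and "N \<in> Obj (GrR A gr)" and f: "f \<in> grhom A M N"
    and surj: "f ` carrier M = carrier N"
  then have N: "graded_right_module A gr N" by simp
  have "f \<zero>\<^bsub>M\<^esub> = \<zero>\<^bsub>N\<^esub>"
    by (rule rhom_zero[OF zero_modulesD(1)[OF M] graded_right_module_imp_right_module[OF N] grhom_rhom[OF f]])
  then show "N \<in> zero_modules A gr"
    unfolding zero_modules_def using N surj[symmetric] zero_modulesD(2)[OF M] by simp
next
  fix L N M :: "('a, 'u) grmodule" and f g
  assume L: "L \<in> zero_modules A gr" and N: "N \<in> zero_modules A gr" and "M \<in> Obj (GrR A gr)"
    and f: "f \<in> grhom A L M" and g: "g \<in> grhom A M N"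
    and ex: "inj_on f (carrier L) \<and> g ` carrier M = carrier N \<and> f ` carrier L = a_kernel M N g"
  then have M: "graded_right_module A gr M" by simp
  have "f \<zero>\<^bsub>L\<^esub> = \<zero>\<^bsub>M\<^esub>"
    by (rule rhom_zero[OF zero_modulesD(1)[OF L] graded_right_module_imp_right_module[OF M] grhom_rhom[OF f]])
  then have "f ` carrier L = {\<zero>\<^bsub>M\<^esub>}"
    unfolding zero_modulesD(2)[OF L] by simp
  then have kernel: "a_kernel M N g = {\<zero>\<^bsub>M\<^esub>}"
    using ex by simp
  have "x \<in> a_kernel M N g" if "x \<in> carrier M" for x
    using rhom_in[OF grhom_rhom[OF g] that] zero_modulesD(2)[OF N] that
    by (simp add: a_kernel_def kernel_def)
  then show "M \<in> zero_modules A gr"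
    using kernel by (intro zero_modulesI[OF M]) blast
next
  fix I :: "'u set" and X and \<iota> :: "'u \<Rightarrow> 'u \<Rightarrow> 'u" and M :: "('a, 'u) grmodule"
  assume M: "M \<in> Obj (GrR A gr)"
    and sum: "(\<forall>i\<in>I. X i \<in> zero_modules A gr \<and> \<iota> i \<in> grhom A (X i) M \<and> inj_on (\<iota> i) (carrier (X i))) \<and>
       direct_sum_of M I (\<lambda>i. \<iota> i ` carrier (X i))"
  have MM: "graded_right_module A gr M" using M by simp
  interpret M: right_module A M by (rule graded_right_module_imp_right_module[OF MM])
  have im: "\<iota> i ` carrier (X i) = {\<zero>\<^bsub>M\<^esub>}" if "i \<in> I" for i
  proof -
    have Xi: "X i \<in> zero_modules A gr" and \<iota>i: "\<iota> i \<in> grhom A (X i) M" using sum that by blast+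
    have "\<iota> i \<zero>\<^bsub>X i\<^esub> = \<zero>\<^bsub>M\<^esub>"
      by (rule rhom_zero[OF zero_modulesD(1)[OF Xi] M.right_module_axioms grhom_rhom[OF \<iota>i]])
    then show ?thesis using zero_modulesD(2)[OF Xi] by simp
  qed
  show "M \<in> zero_modules A gr"
  proof (rule zero_modulesI[OF MM])
    fix x assume x: "x \<in> carrier M"
    have "\<exists>!c. (\<forall>i\<in>I. c i \<in> \<iota> i ` carrier (X i)) \<and> (\<forall>i. i \<notin> I \<longrightarrow> c i = \<zero>\<^bsub>M\<^esub>) \<and>
        finite {i. c i \<noteq> \<zero>\<^bsub>M\<^esub>} \<and> x = finsum M c {i. c i \<noteq> \<zero>\<^bsub>M\<^esub>}"
      using conjunct2[OF sum] x unfolding direct_sum_of_def by blast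
    then obtain c where c: "\<forall>i\<in>I. c i \<in> \<iota> i ` carrier (X i)" "\<forall>i. i \<notin> I \<longrightarrow> c i = \<zero>\<^bsub>M\<^esub>"
      "x = finsum M c {i. c i \<noteq> \<zero>\<^bsub>M\<^esub>}" by blast
    have "c i = \<zero>\<^bsub>M\<^esub>" for i using im c(1,2) by (cases "i \<in> I") blast+
    then show "x = \<zero>\<^bsub>M\<^esub>" using c(3) by simp
  qed
qed

lemma zero_sub_graded:
  assumes X: "graded_right_module A gr X" and gr: "\<And>n. gr n \<subseteq> carrier A"
  shows "graded_right_module A gr (sub_grmodule X {\<zero>\<^bsub>X\<^esub>})"
proof (rule graded_right_moduleI)
  interpret X: graded_group X "homog X" by (rule graded_right_module_graded_group[OF X])
  interpret XX: right_module A X by (rule graded_right_module_imp_right_module[OF X])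
  have simps: "carrier (sub_grmodule X {\<zero>\<^bsub>X\<^esub>}) = {\<zero>\<^bsub>X\<^esub>}" "homog (sub_grmodule X {\<zero>\<^bsub>X\<^esub>}) n = {\<zero>\<^bsub>X\<^esub>}"
    "\<zero>\<^bsub>sub_grmodule X {\<zero>\<^bsub>X\<^esub>}\<^esub> = \<zero>\<^bsub>X\<^esub>" "x \<oplus>\<^bsub>sub_grmodule X {\<zero>\<^bsub>X\<^esub>}\<^esub> y = x \<oplus>\<^bsub>X\<^esub> y"
    "x \<star>\<^bsub>sub_grmodule X {\<zero>\<^bsub>X\<^esub>}\<^esub> a = x \<star>\<^bsub>X\<^esub> a" for n x y a
    using X.part_zero by (auto simp: sub_grmodule_def)
  have "abelian_group (sub_grmodule X {\<zero>\<^bsub>X\<^esub>})"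
    by (rule abelian_groupI) (simp_all add: simps)
  then show "right_module A (sub_grmodule X {\<zero>\<^bsub>X\<^esub>})"
    by (intro right_module.intro right_module_axioms.intro XX.R.ring_axioms)
      (simp_all add: simps XX.zero_ract)
  show "graded_projections (sub_grmodule X {\<zero>\<^bsub>X\<^esub>}) (homog (sub_grmodule X {\<zero>\<^bsub>X\<^esub>})) (\<lambda>n x. x)"
    by (auto simp: graded_projections_def simps hom_def)
  show "x \<star>\<^bsub>sub_grmodule X {\<zero>\<^bsub>X\<^esub>}\<^esub> a \<in> homog (sub_grmodule X {\<zero>\<^bsub>X\<^esub>}) (n + m)"
    if "x \<in> homog (sub_grmodule X {\<zero>\<^bsub>X\<^esub>}) n" "a \<in> gr m" for n m x a
    using that gr by (auto simp: simps intro!: XX.zero_ract)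
qed

lemma sub_grmodule_carrier:
  assumes "graded_right_module A gr X"
  shows "sub_grmodule X (carrier X) = X"
proof -
  interpret X: graded_group X "homog X" by (rule graded_right_module_graded_group[OF assms])
  have "(\<lambda>n. carrier X \<inter> homog X n) = homog X"
    using X.part_subset by blast
  then show ?thesis by (simp add: sub_grmodule_def)
qed

text \<open>
  The only torsion submodule is \<open>0\<close>, and, in the next lemma, the only submodule with a torsion quotient
  is the whole module, since such a quotient has just one element.
\<close>

lemma tors_sub_zero_modules:
  assumes Y: "graded_right_module A gr Y" and gr: "\<And>n. gr n \<subseteq> carrier A"
  shows "tors_sub A gr (zero_modules A gr) Y Y' \<longleftrightarrow> Y' = {\<zero>\<^bsub>Y\<^esub>}"
proof
  assume "tors_sub A gr (zero_modules A gr) Y Y'"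
  then show "Y' = {\<zero>\<^bsub>Y\<^esub>}"
    unfolding tors_sub_def zero_modules_def by (auto simp: sub_grmodule_def)
next
  assume "Y' = {\<zero>\<^bsub>Y\<^esub>}"
  moreover have "\<zero>\<^bsub>Y\<^esub> \<in> carrier Y"
    by (rule right_module_closed(3)[OF graded_right_module_imp_right_module[OF Y]])
  moreover have "carrier (sub_grmodule Y {\<zero>\<^bsub>Y\<^esub>}) = {\<zero>\<^bsub>sub_grmodule Y {\<zero>\<^bsub>Y\<^esub>}\<^esub>}"
    by (simp add: sub_grmodule_def)
  ultimately show "tors_sub A gr (zero_modules A gr) Y Y'"
    using zero_sub_graded[OF Y gr] unfolding tors_sub_def graded_submodule_def zero_modules_def by simp
qed

lemma cotors_sub_zero_modules:
  fixes X :: "('a, 'u) grmodule"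
  assumes X: "graded_right_module A gr X" and gr: "\<And>n. gr n \<subseteq> carrier A"
  shows "cotors_sub A gr (zero_modules A gr) X X' \<longleftrightarrow> X' = carrier X"
proof
  interpret XX: right_module A X by (rule graded_right_module_imp_right_module[OF X])
  assume "cotors_sub A gr (zero_modules A gr) X X'"
  then have sub: "X' \<subseteq> carrier X" "graded_right_module A gr (sub_grmodule X X')"
    and "in_class A (zero_modules A gr :: ('a, 'u) grmodule set) (quot_grmodule X X')"
    unfolding cotors_sub_def graded_submodule_def by blast+
  then obtain M :: "('a, 'u) grmodule" and f where "M \<in> zero_modules A gr" "bij_betw f (carrier M) (carrier (quot_grmodule X X'))"
    unfolding in_class_def by blast
  then obtain q where q: "a_rcosets\<^bsub>X\<^esub> X' = {q}"
    by (auto simp: zero_modules_def bij_betw_def quot_grmodule_def)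
  have zero: "\<zero>\<^bsub>X\<^esub> \<in> X'"
    using right_module_closed(3)[OF graded_right_module_imp_right_module[OF sub(2)]]
    by (simp add: sub_grmodule_def)
  have coset: "X' +>\<^bsub>X\<^esub> x = q" if "x \<in> carrier X" for x
    using q that by (auto simp: A_RCOSETS_def')
  have "x \<in> X'" if x: "x \<in> carrier X" for x
  proof -
    have "x \<in> X' +>\<^bsub>X\<^esub> x"
      using zero x by (auto simp: a_r_coset_def' intro!: bexI[of _ "\<zero>\<^bsub>X\<^esub>"])
    then have "x \<in> X' +>\<^bsub>X\<^esub> \<zero>\<^bsub>X\<^esub>"
      using coset[OF x] coset[OF XX.M.zero_closed] by simp
    then show ?thesis using sub(1) by (auto simp: a_r_coset_def' subset_iff)
  qed
  then show "X' = carrier X" using sub(1) by blast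
next
  assume X': "X' = carrier X"
  interpret XX: right_module A X by (rule graded_right_module_imp_right_module[OF X])
  interpret G: graded_group X "homog X" by (rule graded_right_module_graded_group[OF X])
  let ?Q = "quot_grmodule X (carrier X)" and ?S = "sub_grmodule X {\<zero>\<^bsub>X\<^esub>}"
  have coset: "carrier X +>\<^bsub>X\<^esub> x = carrier X" if x: "x \<in> carrier X" for x
  proof (intro equalityI subsetI)
    show "y \<in> carrier X" if "y \<in> carrier X +>\<^bsub>X\<^esub> x" for y
      using that x by (auto simp: a_r_coset_def')
    show "y \<in> carrier X +>\<^bsub>X\<^esub> x" if "y \<in> carrier X" for y
      using that x XX.M.a_assoc XX.M.l_neg
      by (auto simp: a_r_coset_def' intro!: bexI[of _ "y \<oplus>\<^bsub>X\<^esub> \<ominus>\<^bsub>X\<^esub> x"])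
  qed
  have zero: "\<zero>\<^bsub>X\<^esub> \<in> carrier X" by simp
  have Q_carrier: "carrier ?Q = {carrier X}"
    using coset zero by (auto simp: quot_grmodule_def A_RCOSETS_def')
  have set_add: "carrier X <+>\<^bsub>X\<^esub> carrier X = carrier X"
    using zero by (force simp: set_add_def')
  let ?f = "\<lambda>x\<in>{\<zero>\<^bsub>X\<^esub>}. carrier X"
  have S_simps: "carrier ?S = {\<zero>\<^bsub>X\<^esub>}" "x \<oplus>\<^bsub>?S\<^esub> y = x \<oplus>\<^bsub>X\<^esub> y" "x \<star>\<^bsub>?S\<^esub> a = x \<star>\<^bsub>X\<^esub> a" for x y a
    by (simp_all add: sub_grmodule_def)
  have "?f \<in> grhom A ?S ?Q"
  proof (rule grhomI)
    show "?f \<in> rhom A ?S ?Q"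
    proof (rule rhomI)
      show "?f \<in> carrier ?S \<rightarrow>\<^sub>E carrier ?Q"
        by (simp add: S_simps Q_carrier)
      show "?f (x \<oplus>\<^bsub>?S\<^esub> y) = ?f x \<oplus>\<^bsub>?Q\<^esub> ?f y" if "x \<in> carrier ?S" "y \<in> carrier ?S" for x y
        using that by (simp add: S_simps quot_grmodule_def set_add)
      show "?f (x \<star>\<^bsub>?S\<^esub> a) = ?f x \<star>\<^bsub>?Q\<^esub> a" if "x \<in> carrier ?S" "a \<in> carrier A" for x a
      proof -
        have "(\<Union>x\<in>carrier X. carrier X +>\<^bsub>X\<^esub> (x \<star>\<^bsub>X\<^esub> a)) = carrier X"
          using coset XX.ract_closed[OF _ that(2)] zero by auto
        then show ?thesis
          using that by (simp add: S_simps quot_grmodule_def XX.zero_ract)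
      qed
    qed
    show "?f x \<in> homog ?Q n" if "x \<in> homog ?S n" for n x
      using that coset[OF zero] G.part_zero[of n]
      by (auto simp: sub_grmodule_def quot_grmodule_def intro!: rev_image_eqI[of "\<zero>\<^bsub>X\<^esub>"])
  qed
  moreover have "bij_betw ?f (carrier ?S) (carrier ?Q)"
    by (simp add: S_simps Q_carrier bij_betw_def)
  moreover have "?S \<in> zero_modules A gr"
    using zero_sub_graded[OF X gr] by (simp add: zero_modules_def sub_grmodule_def)
  ultimately have "in_class A (zero_modules A gr :: ('a, 'u) grmodule set) ?Q"
    unfolding in_class_def by blast
  then show "cotors_sub A gr (zero_modules A gr) X X'"
    unfolding cotors_sub_def graded_submodule_def X' sub_grmodule_carrier[OF X] using X by simp
qed

section \<open>The Gabriel quotient by the zero modules\<close>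

text \<open>
  Modulo the zero modules, the only admissible denominators are \<open>X' = X\<close> and \<open>Y' = 0\<close>. A fraction is
  therefore a homomorphism \<open>X \<rightarrow> Y/0\<close>, and two fractions are identified only if they are equal.
\<close>

lemma zero_coset:
  assumes "right_module A Y" "y \<in> carrier Y"
  shows "{\<zero>\<^bsub>Y\<^esub>} +>\<^bsub>Y\<^esub> y = {y}"
proof -
  interpret right_module A Y by fact
  show ?thesis using assms(2) by (simp add: a_r_coset_def')
qed

lemma quot_zero_simps:
  assumes Y: "graded_right_module A gr Y"
  shows "carrier (quot_grmodule Y {\<zero>\<^bsub>Y\<^esub>}) = (\<lambda>y. {y}) ` carrier Y"
    and "homog (quot_grmodule Y {\<zero>\<^bsub>Y\<^esub>}) n = (\<lambda>y. {y}) ` homog Y n"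
    and "\<lbrakk>x \<in> carrier Y; y \<in> carrier Y\<rbrakk> \<Longrightarrow> {x} \<oplus>\<^bsub>quot_grmodule Y {\<zero>\<^bsub>Y\<^esub>}\<^esub> {y} = {x \<oplus>\<^bsub>Y\<^esub> y}"
    and "\<lbrakk>x \<in> carrier Y; a \<in> carrier A\<rbrakk> \<Longrightarrow> {x} \<star>\<^bsub>quot_grmodule Y {\<zero>\<^bsub>Y\<^esub>}\<^esub> a = {x \<star>\<^bsub>Y\<^esub> a}"
proof -
  interpret YY: right_module A Y by (rule graded_right_module_imp_right_module[OF Y])
  interpret Y: graded_group Y "homog Y" by (rule graded_right_module_graded_group[OF Y])
  note zc = zero_coset[OF YY.right_module_axioms]
  show "carrier (quot_grmodule Y {\<zero>\<^bsub>Y\<^esub>}) = (\<lambda>y. {y}) ` carrier Y"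
    using zc by (auto simp: quot_grmodule_def A_RCOSETS_def')
  show "homog (quot_grmodule Y {\<zero>\<^bsub>Y\<^esub>}) n = (\<lambda>y. {y}) ` homog Y n"
    unfolding quot_grmodule_def using zc Y.part_in_carrier by (simp cong: image_cong_simp)
  show "{x} \<oplus>\<^bsub>quot_grmodule Y {\<zero>\<^bsub>Y\<^esub>}\<^esub> {y} = {x \<oplus>\<^bsub>Y\<^esub> y}" if "x \<in> carrier Y" "y \<in> carrier Y"
    using that by (simp add: quot_grmodule_def set_add_def')
  show "{x} \<star>\<^bsub>quot_grmodule Y {\<zero>\<^bsub>Y\<^esub>}\<^esub> a = {x \<star>\<^bsub>Y\<^esub> a}" if "x \<in> carrier Y" "a \<in> carrier A"
    using that zc[OF YY.ract_closed] by (simp add: quot_grmodule_def)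
qed

lemma grhom_quot_zero:
  assumes X: "graded_right_module A gr X" and Y: "graded_right_module A gr Y"
  shows "grhom A X (quot_grmodule Y {\<zero>\<^bsub>Y\<^esub>}) = (\<lambda>f. \<lambda>x\<in>carrier X. {f x}) ` grhom A X Y"
proof (intro equalityI subsetI)
  interpret X: graded_group X "homog X" by (rule graded_right_module_graded_group[OF X])
  interpret Y: graded_group Y "homog Y" by (rule graded_right_module_graded_group[OF Y])
  note Xc = right_module_closed(1,2)[OF graded_right_module_imp_right_module[OF X]]
  note Yc = right_module_closed(1,2)[OF graded_right_module_imp_right_module[OF Y]]
  note q = quot_zero_simps[OF Y]
  show "F \<in> grhom A X (quot_grmodule Y {\<zero>\<^bsub>Y\<^esub>})" 
    if F_in: "F \<in> (\<lambda>f. \<lambda>x\<in>carrier X. {f x}) ` grhom A X Y" for F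
  proof -
    obtain f where f: "f \<in> grhom A X Y" and F: "F = (\<lambda>x\<in>carrier X. {f x})"
      using F_in by (rule imageE) 
    note fr = grhom_rhom[OF f]
    show ?thesis
      unfolding F
    proof (rule grhomI)
      show "(\<lambda>x\<in>carrier X. {f x}) \<in> rhom A X (quot_grmodule Y {\<zero>\<^bsub>Y\<^esub>})"
        by (rule rhomI) (simp_all add: q rhom_in[OF fr] Xc rhom_add[OF fr] rhom_ract[OF fr])
      show "(\<lambda>x\<in>carrier X. {f x}) x \<in> homog (quot_grmodule Y {\<zero>\<^bsub>Y\<^esub>}) n" if "x \<in> homog X n" for n x
        using that by (simp add: q X.part_in_carrier grhom_homog[OF f])
    qed
  qed
  fix F assume F: "F \<in> grhom A X (quot_grmodule Y {\<zero>\<^bsub>Y\<^esub>})"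
  note Fr = grhom_rhom[OF F]
  define f where "f = (\<lambda>x\<in>carrier X. the_elem (F x))"
  have Ff: "F x = {f x} \<and> f x \<in> carrier Y" if x: "x \<in> carrier X" for x
  proof -
    obtain y where "y \<in> carrier Y" "F x = {y}"
      using rhom_in[OF Fr x] unfolding q by (rule imageE)
    then show ?thesis using x by (simp add: f_def)
  qed
  have "f \<in> grhom A X Y"
  proof (rule grhomI)
    show "f \<in> rhom A X Y"
    proof (rule rhomI)
      have "f \<in> extensional (carrier X)" by (simp add: f_def)
      then show "f \<in> carrier X \<rightarrow>\<^sub>E carrier Y" using Ff by (auto simp: PiE_iff)
      show "f (x \<oplus>\<^bsub>X\<^esub> y) = f x \<oplus>\<^bsub>Y\<^esub> f y" if xy: "x \<in> carrier X" "y \<in> carrier X" for x y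
        using rhom_add[OF Fr xy] Ff[OF xy(1)] Ff[OF xy(2)] Ff[OF Xc(1)[OF xy]] by (simp add: q)
      show "f (x \<star>\<^bsub>X\<^esub> a) = f x \<star>\<^bsub>Y\<^esub> a" if xa: "x \<in> carrier X" "a \<in> carrier A" for x a
        using rhom_ract[OF Fr xa] Ff[OF xa(1)] Ff[OF Xc(2)[OF xa]] xa by (simp add: q)
    qed
    show "f x \<in> homog Y n" if x: "x \<in> homog X n" for n x
      using grhom_homog[OF F x] Ff[OF X.part_in_carrier[OF x]] by (auto simp: q)
  qed
  moreover have "F = (\<lambda>x\<in>carrier X. {f x})"
    using Ff rhom_ext[OF Fr] by (intro extensionalityI[of _ "carrier X"]) auto
  ultimately show "F \<in> (\<lambda>f. \<lambda>x\<in>carrier X. {f x}) ` grhom A X Y" by blast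
qed

context
  fixes A :: "('a, 'x) ring_scheme" and gr :: "int \<Rightarrow> 'a set"
  assumes gr_sub: "\<And>n. gr n \<subseteq> carrier A"
begin

abbreviation (input) Z where "Z \<equiv> zero_modules A gr"

lemma frac_of_hom_eq:
  assumes X: "graded_right_module A gr X" and Y: "graded_right_module A gr Y" and f: "f \<in> grhom A X Y"
  shows "frac_of_hom X Y f = (carrier X, {\<zero>\<^bsub>Y\<^esub>}, \<lambda>x\<in>carrier X. {f x})"
  unfolding frac_of_hom_def
  using zero_coset[OF graded_right_module_imp_right_module[OF Y] rhom_in[OF grhom_rhom[OF f]]]
  by (auto simp: fun_eq_iff restrict_def)

lemma fracs_zero_modules:
  assumes X: "graded_right_module A gr X" and Y: "graded_right_module A gr Y"
  shows "fracs A gr Z X Y = frac_of_hom X Y ` grhom A X Y"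
proof -
  have "fracs A gr Z X Y = {(carrier X, {\<zero>\<^bsub>Y\<^esub>}, F) | F. F \<in> grhom A X (quot_grmodule Y {\<zero>\<^bsub>Y\<^esub>})}"
    unfolding fracs_def cotors_sub_zero_modules[OF X gr_sub] tors_sub_zero_modules[OF Y gr_sub]
    by (auto simp: sub_grmodule_carrier[OF X])
  also have "\<dots> = (\<lambda>f. (carrier X, {\<zero>\<^bsub>Y\<^esub>}, \<lambda>x\<in>carrier X. {f x})) ` grhom A X Y"
    unfolding grhom_quot_zero[OF X Y] by blast
  also have "\<dots> = frac_of_hom X Y ` grhom A X Y"
    by (rule image_cong[OF refl]) (simp add: frac_of_hom_eq[OF X Y])
  finally show ?thesis .
qed

lemma frac_of_hom_inj:
  assumes X: "graded_right_module A gr X" and Y: "graded_right_module A gr Y"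
  shows "inj_on (frac_of_hom X Y) (grhom A X Y)"
proof (rule inj_onI)
  fix f g assume f: "f \<in> grhom A X Y" and g: "g \<in> grhom A X Y" and "frac_of_hom X Y f = frac_of_hom X Y g"
  then have eq: "(\<lambda>x\<in>carrier X. {f x}) = (\<lambda>x\<in>carrier X. {g x})"
    by (simp add: frac_of_hom_eq[OF X Y])
  show "f = g"
  proof (rule rhom_eqI[OF grhom_rhom[OF f] grhom_rhom[OF g]])
    show "f x = g x" if "x \<in> carrier X" for x
      using fun_cong[OF eq, of x] that by simp
  qed
qed

lemma frac_rel_zero_modules:
  assumes X: "graded_right_module A gr X" and Y: "graded_right_module A gr Y"
  shows "frac_rel A gr Z X Y = Id_on (fracs A gr Z X Y)"
proof -
  interpret YY: right_module A Y by (rule graded_right_module_imp_right_module[OF Y])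
  have "p = q" if pq: "(p, q) \<in> frac_rel A gr Z X Y" for p q
  proof -
    have "p \<in> fracs A gr Z X Y" "q \<in> fracs A gr Z X Y"
      using pq unfolding frac_rel_def by auto
    then obtain f g where f: "f \<in> grhom A X Y" "p = frac_of_hom X Y f"
      and g: "g \<in> grhom A X Y" "q = frac_of_hom X Y g"
      unfolding fracs_zero_modules[OF X Y] by blast
    have eq: "\<forall>x\<in>carrier X. {\<zero>\<^bsub>Y\<^esub>} <+>\<^bsub>Y\<^esub> {f x} = {\<zero>\<^bsub>Y\<^esub>} <+>\<^bsub>Y\<^esub> {g x}"
      using pq unfolding f(2) g(2) frac_of_hom_eq[OF X Y f(1)] frac_of_hom_eq[OF X Y g(1)]
        frac_rel_def cotors_sub_zero_modules[OF X gr_sub] tors_sub_zero_modules[OF Y gr_sub] by auto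
    have "f x = g x" if "x \<in> carrier X" for x
      using bspec[OF eq that] rhom_in[OF grhom_rhom[OF f(1)] that] rhom_in[OF grhom_rhom[OF g(1)] that]
      by (simp add: set_add_def')
    then show ?thesis
      using rhom_eqI[OF grhom_rhom[OF f(1)] grhom_rhom[OF g(1)]] f(2) g(2) by blast
  qed
  moreover have "(p, p) \<in> frac_rel A gr Z X Y" if p: "p \<in> fracs A gr Z X Y" for p
  proof -
    obtain f where f: "f \<in> grhom A X Y" "p = frac_of_hom X Y f"
      using p unfolding fracs_zero_modules[OF X Y] by blast
    then show ?thesis
      using p unfolding f(2) frac_of_hom_eq[OF X Y f(1)] frac_rel_def
        cotors_sub_zero_modules[OF X gr_sub] tors_sub_zero_modules[OF Y gr_sub] by auto
  qed
  moreover have "p \<in> fracs A gr Z X Y" if "(p, q) \<in> frac_rel A gr Z X Y" for p q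
    using that unfolding frac_rel_def by auto
  ultimately show ?thesis
    by (intro equalityI subrelI; unfold Id_on_iff; blast)
qed

lemma frac_class:
  assumes X: "graded_right_module A gr X" and Y: "graded_right_module A gr Y" and f: "f \<in> grhom A X Y"
  shows "frac_rel A gr Z X Y `` {frac_of_hom X Y f} = {frac_of_hom X Y f}"
  using f unfolding frac_rel_zero_modules[OF X Y] fracs_zero_modules[OF X Y] by auto

text \<open>
  With full numerators and zero denominators, the domain of the composite fraction is all of \<open>X\<close> and
  its denominator is \<open>{g 0} = {0}\<close>, so that fractions compose like the homomorphisms.
\<close>

lemma frac_comp_of_hom:
  assumes X: "graded_right_module A gr X" and Y: "graded_right_module A gr Y"
    and W: "graded_right_module A gr W" and f: "f \<in> grhom A X Y" and g: "g \<in> grhom A Y W"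
  shows "frac_comp (frac_of_hom Y W g) (frac_of_hom X Y f) = frac_of_hom X W (compose (carrier X) g f)"
proof -
  interpret YY: right_module A Y by (rule graded_right_module_imp_right_module[OF Y])
  note gf = grhom_compose[OF X f g]
  have fx: "f x \<in> carrier Y" if "x \<in> carrier X" for x
    using rhom_in[OF grhom_rhom[OF f] that] .
  have g0: "g \<zero>\<^bsub>Y\<^esub> = \<zero>\<^bsub>W\<^esub>"
    using rhom_zero[OF _ _ grhom_rhom[OF g]] graded_right_module_imp_right_module Y W by blast
  have num: "{x \<in> carrier X. (\<lambda>x\<in>carrier X. {f x}) x \<inter> carrier Y \<noteq> {}} = carrier X"
    using fx by auto
  have den: "(\<Union>y\<in>carrier Y \<inter> {\<zero>\<^bsub>Y\<^esub>}. (\<lambda>y\<in>carrier Y. {g y}) y) = {\<zero>\<^bsub>W\<^esub>}"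
    using g0 by auto
  have map: "(\<lambda>x\<in>carrier X. \<Union>y\<in>(\<lambda>x\<in>carrier X. {f x}) x \<inter> carrier Y. (\<lambda>y\<in>carrier Y. {g y}) y) =
      (\<lambda>x\<in>carrier X. {compose (carrier X) g f x})"
    using fx by (auto simp: fun_eq_iff restrict_def compose_def)
  show ?thesis
    unfolding frac_of_hom_eq[OF X Y f] frac_of_hom_eq[OF Y W g] frac_of_hom_eq[OF X W gf]
      frac_comp.simps Let_def num den map by (rule refl)
qed

lemma gabriel_relabelling:
  "relabelling (GrR A gr :: (('a, 'u) grmodule, 'u \<Rightarrow> 'u) cat) (gabriel_quotient A gr Z) (gabriel_ftor A gr Z)"
proof
  let ?C = "GrR A gr :: (('a, 'u) grmodule, 'u \<Rightarrow> 'u) cat"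
  let ?D = "gabriel_quotient A gr Z :: (('a, 'u) grmodule, 'u frac set) cat"
  let ?P = "gabriel_ftor A gr Z :: (('a, 'u) grmodule, 'u \<Rightarrow> 'u, ('a, 'u) grmodule, 'u frac set) ftor"
  have P: "farr ?P X Y f = {frac_of_hom X Y f}"
    if "graded_right_module A gr X" "graded_right_module A gr Y" "f \<in> grhom A X Y" for X Y f
    using frac_class[OF that] by (simp add: gabriel_ftor_def)
  show "is_category ?C" by (rule is_category_GrR)
  show "Obj ?D = Obj ?C" by (simp add: gabriel_quotient_def)
  show "fobj ?P X = X" for X by (simp add: gabriel_ftor_def)
  show "Id ?D X = farr ?P X X (Id ?C X)" for X
    by (simp add: gabriel_quotient_def gabriel_ftor_def)
  fix X Y assume "X \<in> Obj ?C" "Y \<in> Obj ?C"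
  then have X: "graded_right_module A gr X" and Y: "graded_right_module A gr Y" by simp_all
  have "Hom ?D X Y = (\<lambda>p. {p}) ` fracs A gr Z X Y"
    by (auto simp: gabriel_quotient_def quotient_def frac_rel_zero_modules[OF X Y])
  then have Hom: "Hom ?D X Y = (\<lambda>f. {frac_of_hom X Y f}) ` grhom A X Y"
    by (simp add: fracs_zero_modules[OF X Y] image_image)
  have "inj_on (\<lambda>f. {frac_of_hom X Y f}) (grhom A X Y)"
    using frac_of_hom_inj[OF X Y] by (simp add: inj_on_def)
  then have "bij_betw (\<lambda>f. {frac_of_hom X Y f}) (grhom A X Y) (Hom ?D X Y)"
    by (simp add: bij_betw_def Hom)
  then have "bij_betw (farr ?P X Y) (grhom A X Y) (Hom ?D X Y)"
    by (rule bij_betw_cong[THEN iffD1, rotated]) (simp add: P[OF X Y])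
  then show "bij_betw (farr ?P X Y) (Hom ?C X Y) (Hom ?D X Y)" by simp
  fix W f g assume "W \<in> Obj ?C" "f \<in> Hom ?C X Y" "g \<in> Hom ?C Y W"
  then have W: "graded_right_module A gr W" and f: "f \<in> grhom A X Y" and g: "g \<in> grhom A Y W" by simp_all
  note gf = grhom_compose[OF X f g]
  have "{frac_comp q p | q p. q \<in> {frac_of_hom Y W g} \<and> p \<in> {frac_of_hom X Y f}} =
      {frac_of_hom X W (compose (carrier X) g f)}"
    unfolding frac_comp_of_hom[OF X Y W f g, symmetric] by blast
  then show "Comp ?D X Y W (farr ?P Y W g) (farr ?P X Y f) = farr ?P X W (Comp ?C X Y W g f)"
    unfolding P[OF X Y f] P[OF Y W g] using frac_class[OF X W gf]
    by (simp add: gabriel_quotient_def P[OF X W gf])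
qed

lemma quotient_shift_eq:
  assumes X: "graded_right_module A gr X" and Y: "graded_right_module A gr Y" and f: "f \<in> grhom A X Y"
  shows "farr (quotient_shift A gr Z) X Y (farr (gabriel_ftor A gr Z) X Y f) =
    farr (gabriel_ftor A gr Z) (shift_by 1 X) (shift_by 1 Y) f"
proof -
  note X1 = shift_by_graded[OF X, of 1] and Y1 = shift_by_graded[OF Y, of 1]
  have f1: "f \<in> grhom A (shift_by 1 X) (shift_by 1 Y)"
    using f by (simp add: grhom_shift_by)
  have "frac_of_hom (shift_by 1 X) (shift_by 1 Y) f = frac_of_hom X Y f"
    unfolding frac_of_hom_eq[OF X Y f] frac_of_hom_eq[OF X1 Y1 f1] by simp
  then show ?thesis
    using frac_class[OF X Y f] frac_class[OF X1 Y1 f1]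
    by (simp add: quotient_shift_def gabriel_ftor_def shift_by_1[symmetric])
qed

end

section \<open>The equivalence of triples\<close>

text \<open>
  Since \<open>I\<^sub>A = A\<close> contains \<open>1\<close>, a module annihilated by \<open>I\<^sub>A\<close> is zero, and the zero modules already form
  a localizing subcategory.
\<close>

lemma (in strongly_graded_ring) Tors_eq: "Tors A gr = zero_modules A gr"
proof (rule equalityI)
  have annihilated: "{M \<in> Obj (GrR A gr). \<forall>x\<in>carrier M. \<forall>a\<in>I_ideal A gr. x \<star>\<^bsub>M\<^esub> a = \<zero>\<^bsub>M\<^esub>} \<subseteq> zero_modules A gr"
  proof
    fix M assume "M \<in> {M \<in> Obj (GrR A gr). \<forall>x\<in>carrier M. \<forall>a\<in>I_ideal A gr. x \<star>\<^bsub>M\<^esub> a = \<zero>\<^bsub>M\<^esub>}"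
    then have M: "graded_right_module A gr M" and ann: "\<And>x. x \<in> carrier M \<Longrightarrow> x \<star>\<^bsub>M\<^esub> \<one> = \<zero>\<^bsub>M\<^esub>"
      by (simp_all add: I_ideal_eq)
    interpret M: right_module A M by (rule graded_right_module_imp_right_module[OF M])
    show "M \<in> zero_modules A gr"
      by (rule zero_modulesI[OF M]) (use ann M.ract_one in force)
  qed
  show "Tors A gr \<subseteq> zero_modules A gr"
    unfolding Tors_def using zero_modules_localizing annihilated by blast
  have "M \<in> T" if M: "M \<in> zero_modules A gr"
    and T: "{M \<in> Obj (GrR A gr). \<forall>x\<in>carrier M. \<forall>a\<in>I_ideal A gr. x \<star>\<^bsub>M\<^esub> a = \<zero>\<^bsub>M\<^esub>} \<subseteq> T" for M T
  proof -
    interpret M: right_module A M by (rule zero_modulesD(1)[OF M])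
    have "x \<star>\<^bsub>M\<^esub> a = \<zero>\<^bsub>M\<^esub>" if "x \<in> carrier M" "a \<in> I_ideal A gr" for x a
      using that zero_modulesD(2)[OF M] M.zero_ract by (simp add: I_ideal_eq)
    then show ?thesis using M T unfolding zero_modules_def by auto
  qed
  then show "zero_modules A gr \<subseteq> Tors A gr"
    unfolding Tors_def by blast
qed

context strongly_graded_ring
begin

context
  assumes inf: "infinite (UNIV :: 'u set)" and A_small: "carrier A \<lesssim> (UNIV :: 'u set)"
begin

text \<open>
  The degree zero part of the copy of \<open>A\<close> and the copy of \<open>A\<^sub>0\<close> come from different embeddings into
  the universe; they are isomorphic through \<open>A\<^sub>0\<close> itself.
\<close>

lemma degree_zero_regular:
  fixes O0 :: "('a, 'u) rmodule"
  defines "O0 \<equiv> copy_module (degree_part (regular_module A gr) 0)"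
  shows "right_module A0 O0"
    and "isomorphic (ModR A0) (degree_part (copy_grmodule (regular_module A gr)) 0) O0"
    and "graded_right_module A gr (copy_grmodule (regular_module A gr) :: ('a, 'u) grmodule)"
proof -
  let ?R = "regular_module A gr" and ?Rz = "degree_part (regular_module A gr) 0"
  let ?e = "emb (carrier A) :: 'a \<Rightarrow> 'u" and ?ez = "emb (gr 0) :: 'a \<Rightarrow> 'u"
  let ?C = "copy_grmodule ?R :: ('a, 'u) grmodule"
  have R0: "right_module A0 ?Rz" by (rule degree_part_right_module[OF regular_module_graded])
  have e_inj: "inj_on ?e (carrier A)" by (rule inj_on_emb[OF A_small])
  then have R_inj: "inj_on (emb (carrier ?R) :: 'a \<Rightarrow> 'u) (carrier ?R)" by simp
  have "gr 0 \<lesssim> (UNIV :: 'u set)"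
    using lepoll_trans[OF subset_imp_lepoll[OF gg.part_subset] A_small] .
  then have e0_inj: "inj_on ?ez (gr 0)" by (rule inj_on_emb)
  show O0: "right_module A0 O0"
    unfolding O0_def using copy_module_right_module[OF _ R0] e0_inj by simp
  show C: "graded_right_module A gr ?C"
    using copy_grmodule_graded[OF _ regular_module_graded gg.part_subset] e_inj by simp
  have C0: "right_module A0 (degree_part ?C 0)"
    by (rule degree_part_right_module[OF C])
  have f: "restrict ?e (gr 0) \<in> rhom A0 ?Rz (degree_part ?C 0)"
  proof (rule rhomI)
    show "restrict ?e (gr 0) \<in> carrier ?Rz \<rightarrow>\<^sub>E carrier (degree_part ?C 0)" by simp
    show "restrict ?e (gr 0) (x \<oplus>\<^bsub>?Rz\<^esub> y) = restrict ?e (gr 0) x \<oplus>\<^bsub>degree_part ?C 0\<^esub> restrict ?e (gr 0) y"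
      if "x \<in> carrier ?Rz" "y \<in> carrier ?Rz" for x y
      using that copy_grmodule_add[OF R_inj, of x y] by (simp add: gg.part_add gg.part_in_carrier)
    show "restrict ?e (gr 0) (x \<star>\<^bsub>?Rz\<^esub> a) = restrict ?e (gr 0) x \<star>\<^bsub>degree_part ?C 0\<^esub> a"
      if "x \<in> carrier ?Rz" "a \<in> carrier A0" for x a
      using that copy_grmodule_ract[OF R_inj, of x a] gr_mult[of x 0 a 0] by (simp add: gg.part_in_carrier)
  qed
  have g: "restrict ?ez (gr 0) \<in> rhom A0 ?Rz O0"
    unfolding O0_def using rmodule_copy_iso[OF _ R0] e0_inj by simp
  let ?Cz = "degree_part ?C 0" and ?f = "restrict ?e (gr 0)" and ?g = "restrict ?ez (gr 0)"
  have f_bij: "bij_betw ?f (carrier ?Rz) (carrier ?Cz)"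
    using inj_on_subset[OF e_inj gg.part_subset] by (simp add: bij_betw_def inj_on_restrict_eq)
  have g_bij: "bij_betw ?g (carrier ?Rz) (carrier O0)"
    using e0_inj by (simp add: bij_betw_def inj_on_restrict_eq O0_def)
  let ?f' = "restrict (inv_into (carrier ?Rz) ?f) (carrier ?Cz)"
  have h: "compose (carrier ?Cz) ?g ?f' \<in> rhom A0 ?Cz O0"
    by (rule rhom_compose[OF rhom_inverse(1)[OF R0 f f_bij] g right_module_closed(1,2)[OF C0]])
  have "bij_betw (?g \<circ> inv_into (carrier ?Rz) ?f) (carrier ?Cz) (carrier O0)"
    by (rule bij_betw_trans[OF bij_betw_inv_into[OF f_bij] g_bij])
  then have "bij_betw (compose (carrier ?Cz) ?g ?f') (carrier ?Cz) (carrier O0)"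
    by (rule bij_betw_cong[THEN iffD1, rotated]) (simp add: compose_eq)
  then show "isomorphic (ModR A0) ?Cz O0"
    using is_iso_ModR[OF C0 h] unfolding isomorphic_def by blast
qed

text \<open>
  The Gabriel quotient is \<open>Gr-A\<close> up to the names of its morphisms. Removing the names turns the induced
  shift into the shift of graded modules, so that everything reduces to Dade's theorem and to
  \<open>X(1)\<^sub>0 \<cong> X\<^sub>0 \<otimes> A\<^sub>1\<close>.
\<close>

theorem proj_triple_equivalence:
  fixes G
  defines "G \<equiv> degree_zero_ftor \<circ>\<^sub>F unlabel (GrR A gr) (gabriel_ftor A gr (zero_modules A gr :: ('a, 'u) grmodule set))"
  shows "is_triple_equivalence
      (gabriel_quotient A gr (zero_modules A gr :: ('a, 'u) grmodule set),
       fobj (gabriel_ftor A gr (zero_modules A gr)) (copy_grmodule (regular_module A gr)),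
       quotient_shift A gr (zero_modules A gr))
      (ModR A0, copy_module (degree_part (regular_module A gr) 0), tensor_ftor A0 (\<otimes>) A1) G"
    and "ftor_eq_on (GrR A gr) (G \<circ>\<^sub>F gabriel_ftor A gr (zero_modules A gr)) degree_zero_ftor"
proof -
  let ?Z = "zero_modules A gr :: ('a, 'u) grmodule set"
  let ?C = "GrR A gr :: (('a, 'u) grmodule, 'u \<Rightarrow> 'u) cat"
  let ?D = "gabriel_quotient A gr ?Z" and ?P = "gabriel_ftor A gr ?Z" and ?s = "quotient_shift A gr ?Z"
  let ?M = "ModR A0 :: (('a, 'u) rmodule, 'u \<Rightarrow> 'u) cat"
  let ?t = "tensor_ftor A0 (\<otimes>) A1 :: (('a, 'u) rmodule, 'u \<Rightarrow> 'u, ('a, 'u) rmodule, 'u \<Rightarrow> 'u) ftor"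
  let ?O = "copy_grmodule (regular_module A gr) :: ('a, 'u) grmodule"
  interpret Q: relabelling ?C ?D ?P by (rule gabriel_relabelling[OF gg.part_subset])
  let ?U = "unlabel ?C ?P"
  note D = Q.is_category_target and U = Q.is_functor_unlabel
  note deg0 = is_functor_degree_zero and eqv = is_equivalence_degree_zero[OF inf A_small]
  have G: "is_equivalence ?D ?M G"
    unfolding G_def
    by (rule is_equivalence_comp[OF D is_category_GrR is_category_ModR Q.is_equivalence_unlabel eqv])
  have shift_obj: "shift_by 1 X \<in> Obj ?C" if "X \<in> Obj ?C" for X
    using that shift_by_graded by simp
  have s_P: "farr ?s X Y (farr ?P X Y f) = farr ?P (shift_by 1 X) (shift_by 1 Y) f"
    if "X \<in> Obj ?C" "Y \<in> Obj ?C" "f \<in> Hom ?C X Y" for X Y f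
    using that quotient_shift_eq[OF gg.part_subset, where X = X and Y = Y and f = f] by simp
  have fobj_s: "fobj ?s X = shift_by 1 X" for X
    by (simp add: quotient_shift_def shift_by_1)
  \<comment> \<open>The shift of graded modules, carried over to the quotient along the renaming.\<close>
  let ?s' = "?P \<circ>\<^sub>F (shift_ftor 1 \<circ>\<^sub>F ?U)"
  have shiftU: "is_functor ?D ?C (shift_ftor 1 \<circ>\<^sub>F ?U)"
    by (rule is_functor_comp[OF U is_functor_shift])
  have s'_eqv: "is_equivalence ?D ?D ?s'"
    by (intro is_equivalence_comp[OF D is_category_GrR D _ Q.is_equivalence_relabel]
        is_equivalence_comp[OF D is_category_GrR is_category_GrR Q.is_equivalence_unlabel
          is_equivalence_shift])
  have s'_s: "ftor_eq_on ?D ?s' ?s"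
    unfolding ftor_eq_on_def Q.Obj_eq
  proof (intro conjI ballI)
    fix X Y \<phi> assume X: "X \<in> Obj ?C" and Y: "Y \<in> Obj ?C" and "\<phi> \<in> Hom ?D X Y"
    then obtain f where f: "f \<in> Hom ?C X Y" "\<phi> = farr ?P X Y f"
      using Q.Hom_cases by blast
    then show "farr ?s' X Y \<phi> = farr ?s X Y \<phi>"
      using Q.unlabel_farr[OF X Y f(1)] s_P[OF X Y f(1)]
      by (simp add: shift_ftor_def Q.fobj_unlabel)
  qed (simp add: Q.fobj_eq Q.fobj_unlabel fobj_s shift_ftor_def)
  have s: "is_functor ?D ?D ?s"
    by (rule is_functor_ftor_eq_on[OF D is_equivalence_functor[OF s'_eqv] s'_s])
  have s_eqv: "is_equivalence ?D ?D ?s"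
    by (rule is_equivalence_nat_isomorphic[OF D D s'_eqv s
          nat_isomorphic_ftor_eq_on[OF D is_equivalence_functor[OF s'_eqv] s'_s]])
  have "ftor_eq_on ?D (G \<circ>\<^sub>F ?s) ((degree_zero_ftor \<circ>\<^sub>F shift_ftor 1) \<circ>\<^sub>F ?U)"
    unfolding ftor_eq_on_def Q.Obj_eq
  proof (intro conjI ballI)
    fix X Y \<phi> assume X: "X \<in> Obj ?C" and Y: "Y \<in> Obj ?C" and "\<phi> \<in> Hom ?D X Y"
    then obtain f where f: "f \<in> Hom ?C X Y" "\<phi> = farr ?P X Y f"
      using Q.Hom_cases by blast
    have f1: "f \<in> Hom ?C (shift_by 1 X) (shift_by 1 Y)"
      using f(1) by (simp add: grhom_shift_by)
    show "farr (G \<circ>\<^sub>F ?s) X Y \<phi> = farr ((degree_zero_ftor \<circ>\<^sub>F shift_ftor 1) \<circ>\<^sub>F ?U) X Y \<phi>"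
      using Q.unlabel_farr[OF X Y f(1)] s_P[OF X Y f(1)]
        Q.unlabel_farr[OF shift_obj[OF X] shift_obj[OF Y] f1]
      by (simp add: G_def f(2) fobj_s shift_ftor_def Q.fobj_unlabel)
  qed (simp add: G_def Q.fobj_unlabel fobj_s shift_ftor_def)
  then have "nat_isomorphic ?D ?M (G \<circ>\<^sub>F ?s) ((degree_zero_ftor \<circ>\<^sub>F shift_ftor 1) \<circ>\<^sub>F ?U)"
    by (rule nat_isomorphic_ftor_eq_on[OF is_category_ModR is_functor_comp[OF s is_equivalence_functor[OF G]]])
  moreover have "nat_isomorphic ?D ?M ((degree_zero_ftor \<circ>\<^sub>F shift_ftor 1) \<circ>\<^sub>F ?U) (?t \<circ>\<^sub>F G)"
    using nat_isomorphic_whisker_right[OF U shift_tensor_nat_isomorphic[OF inf A_small]]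
    by (simp add: G_def comp_ftor_assoc)
  ultimately have Gs: "nat_isomorphic ?D ?M (G \<circ>\<^sub>F ?s) (?t \<circ>\<^sub>F G)"
    by (rule nat_isomorphic_trans[OF is_category_ModR is_functor_comp[OF s is_equivalence_functor[OF G]]
          is_functor_comp[OF U is_functor_comp[OF is_functor_shift deg0]]
          is_functor_comp[OF is_equivalence_functor[OF G] is_functor_tensor_A1[OF inf A_small]]])
  have "is_triple (?D, fobj ?P ?O, ?s)"
    unfolding is_triple_def using D s_eqv degree_zero_regular(3) by (simp add: Q.Obj_eq Q.fobj_eq)
  moreover have "is_triple (?M, copy_module (degree_part (regular_module A gr) 0), ?t)"
    unfolding is_triple_def
    using is_category_ModR degree_zero_regular(1) is_equivalence_tensor_A1[OF inf A_small] by simp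
  moreover have "isomorphic ?M (fobj G (fobj ?P ?O)) (copy_module (degree_part (regular_module A gr) 0))"
    using degree_zero_regular(2) by (simp add: G_def Q.fobj_eq Q.fobj_unlabel)
  ultimately show "is_triple_equivalence (?D, fobj ?P ?O, ?s)
      (?M, copy_module (degree_part (regular_module A gr) 0), ?t) G"
    unfolding is_triple_equivalence_def using G Gs by simp
  show "ftor_eq_on ?C (G \<circ>\<^sub>F ?P) degree_zero_ftor"
    unfolding ftor_eq_on_def G_def
    by (simp add: Q.fobj_eq Q.fobj_unlabel) (simp add: Q.unlabel_farr)
qed

end

end

lemma (in strongly_graded_algebra) strongly_graded_ring: "strongly_graded_ring A gr"
  by (intro strongly_graded_ring.intro graded_ring.intro graded_ring_axioms.intro
      strongly_graded_ring_axioms.intro A.ring_axioms direct_sum gr_mult strong)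

theorem proposition3p3:
  fixes K :: "('k, 'q) ring_scheme"
    and A :: "('k, 'a, 'x) module_scheme"
    and gr :: "int \<Rightarrow> 'a set"
  assumes "strongly_graded_algebra K A gr"
    and "infinite (UNIV :: 'u set)"
    and "\<exists>e :: 'a \<Rightarrow> 'u. inj_on e (carrier A)"
  shows "I_ideal A gr = carrier A \<and>
    (Tors A gr :: ('a, 'u) grmodule set) =
      {M. graded_right_module A gr M \<and> carrier M = {\<zero>\<^bsub>M\<^esub>}} \<and>
    (\<exists>G. is_triple_equivalence
           (proj_triple A gr :: (('a, 'u) grmodule, 'u frac set) triple) (mod_triple A gr) G \<and>
         ftor_eq_on (GrR A gr) (G \<circ>\<^sub>F gabriel_ftor A gr (Tors A gr)) degree_zero_ftor)"
proof -
  interpret strongly_graded_ring A gr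
    by (rule strongly_graded_algebra.strongly_graded_ring[OF assms(1)])
  have "carrier A \<lesssim> (UNIV :: 'u set)"
    using assms(3) by (simp add: lepoll_def)
  note equivalence = proj_triple_equivalence[OF assms(2) this]
  have "Tors A gr = {M :: ('a, 'u) grmodule. graded_right_module A gr M \<and> carrier M = {\<zero>\<^bsub>M\<^esub>}}"
    unfolding Tors_eq zero_modules_def ..
  moreover have "\<exists>G. is_triple_equivalence
      (proj_triple A gr :: (('a, 'u) grmodule, 'u frac set) triple) (mod_triple A gr) G \<and>
      ftor_eq_on (GrR A gr) (G \<circ>\<^sub>F gabriel_ftor A gr (Tors A gr)) degree_zero_ftor"
    unfolding proj_triple_def mod_triple_def Let_def Tors_eq degree_zero_ring_def
    using equivalence by blast
  ultimately show ?thesis using I_ideal_eq by blast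
qed

end
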